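(* Let $\mathcal{A}$ be an abelian category with enough projective objects. If every Gorenstein projective object in $\mathcal{A}$ is periodic, then for any object $M$ of $\mathcal{A}$ with $\operatorname{Gpd}_{\mathcal{A}} M<\infty$ one has $\operatorname{qpd}_{\mathcal{A}} M=\operatorname{Gpd}_{\mathcal{A}} M$.
   Context: Complexes $X_\bullet=(\cdots\to X_{i+1}\xrightarrow{d_{i+1}}X_i\xrightarrow{d_i}X_{i-1}\to\cdots)$ are indexed homologically; $\operatorname{sup}X_\bullet=\sup\{i\mid X_i\neq 0\}$, $\operatorname{inf}X_\bullet=\inf\{i\mid X_i\ne 0\}$, $\operatorname{hsup}X_\bullet=\sup\{i\mid \operatorname{H}_i(X_\bullet)\neq 0\}$. A complex is bounded below if $\operatorname{inf}X_\bullet>-\infty$. An object $G$ of $\mathcal{A}$ is Gorenstein projective if there is an exact sequence $\cdots\to P_1\to P_0\to P_{-1}\to P_{-2}\to\cdots$ of projective objects which stays exact after applying $\operatorname{Hom}_{\mathcal{A}}(-,P)$ for every projective $P$, such that $G\cong\operatorname{Im}(P_0\to P_{-1})$. The Gorenstein projective dimension $\operatorname{Gpd}_{\mathcal{A}}M$ is the smallest integer $n\ge 0$ such that there is an exact sequence $0\to G_n\to\cdots\to G_0\to M\to 0$ with all $G_i$ Gorenstein projective, and $\infty$ if there is no such sequence. An object $M$ is periodic if $\Omega^r M\cong M$ for some integer $r\geq 1$, i.e. there is an exact sequence $0\to M\to P_{r-1}\to\cdots\to P_0\to M\to 0$ with all $P_i$ projective and $r\ge 1$. A quasi-projective resolution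 of $M$ is a bounded below complex $P_\bullet$ of projective objects such that for all $i\geq\operatorname{inf}P_\bullet$ there are nonnegative integers $a_i$, not all zero, with $\operatorname{H}_i(P_\bullet)\cong M^{\oplus a_i}$; it is finite if $\operatorname{sup}P_\bullet<\infty$. The quasi-projective dimension is $\operatorname{qpd}_{\mathcal{A}}M=\inf\{\operatorname{sup}P_\bullet-\operatorname{hsup}P_\bullet\mid P_\bullet\text{ a finite quasi-projective resolution of }M\}$, and $\operatorname{qpd}_{\mathcal{A}}M=\infty$ if $M$ has no finite quasi-projective resolution. By convention $\operatorname{qpd}_{\mathcal{A}}0=0$. *)

theory Defs
  imports "HOL-Algebra.Group" "HOL-Library.Extended_Real"
begin

section \<open>Abelian categories\<close>

text \<open>
  The operations are only meaningful on the objects in \<open>Ob\<close> and the arrows in \<open>Arr\<close>; every arrow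
  determines its domain and codomain, so distinct Hom-sets are disjoint.  \<open>Zero a b\<close> is the
  neutral element of the group \<open>Hom(a, b)\<close>.
\<close>

record ('o, 'm) cat =
  Ob :: "'o set"
  Arr :: "'m set"
  Dom :: "'m \<Rightarrow> 'o"
  Cod :: "'m \<Rightarrow> 'o"
  Id :: "'o \<Rightarrow> 'm"
  Comp :: "'m \<Rightarrow> 'm \<Rightarrow> 'm"  (infixl "\<cdot>\<index>" 70)
  Zero :: "'o \<Rightarrow> 'o \<Rightarrow> 'm"
  Plus :: "'m \<Rightarrow> 'm \<Rightarrow> 'm"

definition Hom :: "('o, 'm) cat \<Rightarrow> 'o \<Rightarrow> 'o \<Rightarrow> 'm set" where
  "Hom A a b = {f \<in> Arr A. Dom A f = a \<and> Cod A f = b}"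

definition hom_group :: "('o, 'm) cat \<Rightarrow> 'o \<Rightarrow> 'o \<Rightarrow> 'm monoid" where
  "hom_group A a b = \<lparr>carrier = Hom A a b, mult = Plus A, one = Zero A a b\<rparr>"

locale category =
  fixes A :: "('o, 'm) cat" (structure)
  assumes Dom_in_Ob: "f \<in> Arr A \<Longrightarrow> Dom A f \<in> Ob A"
    and Cod_in_Ob: "f \<in> Arr A \<Longrightarrow> Cod A f \<in> Ob A"
    and Id_in_Hom: "a \<in> Ob A \<Longrightarrow> Id A a \<in> Hom A a a"
    and Comp_in_Hom: "\<lbrakk>f \<in> Hom A a b; g \<in> Hom A b c\<rbrakk> \<Longrightarrow> g \<cdot> f \<in> Hom A a c"
    and Comp_Id: "f \<in> Hom A a b \<Longrightarrow> f \<cdot> Id A a = f"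
    and Id_Comp: "f \<in> Hom A a b \<Longrightarrow> Id A b \<cdot> f = f"
    and Comp_assoc: "\<lbrakk>f \<in> Hom A a b; g \<in> Hom A b c; h \<in> Hom A c d\<rbrakk>
      \<Longrightarrow> (h \<cdot> g) \<cdot> f = h \<cdot> (g \<cdot> f)"

locale preadditive_category = category +
  assumes hom_comm_group: "\<lbrakk>a \<in> Ob A; b \<in> Ob A\<rbrakk> \<Longrightarrow> comm_group (hom_group A a b)"
    and Comp_Plus: "\<lbrakk>f \<in> Hom A a b; f' \<in> Hom A a b; g \<in> Hom A b c\<rbrakk>
      \<Longrightarrow> g \<cdot> Plus A f f' = Plus A (g \<cdot> f) (g \<cdot> f')"
    and Plus_Comp: "\<lbrakk>f \<in> Hom A a b; g \<in> Hom A b c; g' \<in> Hom A b c\<rbrakk>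
      \<Longrightarrow> Plus A g g' \<cdot> f = Plus A (g \<cdot> f) (g' \<cdot> f)"

definition is_zero :: "('o, 'm) cat \<Rightarrow> 'o \<Rightarrow> bool" where
  "is_zero A z \<longleftrightarrow> z \<in> Ob A \<and>
     (\<forall>x\<in>Ob A. (\<exists>!f. f \<in> Hom A z x) \<and> (\<exists>!f. f \<in> Hom A x z))"

definition monic :: "('o, 'm) cat \<Rightarrow> 'm \<Rightarrow> bool" where
  "monic A m \<longleftrightarrow> m \<in> Arr A \<and>
     (\<forall>x. \<forall>f\<in>Hom A x (Dom A m). \<forall>g\<in>Hom A x (Dom A m).
        m \<cdot>\<^bsub>A\<^esub> f = m \<cdot>\<^bsub>A\<^esub> g \<longrightarrow> f = g)"

definition epic :: "('o, 'm) cat \<Rightarrow> 'm \<Rightarrow> bool" where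
  "epic A e \<longleftrightarrow> e \<in> Arr A \<and>
     (\<forall>x. \<forall>f\<in>Hom A (Cod A e) x. \<forall>g\<in>Hom A (Cod A e) x.
        f \<cdot>\<^bsub>A\<^esub> e = g \<cdot>\<^bsub>A\<^esub> e \<longrightarrow> f = g)"

definition isomorphic :: "('o, 'm) cat \<Rightarrow> 'o \<Rightarrow> 'o \<Rightarrow> bool" where
  "isomorphic A a b \<longleftrightarrow> a \<in> Ob A \<and> b \<in> Ob A \<and>
     (\<exists>f\<in>Hom A a b. \<exists>g\<in>Hom A b a. g \<cdot>\<^bsub>A\<^esub> f = Id A a \<and> f \<cdot>\<^bsub>A\<^esub> g = Id A b)"

definition is_kernel :: "('o, 'm) cat \<Rightarrow> 'm \<Rightarrow> 'm \<Rightarrow> bool" where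
  "is_kernel A f k \<longleftrightarrow> f \<in> Arr A \<and> k \<in> Arr A \<and> Cod A k = Dom A f \<and>
     f \<cdot>\<^bsub>A\<^esub> k = Zero A (Dom A k) (Cod A f) \<and>
     (\<forall>x. \<forall>g\<in>Hom A x (Dom A f). f \<cdot>\<^bsub>A\<^esub> g = Zero A x (Cod A f) \<longrightarrow>
        (\<exists>!h. h \<in> Hom A x (Dom A k) \<and> k \<cdot>\<^bsub>A\<^esub> h = g))"

definition is_cokernel :: "('o, 'm) cat \<Rightarrow> 'm \<Rightarrow> 'm \<Rightarrow> bool" where
  "is_cokernel A f c \<longleftrightarrow> f \<in> Arr A \<and> c \<in> Arr A \<and> Dom A c = Cod A f \<and>
     c \<cdot>\<^bsub>A\<^esub> f = Zero A (Dom A f) (Cod A c) \<and>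
     (\<forall>x. \<forall>g\<in>Hom A (Cod A f) x. g \<cdot>\<^bsub>A\<^esub> f = Zero A (Dom A f) x \<longrightarrow>
        (\<exists>!h. h \<in> Hom A (Cod A c) x \<and> h \<cdot>\<^bsub>A\<^esub> c = g))"

definition is_biproduct ::
    "('o, 'm) cat \<Rightarrow> 'o \<Rightarrow> 'o \<Rightarrow> 'o \<Rightarrow> 'm \<Rightarrow> 'm \<Rightarrow> 'm \<Rightarrow> 'm \<Rightarrow> bool" where
  "is_biproduct A a b s i j p q \<longleftrightarrow>
     i \<in> Hom A a s \<and> j \<in> Hom A b s \<and> p \<in> Hom A s a \<and> q \<in> Hom A s b \<and>
     p \<cdot>\<^bsub>A\<^esub> i = Id A a \<and> q \<cdot>\<^bsub>A\<^esub> j = Id A b \<and>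
     p \<cdot>\<^bsub>A\<^esub> j = Zero A b a \<and> q \<cdot>\<^bsub>A\<^esub> i = Zero A a b \<and>
     Plus A (i \<cdot>\<^bsub>A\<^esub> p) (j \<cdot>\<^bsub>A\<^esub> q) = Id A s"

locale abelian_category = preadditive_category +
  assumes ex_zero: "\<exists>z. is_zero A z"
    and ex_biproduct: "\<lbrakk>a \<in> Ob A; b \<in> Ob A\<rbrakk> \<Longrightarrow> \<exists>s i j p q. is_biproduct A a b s i j p q"
    and ex_kernel: "f \<in> Arr A \<Longrightarrow> \<exists>k. is_kernel A f k"
    and ex_cokernel: "f \<in> Arr A \<Longrightarrow> \<exists>c. is_cokernel A f c"
    and monic_is_kernel: "monic A m \<Longrightarrow> \<exists>f. is_kernel A f m"
    and epic_is_cokernel: "epic A e \<Longrightarrow> \<exists>f. is_cokernel A f e"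

definition is_image :: "('o, 'm) cat \<Rightarrow> 'm \<Rightarrow> 'm \<Rightarrow> bool" where
  "is_image A f m \<longleftrightarrow> (\<exists>c. is_cokernel A f c \<and> is_kernel A c m)"

definition exact_pair :: "('o, 'm) cat \<Rightarrow> 'm \<Rightarrow> 'm \<Rightarrow> bool" where
  "exact_pair A f g \<longleftrightarrow> Cod A f = Dom A g \<and> (\<exists>m. is_image A f m \<and> is_kernel A g m)"

definition projective :: "('o, 'm) cat \<Rightarrow> 'o \<Rightarrow> bool" where
  "projective A P \<longleftrightarrow> P \<in> Ob A \<and>
     (\<forall>e. epic A e \<longrightarrow> (\<forall>f\<in>Hom A P (Cod A e). \<exists>g\<in>Hom A P (Dom A e). e \<cdot>\<^bsub>A\<^esub> g = f))"

definition enough_projectives :: "('o, 'm) cat \<Rightarrow> bool" where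
  "enough_projectives A \<longleftrightarrow>
     (\<forall>M\<in>Ob A. \<exists>P e. projective A P \<and> e \<in> Hom A P M \<and> epic A e)"

text \<open>\<open>is_copower A M n D\<close>: \<open>D\<close> is a coproduct \<open>M\<^sup>\<oplus>\<^sup>n\<close> of \<open>n\<close> copies of \<open>M\<close> (a zero object if \<open>n = 0\<close>).\<close>

definition is_copower :: "('o, 'm) cat \<Rightarrow> 'o \<Rightarrow> nat \<Rightarrow> 'o \<Rightarrow> bool" where
  "is_copower A M n D \<longleftrightarrow> M \<in> Ob A \<and> D \<in> Ob A \<and>
     (\<exists>i. (\<forall>k<n. i k \<in> Hom A M D) \<and>
        (\<forall>x\<in>Ob A. \<forall>f. (\<forall>k<n. f k \<in> Hom A M x) \<longrightarrow>
           (\<exists>!h. h \<in> Hom A D x \<and> (\<forall>k<n. h \<cdot>\<^bsub>A\<^esub> i k = f k))))"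


section \<open>Complexes\<close>

record ('o, 'm) chain =
  obj :: "int \<Rightarrow> 'o"
  diff :: "int \<Rightarrow> 'm"

definition chain_complex :: "('o, 'm) cat \<Rightarrow> ('o, 'm) chain \<Rightarrow> bool" where
  "chain_complex A X \<longleftrightarrow>
     (\<forall>i. obj X i \<in> Ob A \<and> diff X i \<in> Hom A (obj X i) (obj X (i - 1)) \<and>
          diff X i \<cdot>\<^bsub>A\<^esub> diff X (i + 1) = Zero A (obj X (i + 1)) (obj X (i - 1)))"

definition exact_complex :: "('o, 'm) cat \<Rightarrow> ('o, 'm) chain \<Rightarrow> bool" where
  "exact_complex A X \<longleftrightarrow> chain_complex A X \<and> (\<forall>i. exact_pair A (diff X (i + 1)) (diff X i))"

text \<open>The homology \<open>Ker d\<^sub>i / Im d\<^sub>i\<^sub>+\<^sub>1\<close> is the cokernel of the map \<open>X\<^sub>i\<^sub>+\<^sub>1 \<rightarrow> Ker d\<^sub>i\<close> induced by \<open>d\<^sub>i\<^sub>+\<^sub>1\<close>.\<close>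

definition is_homology :: "('o, 'm) cat \<Rightarrow> ('o, 'm) chain \<Rightarrow> int \<Rightarrow> 'o \<Rightarrow> bool" where
  "is_homology A X i H \<longleftrightarrow>
     (\<exists>k u c. is_kernel A (diff X i) k \<and>
        u \<in> Hom A (obj X (i + 1)) (Dom A k) \<and> k \<cdot>\<^bsub>A\<^esub> u = diff X (i + 1) \<and>
        is_cokernel A u c \<and> Cod A c = H)"

definition homology :: "('o, 'm) cat \<Rightarrow> ('o, 'm) chain \<Rightarrow> int \<Rightarrow> 'o" where
  "homology A X i = (SOME H. is_homology A X i H)"

definition csup :: "('o, 'm) cat \<Rightarrow> ('o, 'm) chain \<Rightarrow> ereal" where
  "csup A X = (SUP i\<in>{i. \<not> is_zero A (obj X i)}. ereal (real_of_int i))"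

definition cinf :: "('o, 'm) cat \<Rightarrow> ('o, 'm) chain \<Rightarrow> ereal" where
  "cinf A X = (INF i\<in>{i. \<not> is_zero A (obj X i)}. ereal (real_of_int i))"

definition hsup :: "('o, 'm) cat \<Rightarrow> ('o, 'm) chain \<Rightarrow> ereal" where
  "hsup A X = (SUP i\<in>{i. \<not> is_zero A (homology A X i)}. ereal (real_of_int i))"


section \<open>Gorenstein projective, periodic, and quasi-projective notions\<close>

text \<open>The last condition is exactness of
  \<open>Hom(X\<^sub>i\<^sub>-\<^sub>1, Q) \<rightarrow> Hom(X\<^sub>i, Q) \<rightarrow> Hom(X\<^sub>i\<^sub>+\<^sub>1, Q)\<close> at the middle term.\<close>

definition totally_acyclic :: "('o, 'm) cat \<Rightarrow> ('o, 'm) chain \<Rightarrow> bool" where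
  "totally_acyclic A X \<longleftrightarrow> exact_complex A X \<and> (\<forall>i. projective A (obj X i)) \<and>
     (\<forall>Q. projective A Q \<longrightarrow> (\<forall>i.
        {f \<in> Hom A (obj X i) Q. f \<cdot>\<^bsub>A\<^esub> diff X (i + 1) = Zero A (obj X (i + 1)) Q}
        = (\<lambda>g. g \<cdot>\<^bsub>A\<^esub> diff X i) ` Hom A (obj X (i - 1)) Q))"

definition gorenstein_projective :: "('o, 'm) cat \<Rightarrow> 'o \<Rightarrow> bool" where
  "gorenstein_projective A G \<longleftrightarrow>
     (\<exists>X m. totally_acyclic A X \<and> is_image A (diff X 0) m \<and> isomorphic A G (Dom A m))"

text \<open>
  Finite exact sequences ending in \<open>M \<rightarrow> 0\<close> are encoded as exact complexes with \<open>M\<close> in degree \<open>-1\<close>,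
  extended by zero objects on both sides.
\<close>

definition gproj_resolution :: "('o, 'm) cat \<Rightarrow> 'o \<Rightarrow> nat \<Rightarrow> ('o, 'm) chain \<Rightarrow> bool" where
  "gproj_resolution A M n X \<longleftrightarrow> exact_complex A X \<and> obj X (- 1) = M \<and>
     (\<forall>i. 0 \<le> i \<and> i \<le> int n \<longrightarrow> gorenstein_projective A (obj X i)) \<and>
     (\<forall>i. i < - 1 \<or> int n < i \<longrightarrow> is_zero A (obj X i))"

definition gpd :: "('o, 'm) cat \<Rightarrow> 'o \<Rightarrow> ereal" where
  "gpd A M = (INF n\<in>{n. \<exists>X. gproj_resolution A M n X}. ereal (real n))"

definition periodic :: "('o, 'm) cat \<Rightarrow> 'o \<Rightarrow> bool" where
  "periodic A M \<longleftrightarrow> (\<exists>r X. (1::int) \<le> r \<and> exact_complex A X \<and>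
     obj X (- 1) = M \<and> obj X r = M \<and>
     (\<forall>i. 0 \<le> i \<and> i < r \<longrightarrow> projective A (obj X i)) \<and>
     (\<forall>i. i < - 1 \<or> r < i \<longrightarrow> is_zero A (obj X i)))"

definition qproj_resolution :: "('o, 'm) cat \<Rightarrow> 'o \<Rightarrow> ('o, 'm) chain \<Rightarrow> bool" where
  "qproj_resolution A M X \<longleftrightarrow> chain_complex A X \<and> (\<forall>i. projective A (obj X i)) \<and>
     - \<infinity> < cinf A X \<and>
     (\<exists>a :: int \<Rightarrow> nat.
        (\<exists>i. cinf A X \<le> ereal (real_of_int i) \<and> a i \<noteq> 0) \<and>
        (\<forall>i. cinf A X \<le> ereal (real_of_int i) \<longrightarrow>
           (\<exists>D. is_copower A M (a i) D \<and> isomorphic A (homology A X i) D)))"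

definition finite_qproj_resolution :: "('o, 'm) cat \<Rightarrow> 'o \<Rightarrow> ('o, 'm) chain \<Rightarrow> bool" where
  "finite_qproj_resolution A M X \<longleftrightarrow> qproj_resolution A M X \<and> csup A X < \<infinity>"

text \<open>For a finite quasi-projective resolution of a nonzero \<open>M\<close> both suprema are finite, so the
  subtraction is that of integers.\<close>

definition qpd :: "('o, 'm) cat \<Rightarrow> 'o \<Rightarrow> ereal" where
  "qpd A M = (if is_zero A M then 0
     else (INF X\<in>{X. finite_qproj_resolution A M X}. csup A X - hsup A X))"

end

theory Submission
  imports Defs
begin

text \<open>
  Two inequalities are to be shown for a nonzero \<open>M\<close> of Gorenstein projective dimension \<open>n\<close>.

  For \<open>qpd M \<le> n\<close> a resolution is constructed.  The approximation of Auslander and Buchweitz gives a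
  short exact sequence \<open>0 \<rightarrow> L \<rightarrow> G \<rightarrow> M \<rightarrow> 0\<close> with \<open>G\<close> Gorenstein projective and \<open>L\<close> of projective
  dimension at most \<open>n - 1\<close> (\<open>L = 0\<close> if \<open>n = 0\<close>).  High syzygies of \<open>M\<close> and \<open>G\<close> agree, since those of
  \<open>L\<close> vanish, and \<open>G\<close> is periodic; hence \<open>G\<close> is a syzygy of \<open>M\<close>:
  \<open>0 \<rightarrow> G \<rightarrow> W\<^sub>s \<rightarrow> \<dots> \<rightarrow> W\<^sub>0 \<rightarrow> M \<rightarrow> 0\<close> with projective \<open>W\<^sub>i\<close> and \<open>s \<ge> 1\<close>.  Composing a projective resolution
  of \<open>L\<close> with \<open>L \<subseteq> G \<subseteq> W\<^sub>s\<close> yields the complex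
  \<open>L\<^sub>n\<^sub>-\<^sub>1 \<rightarrow> \<dots> \<rightarrow> L\<^sub>0 \<rightarrow> W\<^sub>s \<rightarrow> \<dots> \<rightarrow> W\<^sub>0\<close>, whose homology is \<open>G / L = M\<close> in degree \<open>s\<close> and \<open>M\<close> in degree \<open>0\<close>, and
  whose top degree is at most \<open>s + n\<close> (\<open>periodic_approximation\<close>, \<open>qproj_resolution_exists\<close>).

  For \<open>n \<le> qpd M\<close> let a finite quasi-projective resolution have top degree \<open>s\<close> and top homology in
  degree \<open>h\<close>.  Kernels of epimorphisms do not raise the dimension, so from a bound \<open>m + 1\<close> for the
  homology one gets the bound \<open>m\<close> for all cycles, by induction from the bottom.  The top part of the
  complex resolves the boundaries in degree \<open>h\<close> in length \<open>s - h - 1\<close>.  If \<open>m \<ge> s - h\<close>, the homology in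
  degree \<open>h\<close>, a nonempty sum of copies of \<open>M\<close>, thus has dimension at most \<open>m\<close>, and so has its summand \<open>M\<close>.
  This lowers the bound for \<open>M\<close> down to \<open>s - h\<close> (\<open>gdim_of_qproj_resolution\<close>).

  Both arguments only need to know between which objects short exact sequences exist, so these are
  manipulated as a relation \<open>ext\<close> on triples of objects.  The few closure properties of this relation
  (preimages, quotients, pullbacks, pushouts, horseshoes) are proved by diagram chases in which arrows
  out of projective objects serve as elements (\<open>sesI\<close>).  Gorenstein projective objects are handled
  through a coinductive predicate \<open>gp\<close> involving only an elementary form of \<open>Ext\<^sup>1(-, Q) = 0\<close>;
  complexes enter only at the end, where they are taken apart into short exact sequences or
  spliced from them.
\<close>

lemma hom_iff: "f \<in> Hom A a b \<longleftrightarrow> f \<in> Arr A \<and> Dom A f = a \<and> Cod A f = b"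
  by (simp add: Hom_def)

section \<open>Composition and addition of arrows\<close>

context category
begin

lemma Dom_Ob [simp]: "f \<in> Arr A \<Longrightarrow> Dom A f \<in> Ob A"
  and Cod_Ob [simp]: "f \<in> Arr A \<Longrightarrow> Cod A f \<in> Ob A"
  by (fact Dom_in_Ob Cod_in_Ob)+

lemma Hom_Ob: "f \<in> Hom A a b \<Longrightarrow> a \<in> Ob A \<and> b \<in> Ob A"
  by (auto simp: hom_iff)

lemma HomD:
  assumes "x \<in> Hom A a b"
  shows "x \<in> Arr A" "Dom A x = a" "Cod A x = b" "a \<in> Ob A" "b \<in> Ob A"
  using assms Hom_Ob[OF assms] by (simp_all add: hom_iff)

lemma Id_simps [simp]:
  assumes "a \<in> Ob A"
  shows "Id A a \<in> Arr A" "Dom A (Id A a) = a" "Cod A (Id A a) = a"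
  using Id_in_Hom[OF assms] by (auto simp: hom_iff)

lemma comp_simps [simp]:
  assumes "f \<in> Arr A" "g \<in> Arr A" "Cod A f = Dom A g"
  shows "g \<cdot> f \<in> Arr A" "Dom A (g \<cdot> f) = Dom A f" "Cod A (g \<cdot> f) = Cod A g"
  using Comp_in_Hom[of f "Dom A f" "Cod A f" g "Cod A g"] assms by (auto simp: hom_iff)

lemma comp_assoc [simp]:
  assumes "f \<in> Arr A" "g \<in> Arr A" "h \<in> Arr A" "Cod A f = Dom A g" "Cod A g = Dom A h"
  shows "(h \<cdot> g) \<cdot> f = h \<cdot> (g \<cdot> f)"
  using Comp_assoc[of f "Dom A f" "Cod A f" g "Cod A g" h "Cod A h"] assms by (auto simp: hom_iff)

lemma comp_Id [simp]: "f \<in> Arr A \<Longrightarrow> Dom A f = a \<Longrightarrow> f \<cdot> Id A a = f"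
  and Id_comp [simp]: "f \<in> Arr A \<Longrightarrow> Cod A f = b \<Longrightarrow> Id A b \<cdot> f = f"
  using Comp_Id[of f a "Cod A f"] Id_Comp[of f "Dom A f" b] by (auto simp: hom_iff)

text \<open>Carries an equation between composites past the right-nested normal form of composition.\<close>

lemma comp_eq_comp:
  assumes "g \<cdot> f = h" "f \<in> Arr A" "g \<in> Arr A" "Cod A f = Dom A g" "x \<in> Arr A" "Cod A x = Dom A f"
  shows "g \<cdot> (f \<cdot> x) = h \<cdot> x"
  using assms by (metis comp_assoc)

end

context preadditive_category
begin

lemma hom_group_simps [simp]:
  "carrier (hom_group A a b) = Hom A a b"
  "mult (hom_group A a b) = Plus A"
  "one (hom_group A a b) = Zero A a b"
  by (simp_all add: hom_group_def)

lemma Zero_simps [simp]: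
  assumes "a \<in> Ob A" "b \<in> Ob A"
  shows "Zero A a b \<in> Arr A" "Dom A (Zero A a b) = a" "Cod A (Zero A a b) = b"
proof -
  interpret comm_group "hom_group A a b" using assms by (rule hom_comm_group)
  show "Zero A a b \<in> Arr A" "Dom A (Zero A a b) = a" "Cod A (Zero A a b) = b"
    using one_closed by (auto simp: hom_iff)
qed

lemma Plus_simps [simp]:
  assumes "f \<in> Arr A" "g \<in> Arr A" "Dom A f = Dom A g" "Cod A f = Cod A g"
  shows "Plus A f g \<in> Arr A" "Dom A (Plus A f g) = Dom A g" "Cod A (Plus A f g) = Cod A g"
proof -
  interpret comm_group "hom_group A (Dom A f) (Cod A f)" using assms by (intro hom_comm_group) auto
  have "Plus A f g \<in> Hom A (Dom A f) (Cod A f)"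
    using m_closed[of f g] assms by (auto simp: hom_iff)
  thus "Plus A f g \<in> Arr A" "Dom A (Plus A f g) = Dom A g" "Cod A (Plus A f g) = Cod A g"
    using assms by (auto simp: hom_iff)
qed

lemma Plus_Zero [simp]:
  assumes "f \<in> Arr A" "Dom A f = a" "Cod A f = b"
  shows "Plus A f (Zero A a b) = f" "Plus A (Zero A a b) f = f"
proof -
  interpret comm_group "hom_group A a b" using assms by (intro hom_comm_group) auto
  show "Plus A f (Zero A a b) = f" "Plus A (Zero A a b) f = f"
    using l_one[of f] r_one[of f] assms by (auto simp: hom_iff)
qed

lemma Plus_assoc:
  assumes "f \<in> Hom A a b" "g \<in> Hom A a b" "h \<in> Hom A a b"
  shows "Plus A (Plus A f g) h = Plus A f (Plus A g h)"
proof -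
  interpret comm_group "hom_group A a b" using assms by (intro hom_comm_group) (auto simp: hom_iff)
  show ?thesis using m_assoc[of f g h] assms by auto
qed

lemma Plus_commute:
  assumes "f \<in> Hom A a b" "g \<in> Hom A a b"
  shows "Plus A f g = Plus A g f"
proof -
  interpret comm_group "hom_group A a b" using assms by (intro hom_comm_group) (auto simp: hom_iff)
  show ?thesis using m_comm[of f g] assms by auto
qed

definition neg :: "'b \<Rightarrow> 'b" where
  "neg f = m_inv (hom_group A (Dom A f) (Cod A f)) f"

lemma neg_simps [simp]:
  assumes "f \<in> Arr A"
  shows "neg f \<in> Arr A" "Dom A (neg f) = Dom A f" "Cod A (neg f) = Cod A f"
    "Plus A f (neg f) = Zero A (Dom A f) (Cod A f)"
    "Plus A (neg f) f = Zero A (Dom A f) (Cod A f)"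
proof -
  interpret comm_group "hom_group A (Dom A f) (Cod A f)" using assms by (intro hom_comm_group) auto
  have f: "f \<in> carrier (hom_group A (Dom A f) (Cod A f))" using assms by (simp add: hom_iff)
  show "neg f \<in> Arr A" "Dom A (neg f) = Dom A f" "Cod A (neg f) = Cod A f"
    "Plus A f (neg f) = Zero A (Dom A f) (Cod A f)"
    "Plus A (neg f) f = Zero A (Dom A f) (Cod A f)"
    using inv_closed[OF f] r_inv[OF f] l_inv[OF f] by (auto simp: neg_def hom_iff)
qed

lemma Plus_cancel:
  assumes "Plus A f g = Plus A f h" "f \<in> Hom A a b" "g \<in> Hom A a b" "h \<in> Hom A a b"
  shows "g = h"
proof -
  interpret comm_group "hom_group A a b" using assms by (intro hom_comm_group) (auto simp: hom_iff)
  show ?thesis using assms Units_l_cancel[of f g h] by (simp add: Units_eq)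
qed

lemma neg_unique:
  assumes "Plus A f g = Zero A a b" "f \<in> Hom A a b" "g \<in> Hom A a b"
  shows "g = neg f"
  by (rule Plus_cancel[of f g "neg f" a b]) (use assms in \<open>auto simp: hom_iff\<close>)

lemma comp_Plus [simp]:
  assumes "f \<in> Arr A" "f' \<in> Arr A" "g \<in> Arr A" "Dom A f = Dom A f'" "Cod A f = Cod A f'"
    "Cod A f' = Dom A g"
  shows "g \<cdot> Plus A f f' = Plus A (g \<cdot> f) (g \<cdot> f')"
  using Comp_Plus[of f "Dom A f" "Cod A f" f' g "Cod A g"] assms by (auto simp: hom_iff)

lemma Plus_comp [simp]:
  assumes "f \<in> Arr A" "g \<in> Arr A" "g' \<in> Arr A" "Dom A g = Dom A g'" "Cod A g = Cod A g'"
    "Cod A f = Dom A g'"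
  shows "Plus A g g' \<cdot> f = Plus A (g \<cdot> f) (g' \<cdot> f)"
  using Plus_Comp[of f "Dom A f" "Cod A f" g "Cod A g" g'] assms by (auto simp: hom_iff)

lemma comp_Zero [simp]:
  assumes "g \<in> Arr A" "a \<in> Ob A" "Dom A g = b"
  shows "g \<cdot> Zero A a b = Zero A a (Cod A g)"
proof -
  have b: "b \<in> Ob A" using assms by auto
  have "Plus A (g \<cdot> Zero A a b) (g \<cdot> Zero A a b) = g \<cdot> Plus A (Zero A a b) (Zero A a b)"
    using assms b by (simp del: Plus_Zero)
  also have "\<dots> = Plus A (g \<cdot> Zero A a b) (Zero A a (Cod A g))"
    using assms b by simp
  finally show ?thesis
    by (rule Plus_cancel[where a = a and b = "Cod A g"]) (use assms b in \<open>auto simp: hom_iff\<close>)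
qed

lemma Zero_comp [simp]:
  assumes "f \<in> Arr A" "c \<in> Ob A" "Cod A f = b"
  shows "Zero A b c \<cdot> f = Zero A (Dom A f) c"
proof -
  have b: "b \<in> Ob A" using assms by auto
  have "Plus A (Zero A b c \<cdot> f) (Zero A b c \<cdot> f) = Plus A (Zero A b c) (Zero A b c) \<cdot> f"
    using assms b by (simp del: Plus_Zero)
  also have "\<dots> = Plus A (Zero A b c \<cdot> f) (Zero A (Dom A f) c)"
    using assms b by simp
  finally show ?thesis
    by (rule Plus_cancel[where a = "Dom A f" and b = c]) (use assms b in \<open>auto simp: hom_iff\<close>)
qed

lemma neg_comp [simp]:
  assumes "f \<in> Arr A" "g \<in> Arr A" "Cod A f = Dom A g"
  shows "neg g \<cdot> f = neg (g \<cdot> f)"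
proof (rule neg_unique)
  show "Plus A (g \<cdot> f) (neg g \<cdot> f) = Zero A (Dom A f) (Cod A g)"
    using assms Plus_comp[of f g "neg g", symmetric] by simp
qed (use assms in \<open>auto simp: hom_iff\<close>)

lemma comp_neg [simp]:
  assumes "f \<in> Arr A" "g \<in> Arr A" "Cod A f = Dom A g"
  shows "g \<cdot> neg f = neg (g \<cdot> f)"
proof (rule neg_unique)
  show "Plus A (g \<cdot> f) (g \<cdot> neg f) = Zero A (Dom A f) (Cod A g)"
    using assms comp_Plus[of f "neg f" g, symmetric] by simp
qed (use assms in \<open>auto simp: hom_iff\<close>)

lemma neg_Zero [simp]: "a \<in> Ob A \<Longrightarrow> b \<in> Ob A \<Longrightarrow> neg (Zero A a b) = Zero A a b"
  by (rule neg_unique[symmetric]) (simp_all add: hom_iff)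

lemma diff_eq_zeroD:
  assumes "Plus A f (neg g) = Zero A a b" "f \<in> Hom A a b" "g \<in> Hom A a b"
  shows "f = g"
proof (rule Plus_cancel[of "neg g" f g a b])
  show "Plus A (neg g) f = Plus A (neg g) g"
    using assms Plus_commute[of f a b "neg g"] by (auto simp: hom_iff)
qed (use assms in \<open>auto simp: hom_iff\<close>)

lemma monicI:
  assumes "m \<in> Hom A a b" "\<And>t x. x \<in> Hom A t a \<Longrightarrow> m \<cdot> x = Zero A t b \<Longrightarrow> x = Zero A t a"
  shows "monic A m"
  unfolding monic_def
proof (intro conjI allI ballI impI)
  fix t f g assume fg: "f \<in> Hom A t (Dom A m)" "g \<in> Hom A t (Dom A m)" "m \<cdot> f = m \<cdot> g"
  have "m \<cdot> Plus A f (neg g) = Zero A t b" using fg assms(1) by (auto simp: hom_iff)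
  from assms(2)[OF _ this] have "Plus A f (neg g) = Zero A t a"
    using fg assms(1) by (auto simp: hom_iff)
  thus "f = g" by (rule diff_eq_zeroD) (use fg assms(1) in \<open>auto simp: hom_iff\<close>)
qed (use assms in \<open>auto simp: hom_iff\<close>)

lemma epicI:
  assumes "e \<in> Hom A a b" "\<And>t x. x \<in> Hom A b t \<Longrightarrow> x \<cdot> e = Zero A a t \<Longrightarrow> x = Zero A b t"
  shows "epic A e"
  unfolding epic_def
proof (intro conjI allI ballI impI)
  fix t f g assume fg: "f \<in> Hom A (Cod A e) t" "g \<in> Hom A (Cod A e) t" "f \<cdot> e = g \<cdot> e"
  have "Plus A f (neg g) \<cdot> e = Zero A a t" using fg assms(1) by (auto simp: hom_iff)
  from assms(2)[OF _ this] have "Plus A f (neg g) = Zero A b t"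
    using fg assms(1) by (auto simp: hom_iff)
  thus "f = g" by (rule diff_eq_zeroD) (use fg assms(1) in \<open>auto simp: hom_iff\<close>)
qed (use assms in \<open>auto simp: hom_iff\<close>)

lemma monicD:
  assumes "monic A m" "m \<cdot> x = m \<cdot> y" "m \<in> Hom A a b" "x \<in> Hom A t a" "y \<in> Hom A t a"
  shows "x = y"
  using assms unfolding monic_def by (auto simp: hom_iff)

lemma epicD:
  assumes "epic A e" "x \<cdot> e = y \<cdot> e" "e \<in> Hom A a b" "x \<in> Hom A b t" "y \<in> Hom A b t"
  shows "x = y"
  using assms unfolding epic_def by (auto simp: hom_iff)

section \<open>Monomorphisms, epimorphisms, kernels and cokernels\<close>

lemma epic_comp:
  assumes e: "epic A e" "e \<in> Hom A a b" and g: "epic A g" "g \<in> Hom A b c"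
  shows "epic A (g \<cdot> e)"
proof (rule epicI)
  note [simp] = HomD[OF e(2)] HomD[OF g(2)]
  show "g \<cdot> e \<in> Hom A a c" by (simp add: hom_iff)
  fix t x assume x: "x \<in> Hom A c t" "x \<cdot> (g \<cdot> e) = Zero A a t"
  note [simp] = HomD[OF x(1)]
  have "(x \<cdot> g) \<cdot> e = Zero A b t \<cdot> e" using x(2) by simp
  hence "x \<cdot> g = Zero A b t" by (rule epicD[OF e(1)]) (simp_all add: hom_iff)
  hence "x \<cdot> g = Zero A c t \<cdot> g" by simp
  thus "x = Zero A c t" by (rule epicD[OF g(1)]) (simp_all add: hom_iff)
qed

lemma monic_comp:
  assumes e: "monic A e" "e \<in> Hom A a b" and g: "monic A g" "g \<in> Hom A b c"
  shows "monic A (g \<cdot> e)"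
proof (rule monicI)
  note [simp] = HomD[OF e(2)] HomD[OF g(2)]
  show "g \<cdot> e \<in> Hom A a c" by (simp add: hom_iff)
  fix t x assume x: "x \<in> Hom A t a" "g \<cdot> e \<cdot> x = Zero A t c"
  note [simp] = HomD[OF x(1)]
  have "g \<cdot> (e \<cdot> x) = g \<cdot> Zero A t b" using x(2) by simp
  hence "e \<cdot> x = Zero A t b" by (rule monicD[OF g(1)]) (simp_all add: hom_iff)
  hence "e \<cdot> x = e \<cdot> Zero A t a" by simp
  thus "x = Zero A t a" by (rule monicD[OF e(1)]) (simp_all add: hom_iff)
qed

lemma is_kernelD:
  assumes "is_kernel A g f"
  shows "f \<in> Hom A (Dom A f) (Dom A g)" "g \<in> Arr A" "g \<cdot> f = Zero A (Dom A f) (Cod A g)" "monic A f"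
    "x \<in> Hom A t (Dom A g) \<Longrightarrow> g \<cdot> x = Zero A t (Cod A g) \<Longrightarrow> \<exists>h\<in>Hom A t (Dom A f). f \<cdot> h = x"
proof -
  show 1: "f \<in> Hom A (Dom A f) (Dom A g)" "g \<in> Arr A" "g \<cdot> f = Zero A (Dom A f) (Cod A g)"
    using assms by (auto simp: is_kernel_def hom_iff)
  show "\<exists>h\<in>Hom A t (Dom A f). f \<cdot> h = x" if "x \<in> Hom A t (Dom A g)" "g \<cdot> x = Zero A t (Cod A g)"
    using assms that unfolding is_kernel_def by blast
  show "monic A f"
  proof (rule monicI[OF 1(1)])
    fix t x assume x: "x \<in> Hom A t (Dom A f)" "f \<cdot> x = Zero A t (Dom A g)"
    hence t: "t \<in> Ob A" by (auto simp: hom_iff)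
    have "\<exists>!h. h \<in> Hom A t (Dom A f) \<and> f \<cdot> h = Zero A t (Dom A g)"
    proof -
      have "Zero A t (Dom A g) \<in> Hom A t (Dom A g)" "g \<cdot> Zero A t (Dom A g) = Zero A t (Cod A g)"
        using t 1 by (auto simp: hom_iff)
      thus ?thesis using assms unfolding is_kernel_def by blast
    qed
    moreover have "Zero A t (Dom A f) \<in> Hom A t (Dom A f) \<and> f \<cdot> Zero A t (Dom A f) = Zero A t (Dom A g)"
      using t 1 by (auto simp: hom_iff)
    ultimately show "x = Zero A t (Dom A f)" using x by blast
  qed
qed

lemma is_kernelI:
  assumes "f \<in> Hom A a b" "g \<in> Hom A b c" "g \<cdot> f = Zero A a c" "monic A f"
    "\<And>t x. x \<in> Hom A t b \<Longrightarrow> g \<cdot> x = Zero A t c \<Longrightarrow> \<exists>h\<in>Hom A t a. f \<cdot> h = x"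
  shows "is_kernel A g f"
  unfolding is_kernel_def
proof (intro conjI allI ballI impI)
  have [simp]: "Dom A g = b" "Cod A g = c" "Dom A f = a" using assms(1,2) by (auto simp: hom_iff)
  fix t x assume "x \<in> Hom A t (Dom A g)" "g \<cdot> x = Zero A t (Cod A g)"
  then obtain h where "h \<in> Hom A t a" "f \<cdot> h = x" using assms(5)[of x t] by auto
  moreover from this have "h' = h" if "h' \<in> Hom A t a" "f \<cdot> h' = x" for h'
    by (intro monicD[OF assms(4) _ assms(1), of h' h t]) (simp_all add: that)
  ultimately show "\<exists>!h. h \<in> Hom A t (Dom A f) \<and> f \<cdot> h = x" by auto
qed (use assms(1-4) in \<open>auto simp: hom_iff\<close>)

lemma is_cokernelD:
  assumes "is_cokernel A f g"
  shows "g \<in> Hom A (Cod A f) (Cod A g)" "f \<in> Arr A" "g \<cdot> f = Zero A (Dom A f) (Cod A g)" "epic A g"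
    "x \<in> Hom A (Cod A f) t \<Longrightarrow> x \<cdot> f = Zero A (Dom A f) t \<Longrightarrow> \<exists>h\<in>Hom A (Cod A g) t. h \<cdot> g = x"
proof -
  show 1: "g \<in> Hom A (Cod A f) (Cod A g)" "f \<in> Arr A" "g \<cdot> f = Zero A (Dom A f) (Cod A g)"
    using assms by (auto simp: is_cokernel_def hom_iff)
  show "\<exists>h\<in>Hom A (Cod A g) t. h \<cdot> g = x"
    if "x \<in> Hom A (Cod A f) t" "x \<cdot> f = Zero A (Dom A f) t"
    using assms that unfolding is_cokernel_def by blast
  show "epic A g"
  proof (rule epicI[OF 1(1)])
    fix t x assume x: "x \<in> Hom A (Cod A g) t" "x \<cdot> g = Zero A (Cod A f) t"
    hence t: "t \<in> Ob A" by (auto simp: hom_iff)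
    have "\<exists>!h. h \<in> Hom A (Cod A g) t \<and> h \<cdot> g = Zero A (Cod A f) t"
    proof -
      have "Zero A (Cod A f) t \<in> Hom A (Cod A f) t" "Zero A (Cod A f) t \<cdot> f = Zero A (Dom A f) t"
        using t 1 by (auto simp: hom_iff)
      thus ?thesis using assms unfolding is_cokernel_def by blast
    qed
    moreover have "Zero A (Cod A g) t \<in> Hom A (Cod A g) t \<and> Zero A (Cod A g) t \<cdot> g = Zero A (Cod A f) t"
      using t 1 by (auto simp: hom_iff)
    ultimately show "x = Zero A (Cod A g) t" using x by blast
  qed
qed

lemma is_kernel_simps:
  assumes "is_kernel A g f"
  shows "f \<in> Arr A" "g \<in> Arr A" "Cod A f = Dom A g"
  using assms by (simp_all add: is_kernel_def)

lemma is_cokernel_simps: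
  assumes "is_cokernel A f g"
  shows "f \<in> Arr A" "g \<in> Arr A" "Dom A g = Cod A f"
  using assms by (simp_all add: is_cokernel_def)

lemma is_cokernelI:
  assumes "f \<in> Hom A a b" "g \<in> Hom A b c" "g \<cdot> f = Zero A a c" "epic A g"
    "\<And>t x. x \<in> Hom A b t \<Longrightarrow> x \<cdot> f = Zero A a t \<Longrightarrow> \<exists>h\<in>Hom A c t. h \<cdot> g = x"
  shows "is_cokernel A f g"
  unfolding is_cokernel_def
proof (intro conjI allI ballI impI)
  have [simp]: "Cod A f = b" "Cod A g = c" "Dom A f = a" using assms(1,2) by (auto simp: hom_iff)
  fix t x assume "x \<in> Hom A (Cod A f) t" "x \<cdot> f = Zero A (Dom A f) t"
  then obtain h where "h \<in> Hom A c t" "h \<cdot> g = x" using assms(5)[of x t] by auto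
  moreover from this have "h' = h" if "h' \<in> Hom A c t" "h' \<cdot> g = x" for h'
    by (intro epicD[OF assms(4) _ assms(2), of h' h t]) (simp_all add: that)
  ultimately show "\<exists>!h. h \<in> Hom A (Cod A g) t \<and> h \<cdot> g = x" by auto
qed (use assms(1-4) in \<open>auto simp: hom_iff\<close>)

lemma is_kernel_of_monic_comp:
  assumes m: "monic A m" "m \<in> Hom A b c" and e: "e \<in> Hom A a b" and k: "is_kernel A (m \<cdot> e) k"
  shows "is_kernel A e k"
proof -
  note [simp] = HomD[OF m(2)] HomD[OF e]
  note k' = is_kernelD[OF k]
  have [simp]: "k \<in> Arr A" "Cod A k = a" using is_kernel_simps[OF k] by simp_all
  show ?thesis
  proof (rule is_kernelI[OF _ e _ k'(4)])
    show "k \<in> Hom A (Dom A k) a" by (simp add: hom_iff)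
    have "m \<cdot> (e \<cdot> k) = m \<cdot> Zero A (Dom A k) b" using k'(3) by simp
    thus "e \<cdot> k = Zero A (Dom A k) b" by (rule monicD[OF m(1)]) (simp_all add: hom_iff)
    fix t x assume x: "x \<in> Hom A t a" "e \<cdot> x = Zero A t b"
    note [simp] = HomD[OF x(1)]
    show "\<exists>h\<in>Hom A t (Dom A k). k \<cdot> h = x" by (rule k'(5)) (simp_all add: hom_iff x(2))
  qed
qed

lemma is_kernel_monic_comp:
  assumes m: "monic A m" "m \<in> Hom A b c" and e: "e \<in> Hom A a b" and k: "is_kernel A e k"
  shows "is_kernel A (m \<cdot> e) k"
proof -
  note [simp] = HomD[OF m(2)] HomD[OF e]
  note k' = is_kernelD[OF k]
  have [simp]: "k \<in> Arr A" "Cod A k = a" using is_kernel_simps[OF k] by simp_all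
  show ?thesis
  proof (rule is_kernelI[OF _ _ _ k'(4)])
    show "k \<in> Hom A (Dom A k) a" "m \<cdot> e \<in> Hom A a c" by (simp_all add: hom_iff)
    show "m \<cdot> e \<cdot> k = Zero A (Dom A k) c" using k'(3) by simp
    fix t x assume x: "x \<in> Hom A t a" "m \<cdot> e \<cdot> x = Zero A t c"
    note [simp] = HomD[OF x(1)]
    have "m \<cdot> (e \<cdot> x) = m \<cdot> Zero A t b" using x(2) by simp
    hence "e \<cdot> x = Zero A t b" by (rule monicD[OF m(1)]) (simp_all add: hom_iff)
    thus "\<exists>h\<in>Hom A t (Dom A k). k \<cdot> h = x" by (intro k'(5)) (simp_all add: hom_iff)
  qed
qed

lemma is_cokernel_comp_epic:
  assumes e: "epic A e" "e \<in> Hom A a b" and m: "m \<in> Hom A b c" and k: "is_cokernel A m k"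
  shows "is_cokernel A (m \<cdot> e) k"
proof -
  note [simp] = HomD[OF m] HomD[OF e(2)]
  note k' = is_cokernelD[OF k]
  have [simp]: "k \<in> Arr A" "Dom A k = c" using is_cokernel_simps[OF k] by simp_all
  have km: "k \<cdot> m = Zero A b (Cod A k)" using k'(3) by simp
  show ?thesis
  proof (rule is_cokernelI[OF _ _ _ k'(4)])
    show "m \<cdot> e \<in> Hom A a c" "k \<in> Hom A c (Cod A k)" by (simp_all add: hom_iff)
    show "k \<cdot> (m \<cdot> e) = Zero A a (Cod A k)" using comp_eq_comp[OF km, of e] by simp
    fix t x assume x: "x \<in> Hom A c t" "x \<cdot> (m \<cdot> e) = Zero A a t"
    note [simp] = HomD[OF x(1)]
    have "(x \<cdot> m) \<cdot> e = Zero A b t \<cdot> e" using x(2) by simp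
    hence "x \<cdot> m = Zero A b t" by (rule epicD[OF e(1)]) (simp_all add: hom_iff)
    thus "\<exists>h\<in>Hom A (Cod A k) t. h \<cdot> k = x" by (intro k'(5)) (simp_all add: hom_iff)
  qed
qed

lemma is_zero_Hom:
  assumes "is_zero A z" "f \<in> Hom A z x \<or> f \<in> Hom A x z"
  shows "f = Zero A (Dom A f) (Cod A f)"
proof -
  have z: "z \<in> Ob A" and x: "x \<in> Ob A" using assms by (auto simp: is_zero_def hom_iff)
  have "\<exists>!f. f \<in> Hom A z x" "\<exists>!f. f \<in> Hom A x z"
    using assms(1) x unfolding is_zero_def by blast+
  moreover have "Zero A z x \<in> Hom A z x" "Zero A x z \<in> Hom A x z"
    using z x by (auto simp: hom_iff)
  ultimately have "f = Zero A z x \<and> f \<in> Hom A z x \<or> f = Zero A x z \<and> f \<in> Hom A x z"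
    using assms(2) by blast
  thus ?thesis by (auto simp: hom_iff)
qed

lemma is_zeroI:
  assumes "z \<in> Ob A" "Id A z = Zero A z z"
  shows "is_zero A z"
  unfolding is_zero_def
proof (intro conjI ballI ex1I)
  fix x f assume "x \<in> Ob A" "f \<in> Hom A z x"
  thus "f = Zero A z x" using comp_Id[of f z] assms by (auto simp: hom_iff simp del: comp_Id)
next
  fix x f assume "x \<in> Ob A" "f \<in> Hom A x z"
  thus "f = Zero A x z" using Id_comp[of f z] assms by (auto simp: hom_iff simp del: Id_comp)
qed (use assms in \<open>auto simp: hom_iff\<close>)

section \<open>Short exact sequences\<close>

definition ses :: "'b \<Rightarrow> 'b \<Rightarrow> 'a \<Rightarrow> 'a \<Rightarrow> 'a \<Rightarrow> bool" where
  "ses f g a b c \<longleftrightarrow> f \<in> Hom A a b \<and> g \<in> Hom A b c \<and> is_kernel A g f \<and> is_cokernel A f g"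

lemma ses_simps:
  assumes "ses f g a b c"
  shows "f \<in> Arr A" "Dom A f = a" "Cod A f = b" "g \<in> Arr A" "Dom A g = b" "Cod A g = c"
    "a \<in> Ob A" "b \<in> Ob A" "c \<in> Ob A" "g \<cdot> f = Zero A a c"
    "x \<in> Arr A \<Longrightarrow> Cod A x = a \<Longrightarrow> g \<cdot> (f \<cdot> x) = Zero A (Dom A x) c"
proof -
  show *: "f \<in> Arr A" "Dom A f = a" "Cod A f = b" "g \<in> Arr A" "Dom A g = b" "Cod A g = c"
    "g \<cdot> f = Zero A a c"
    using assms is_kernelD(3)[of g f] unfolding ses_def hom_iff by auto
  show "a \<in> Ob A" "b \<in> Ob A" "c \<in> Ob A" using * Dom_Ob Cod_Ob by blast+
  thus "x \<in> Arr A \<Longrightarrow> Cod A x = a \<Longrightarrow> g \<cdot> (f \<cdot> x) = Zero A (Dom A x) c"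
    using comp_eq_comp[of g f "Zero A a c" x] * by simp
qed

lemma ses_mono:
  assumes "ses f g a b c" "f \<cdot> x = f \<cdot> y" "x \<in> Hom A t a" "y \<in> Hom A t a"
  shows "x = y"
  using assms monicD[of f x y a b t] is_kernelD(4)[of g f] unfolding ses_def by blast

lemma ses_zero:
  assumes "ses f g a b c" "f \<cdot> x = Zero A t b" "x \<in> Hom A t a"
  shows "x = Zero A t a"
proof -
  note [simp] = ses_simps[OF assms(1)] assms(3)[unfolded hom_iff]
  have [simp]: "t \<in> Ob A" using Hom_Ob[OF assms(3)] by blast
  show ?thesis by (rule ses_mono[OF assms(1), of x _ t]) (simp_all add: assms hom_iff)
qed

lemma ses_lift:
  assumes "ses f g a b c" "g \<cdot> x = Zero A t c" "x \<in> Hom A t b"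
  obtains y where "y \<in> Hom A t a" "f \<cdot> y = x"
proof -
  have "is_kernel A g f" using assms(1) by (simp add: ses_def)
  from is_kernelD(5)[OF this, of x t] show ?thesis
    using assms that ses_simps[OF assms(1)] by auto
qed

lemma ses_desc:
  assumes "ses f g a b c" "x \<cdot> f = Zero A a t" "x \<in> Hom A b t"
  obtains y where "y \<in> Hom A c t" "y \<cdot> g = x"
proof -
  have "is_cokernel A f g" using assms(1) by (simp add: ses_def)
  from is_cokernelD(5)[OF this, of x t] show ?thesis
    using assms that ses_simps[OF assms(1)] by auto
qed

lemma ses_epic: "ses f g a b c \<Longrightarrow> epic A g"
  and ses_monic: "ses f g a b c \<Longrightarrow> monic A f"
  using is_cokernelD(4) is_kernelD(4) unfolding ses_def by blast+

lemma ses_proj: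
  assumes "ses f g a b c" "projective A P" "y \<in> Hom A P c"
  obtains x where "x \<in> Hom A P b" "g \<cdot> x = y"
  using assms(2,3) ses_epic[OF assms(1)] ses_simps(5,6)[OF assms(1)] unfolding projective_def by blast

text \<open>
  The arrows are forgotten: almost everything below only needs that some short exact sequence with
  the given objects exists.
\<close>

definition ext :: "'a \<Rightarrow> 'a \<Rightarrow> 'a \<Rightarrow> bool" where
  "ext a b c \<longleftrightarrow> (\<exists>f g. ses f g a b c)"

section \<open>Biproducts and zero objects\<close>

lemma biproduct_simps:
  assumes "is_biproduct A a b s i j p q"
  shows "i \<in> Arr A" "Dom A i = a" "Cod A i = s" "j \<in> Arr A" "Dom A j = b" "Cod A j = s"
    "p \<in> Arr A" "Dom A p = s" "Cod A p = a" "q \<in> Arr A" "Dom A q = s" "Cod A q = b"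
    "a \<in> Ob A" "b \<in> Ob A" "s \<in> Ob A"
    "p \<cdot> i = Id A a" "q \<cdot> j = Id A b" "p \<cdot> j = Zero A b a" "q \<cdot> i = Zero A a b"
    "x \<in> Arr A \<Longrightarrow> Cod A x = a \<Longrightarrow> p \<cdot> (i \<cdot> x) = x"
    "x \<in> Arr A \<Longrightarrow> Cod A x = b \<Longrightarrow> q \<cdot> (j \<cdot> x) = x"
    "x \<in> Arr A \<Longrightarrow> Cod A x = b \<Longrightarrow> p \<cdot> (j \<cdot> x) = Zero A (Dom A x) a"
    "x \<in> Arr A \<Longrightarrow> Cod A x = a \<Longrightarrow> q \<cdot> (i \<cdot> x) = Zero A (Dom A x) b"
proof -
  have h: "i \<in> Hom A a s" "j \<in> Hom A b s" "p \<in> Hom A s a" "q \<in> Hom A s b"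
    and e: "p \<cdot> i = Id A a" "q \<cdot> j = Id A b" "p \<cdot> j = Zero A b a" "q \<cdot> i = Zero A a b"
    using assms unfolding is_biproduct_def by blast+
  note [simp] = HomD[OF h(1)] HomD[OF h(2)] HomD[OF h(3)] HomD[OF h(4)] e
  show "i \<in> Arr A" "Dom A i = a" "Cod A i = s" "j \<in> Arr A" "Dom A j = b" "Cod A j = s"
    "p \<in> Arr A" "Dom A p = s" "Cod A p = a" "q \<in> Arr A" "Dom A q = s" "Cod A q = b"
    "a \<in> Ob A" "b \<in> Ob A" "s \<in> Ob A"
    "p \<cdot> i = Id A a" "q \<cdot> j = Id A b" "p \<cdot> j = Zero A b a" "q \<cdot> i = Zero A a b"
    by simp_all
  show "x \<in> Arr A \<Longrightarrow> Cod A x = a \<Longrightarrow> p \<cdot> (i \<cdot> x) = x"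
    "x \<in> Arr A \<Longrightarrow> Cod A x = b \<Longrightarrow> q \<cdot> (j \<cdot> x) = x"
    "x \<in> Arr A \<Longrightarrow> Cod A x = b \<Longrightarrow> p \<cdot> (j \<cdot> x) = Zero A (Dom A x) a"
    "x \<in> Arr A \<Longrightarrow> Cod A x = a \<Longrightarrow> q \<cdot> (i \<cdot> x) = Zero A (Dom A x) b"
    using comp_eq_comp[OF e(1), of x] comp_eq_comp[OF e(2), of x]
      comp_eq_comp[OF e(3), of x] comp_eq_comp[OF e(4), of x] by simp_all
qed

lemma biproduct_decomp:
  assumes B: "is_biproduct A a b s i j p q" and x: "x \<in> Hom A t s"
  shows "x = Plus A (i \<cdot> (p \<cdot> x)) (j \<cdot> (q \<cdot> x))"
proof -
  note [simp] = biproduct_simps[OF B] HomD[OF x]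
  have 1: "Plus A (i \<cdot> p) (j \<cdot> q) = Id A s" using B by (simp add: is_biproduct_def)
  have "Plus A (i \<cdot> p) (j \<cdot> q) \<cdot> x = Plus A (i \<cdot> (p \<cdot> x)) (j \<cdot> (q \<cdot> x))" by simp
  thus ?thesis unfolding 1 by simp
qed

lemma biproduct_eqI:
  assumes B: "is_biproduct A a b s i j p q" and x: "x \<in> Hom A t s" "y \<in> Hom A t s"
    and "p \<cdot> x = p \<cdot> y" "q \<cdot> x = q \<cdot> y"
  shows "x = y"
  using biproduct_decomp[OF B x(1)] biproduct_decomp[OF B x(2)] assms(4,5) by metis

lemma biproduct_swap:
  assumes B: "is_biproduct A a b s i j p q"
  shows "is_biproduct A b a s j i q p"
proof -
  note [simp] = biproduct_simps[OF B]
  have "Plus A (i \<cdot> p) (j \<cdot> q) = Plus A (j \<cdot> q) (i \<cdot> p)"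
    by (rule Plus_commute[of _ s s]) (simp_all add: hom_iff)
  thus ?thesis using B unfolding is_biproduct_def by simp
qed

lemma biproduct_projective:
  assumes B: "is_biproduct A a b s i j p q" and "projective A a" "projective A b"
  shows "projective A s"
  unfolding projective_def
proof (intro conjI allI impI ballI)
  note [simp] = biproduct_simps[OF B]
  show "s \<in> Ob A" by simp
  fix e f assume e: "epic A e" and f: "f \<in> Hom A s (Cod A e)"
  note [simp] = HomD[OF f]
  have [simp]: "e \<in> Arr A" using e by (simp add: epic_def)
  have fij: "f \<cdot> i \<in> Hom A a (Cod A e)" "f \<cdot> j \<in> Hom A b (Cod A e)" by (simp_all add: hom_iff)
  obtain u v where u: "u \<in> Hom A a (Dom A e)" "e \<cdot> u = f \<cdot> i"
    and v: "v \<in> Hom A b (Dom A e)" "e \<cdot> v = f \<cdot> j"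
    using assms(2,3) e fij unfolding projective_def by metis
  note [simp] = HomD[OF u(1)] HomD[OF v(1)]
  have 1: "Plus A (i \<cdot> p) (j \<cdot> q) = Id A s" using B by (simp add: is_biproduct_def)
  have "e \<cdot> Plus A (u \<cdot> p) (v \<cdot> q) = Plus A ((e \<cdot> u) \<cdot> p) ((e \<cdot> v) \<cdot> q)" by simp
  also have "\<dots> = f \<cdot> Plus A (i \<cdot> p) (j \<cdot> q)" unfolding u(2) v(2) by simp
  also have "\<dots> = f" unfolding 1 by simp
  finally show "\<exists>g\<in>Hom A s (Dom A e). e \<cdot> g = f"
    by (intro bexI[of _ "Plus A (u \<cdot> p) (v \<cdot> q)"]) (simp_all add: hom_iff)
qed

text \<open>
  With a retraction \<open>r\<close> of \<open>f\<close>, the arrow \<open>1 - f r\<close> kills \<open>f\<close>, hence descends along \<open>g\<close> to a section.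
\<close>

lemma split_of_retraction:
  assumes S: "ses f g a X q" and r: "r \<in> Hom A X a" "r \<cdot> f = Id A a"
  shows "\<exists>s. is_biproduct A a q X f s r g"
proof -
  note [simp] = ses_simps[OF S] HomD[OF r(1)] r(2) comp_eq_comp[OF r(2)]
  define m where "m = Plus A (Id A X) (neg (f \<cdot> r))"
  have m [simp]: "m \<in> Arr A" "Dom A m = X" "Cod A m = X" by (simp_all add: m_def)
  have "m \<cdot> f = Zero A a X" by (simp add: m_def)
  then obtain s where s: "s \<in> Hom A q X" "s \<cdot> g = m"
    by (rule ses_desc[OF S]) (simp_all add: hom_iff)
  note [simp] = HomD[OF s(1)]
  have "(g \<cdot> s) \<cdot> g = g \<cdot> (s \<cdot> g)" by simp
  also have "\<dots> = g" unfolding s(2) by (simp add: m_def comp_eq_comp[of g f])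
  also have "\<dots> = Id A q \<cdot> g" by simp
  finally have gs: "g \<cdot> s = Id A q" by (rule epicD[OF ses_epic[OF S]]) (simp_all add: hom_iff)
  have "(r \<cdot> s) \<cdot> g = r \<cdot> (s \<cdot> g)" by simp
  also have "\<dots> = Zero A q a \<cdot> g" unfolding s(2) by (simp add: m_def)
  finally have rs: "r \<cdot> s = Zero A q a" by (rule epicD[OF ses_epic[OF S]]) (simp_all add: hom_iff)
  have "Plus A (f \<cdot> r) m = Plus A (f \<cdot> r) (Plus A (neg (f \<cdot> r)) (Id A X))"
    unfolding m_def by (subst Plus_commute[of "Id A X" X X]) (simp_all add: hom_iff)
  also have "\<dots> = Id A X" by (subst Plus_assoc[symmetric, of _ X X]) (simp_all add: hom_iff)
  finally have "Plus A (f \<cdot> r) m = Id A X" .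
  hence "is_biproduct A a q X f s r g" unfolding is_biproduct_def by (simp add: hom_iff gs rs s(2))
  thus ?thesis ..
qed

text \<open>
  With a section \<open>s\<close> of \<open>g\<close>, the arrow \<open>1 - s g\<close> is killed by \<open>g\<close>, hence lifts along \<open>f\<close> to a
  retraction.
\<close>

lemma split_of_section:
  assumes S: "ses f g a X q" and s: "s \<in> Hom A q X" "g \<cdot> s = Id A q"
  shows "\<exists>r. is_biproduct A a q X f s r g"
proof -
  note [simp] = ses_simps[OF S] HomD[OF s(1)] s(2) comp_eq_comp[OF s(2)]
  define m where "m = Plus A (Id A X) (neg (s \<cdot> g))"
  have m [simp]: "m \<in> Arr A" "Dom A m = X" "Cod A m = X" by (simp_all add: m_def)
  have "g \<cdot> m = Zero A X q" by (simp add: m_def)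
  then obtain r where r: "r \<in> Hom A X a" "f \<cdot> r = m"
    by (rule ses_lift[OF S]) (simp_all add: hom_iff)
  note [simp] = HomD[OF r(1)]
  have "f \<cdot> (r \<cdot> f) = (f \<cdot> r) \<cdot> f" by simp
  also have "\<dots> = f \<cdot> Id A a" unfolding r(2) by (simp add: m_def)
  finally have "r \<cdot> f = Id A a" by (rule ses_mono[OF S]) (simp_all add: hom_iff)
  from split_of_retraction[OF S r(1) this] obtain s' where B: "is_biproduct A a q X f s' r g" ..
  have "f \<cdot> (r \<cdot> s) = (f \<cdot> r) \<cdot> s" by simp
  also have "\<dots> = f \<cdot> Zero A q a" unfolding r(2) by (simp add: m_def)
  finally have rs: "r \<cdot> s = Zero A q a" by (rule ses_mono[OF S]) (simp_all add: hom_iff)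
  have "s' = s" by (rule biproduct_eqI[OF B]) (simp_all add: hom_iff biproduct_simps[OF B] rs)
  with B show ?thesis by blast
qed

lemma is_zero_simps:
  assumes "is_zero A z"
  shows "z \<in> Ob A" "x \<in> Ob A \<Longrightarrow> f \<in> Hom A x z \<Longrightarrow> f = Zero A x z"
    "x \<in> Ob A \<Longrightarrow> f \<in> Hom A z x \<Longrightarrow> f = Zero A z x" "Id A z = Zero A z z"
proof -
  show z: "z \<in> Ob A" using assms by (simp add: is_zero_def)
  show "f = Zero A x z" if "x \<in> Ob A" "f \<in> Hom A x z"
    using is_zero_Hom[OF assms, of f x] HomD[OF that(2)] that(2) by simp
  show "f = Zero A z x" if "x \<in> Ob A" "f \<in> Hom A z x"
    using is_zero_Hom[OF assms, of f x] HomD[OF that(2)] that(2) by simp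
  show "Id A z = Zero A z z"
    using is_zero_Hom[OF assms, of "Id A z" z] z by (simp add: hom_iff)
qed

lemma biproduct_zero:
  assumes "is_zero A z" "a \<in> Ob A"
  shows "is_biproduct A a z a (Id A a) (Zero A z a) (Id A a) (Zero A a z)"
  using is_zero_simps(1,4)[OF assms(1)] assms(2) by (simp add: is_biproduct_def hom_iff)

lemma zero_projective: "is_zero A z \<Longrightarrow> projective A z"
  unfolding projective_def
proof (intro conjI allI impI ballI)
  assume z: "is_zero A z"
  note [simp] = is_zero_simps(1)[OF z]
  show "z \<in> Ob A" by simp
  fix e f assume e: "epic A e" and f: "f \<in> Hom A z (Cod A e)"
  note [simp] = HomD[OF f]
  have [simp]: "e \<in> Arr A" using e by (simp add: epic_def)
  have "f = Zero A z (Cod A e)" by (rule is_zero_simps(3)[OF z _ f]) simp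
  thus "\<exists>g\<in>Hom A z (Dom A e). e \<cdot> g = f"
    by (intro bexI[of _ "Zero A z (Dom A e)"]) (simp_all add: hom_iff)
qed

end

section \<open>Kernels, cokernels and images in an abelian category\<close>

context abelian_category
begin

lemma cokernel_of_kernel:
  assumes "epic A e" "is_kernel A e k"
  shows "is_cokernel A k e"
proof -
  obtain f where f: "is_cokernel A f e" using epic_is_cokernel[OF assms(1)] ..
  note k = is_kernelD[OF assms(2)] and c = is_cokernelD[OF f]
  note [simp] = is_kernel_simps[OF assms(2)] is_cokernel_simps[OF f]
  have "\<exists>u\<in>Hom A (Dom A f) (Dom A k). k \<cdot> u = f" by (intro k(5)) (simp_all add: hom_iff c(3))
  then obtain u where u: "u \<in> Hom A (Dom A f) (Dom A k)" "k \<cdot> u = f" by blast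
  note [simp] = u(1)[unfolded hom_iff]
  show ?thesis
  proof (rule is_cokernelI[OF k(1) _ k(3) assms(1)])
    show "e \<in> Hom A (Dom A e) (Cod A e)" by (simp add: hom_iff)
    fix t x assume x: "x \<in> Hom A (Dom A e) t" "x \<cdot> k = Zero A (Dom A k) t"
    note [simp] = x(1)[unfolded hom_iff]
    have [simp]: "t \<in> Ob A" using Hom_Ob[OF x(1)] by blast
    have "x \<cdot> f = (x \<cdot> k) \<cdot> u" using u(2) by simp
    hence "x \<cdot> f = Zero A (Dom A f) t" unfolding x(2) by simp
    thus "\<exists>h\<in>Hom A (Cod A e) t. h \<cdot> e = x" by (intro c(5)) (simp_all add: hom_iff)
  qed
qed

lemma kernel_of_cokernel:
  assumes "monic A m" "is_cokernel A m c"
  shows "is_kernel A c m"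
proof -
  obtain f where f: "is_kernel A f m" using monic_is_kernel[OF assms(1)] ..
  note c = is_cokernelD[OF assms(2)] and k = is_kernelD[OF f]
  note [simp] = is_kernel_simps[OF f] is_cokernel_simps[OF assms(2)]
  have "\<exists>u\<in>Hom A (Cod A c) (Cod A f). u \<cdot> c = f" by (intro c(5)) (simp_all add: hom_iff k(3))
  then obtain u where u: "u \<in> Hom A (Cod A c) (Cod A f)" "u \<cdot> c = f" by blast
  note [simp] = u(1)[unfolded hom_iff]
  show ?thesis
  proof (rule is_kernelI[OF _ c(1) c(3) assms(1)])
    show "m \<in> Hom A (Dom A m) (Cod A m)" by (simp add: hom_iff)
    fix t x assume x: "x \<in> Hom A t (Cod A m)" "c \<cdot> x = Zero A t (Cod A c)"
    note [simp] = x(1)[unfolded hom_iff]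
    have [simp]: "t \<in> Ob A" using Hom_Ob[OF x(1)] by blast
    have "(u \<cdot> c) \<cdot> x = u \<cdot> (c \<cdot> x)" by simp
    hence "f \<cdot> x = Zero A t (Cod A f)" unfolding u(2) x(2) by simp
    thus "\<exists>h\<in>Hom A t (Dom A m). m \<cdot> h = x" by (intro k(5)) (simp_all add: hom_iff)
  qed
qed

lemma ses_of_epic:
  assumes "epic A g" "g \<in> Hom A b c"
  obtains f a where "ses f g a b c"
proof -
  obtain f where f: "is_kernel A g f" using ex_kernel assms by (auto simp: hom_iff)
  hence "ses f g (Dom A f) b c"
    using cokernel_of_kernel[OF assms(1) f] is_kernelD(1)[OF f] assms(2) by (simp add: ses_def hom_iff)
  thus ?thesis by (rule that)
qed

lemma ses_of_monic:
  assumes "monic A f" "f \<in> Hom A a b"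
  obtains g c where "ses f g a b c"
proof -
  obtain g where g: "is_cokernel A f g" using ex_cokernel assms by (auto simp: hom_iff)
  hence "ses f g a b (Cod A g)"
    using kernel_of_cokernel[OF assms(1) g] is_cokernelD(1)[OF g] assms(2) by (simp add: ses_def hom_iff)
  thus ?thesis by (rule that)
qed

text \<open>
  The arrow \<open>e\<close> through which \<open>u\<close> factors over its image \<open>m\<close> is epic: if \<open>x e = 0\<close>, then \<open>u\<close> factors
  through \<open>m n\<close> with \<open>n\<close> the kernel of \<open>x\<close>; as \<open>m n\<close> is itself a kernel, \<open>m\<close> factors through it, so
  that \<open>n\<close> is split epic and \<open>x = 0\<close>.
\<close>

lemma image_factorization:
  assumes "u \<in> Hom A a b" "is_cokernel A u c" "is_kernel A c m"
  obtains e where "e \<in> Hom A a (Dom A m)" "m \<cdot> e = u" "epic A e"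
proof -
  note c = is_cokernelD[OF assms(2)] and k = is_kernelD[OF assms(3)]
  note [simp] = assms(1)[unfolded hom_iff] is_cokernel_simps[OF assms(2)] is_kernel_simps[OF assms(3)]
  have [simp]: "a \<in> Ob A" "b \<in> Ob A" using Hom_Ob[OF assms(1)] by auto
  have "c \<cdot> u = Zero A a (Cod A c)" using c(3) by simp
  hence "\<exists>e\<in>Hom A a (Dom A m). m \<cdot> e = u" by (intro k(5)) (simp_all add: hom_iff)
  then obtain e where e: "e \<in> Hom A a (Dom A m)" "m \<cdot> e = u" by blast
  note [simp] = e(1)[unfolded hom_iff]
  have "epic A e"
  proof (rule epicI[OF e(1)])
    fix t x assume x: "x \<in> Hom A (Dom A m) t" "x \<cdot> e = Zero A a t"
    note [simp] = x(1)[unfolded hom_iff]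
    have [simp]: "t \<in> Ob A" using Hom_Ob[OF x(1)] by auto
    obtain n where n: "is_kernel A x n" using ex_kernel[of x] by auto
    note n' = is_kernelD[OF n]
    note [simp] = is_kernel_simps[OF n]
    have "\<exists>e'\<in>Hom A a (Dom A n). n \<cdot> e' = e" by (intro n'(5)) (simp_all add: hom_iff x(2))
    then obtain e' where e': "e' \<in> Hom A a (Dom A n)" "n \<cdot> e' = e" by blast
    note [simp] = e'(1)[unfolded hom_iff]
    have "monic A (m \<cdot> n)"
    proof (rule monicI)
      show "m \<cdot> n \<in> Hom A (Dom A n) b" by (simp add: hom_iff)
      fix s y assume y: "y \<in> Hom A s (Dom A n)" "m \<cdot> n \<cdot> y = Zero A s b"
      note [simp] = y(1)[unfolded hom_iff]
      have [simp]: "s \<in> Ob A" using Hom_Ob[OF y(1)] by auto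
      have "m \<cdot> (n \<cdot> y) = m \<cdot> Zero A s (Dom A m)" using y(2) by simp
      hence "n \<cdot> y = Zero A s (Dom A m)"
        by (rule monicD[OF k(4)]) (simp_all add: hom_iff)
      hence "n \<cdot> y = n \<cdot> Zero A s (Dom A n)" by simp
      thus "y = Zero A s (Dom A n)"
        by (rule monicD[OF n'(4)]) (simp_all add: hom_iff)
    qed
    then obtain w where w: "is_kernel A w (m \<cdot> n)" using monic_is_kernel by blast
    note w' = is_kernelD[OF w]
    have [simp]: "w \<in> Arr A" "Dom A w = b" using is_kernel_simps[OF w] by simp_all
    have "w \<cdot> u = (w \<cdot> (m \<cdot> n)) \<cdot> e'" using e(2) e'(2) by simp
    hence "w \<cdot> u = Zero A a (Cod A w)" using w'(3) by simp
    hence "\<exists>v\<in>Hom A (Cod A c) (Cod A w). v \<cdot> c = w" by (intro c(5)) (simp_all add: hom_iff)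
    then obtain v where v: "v \<in> Hom A (Cod A c) (Cod A w)" "v \<cdot> c = w" by blast
    note [simp] = v(1)[unfolded hom_iff]
    have "w \<cdot> m = v \<cdot> (c \<cdot> m)" using v(2)[symmetric] by simp
    hence "w \<cdot> m = Zero A (Dom A m) (Cod A w)" unfolding k(3) by simp
    hence "\<exists>s\<in>Hom A (Dom A m) (Dom A (m \<cdot> n)). m \<cdot> n \<cdot> s = m" by (intro w'(5)) (simp_all add: hom_iff)
    then obtain s where s: "s \<in> Hom A (Dom A m) (Dom A n)" "m \<cdot> n \<cdot> s = m" by auto
    note [simp] = s(1)[unfolded hom_iff]
    have "m \<cdot> (n \<cdot> s) = m \<cdot> Id A (Dom A m)" using s(2) by simp
    hence ns: "n \<cdot> s = Id A (Dom A m)"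
      by (rule monicD[OF k(4)]) (simp_all add: hom_iff)
    have "x = x \<cdot> (n \<cdot> s)" using ns by simp
    also have "\<dots> = (x \<cdot> n) \<cdot> s" by simp
    also have "\<dots> = Zero A (Dom A m) t" using n'(3) by simp
    finally show "x = Zero A (Dom A m) t" .
  qed
  thus ?thesis using e that by blast
qed

end

section \<open>Exactness tested on projective objects\<close>

locale abelian_enough_projectives = abelian_category +
  assumes enough: "enough_projectives A"
begin

lemma cover:
  assumes "X \<in> Ob A"
  obtains k K P e where "projective A P" "ses k e K P X"
proof -
  obtain P e where "projective A P" "e \<in> Hom A P X" "epic A e"
    using enough assms unfolding enough_projectives_def by blast
  moreover from this obtain k K where "ses k e K P X" by (blast elim: ses_of_epic)
  ultimately show ?thesis by (intro that)
qed

lemma projective_Ob: "projective A P \<Longrightarrow> P \<in> Ob A"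
  by (simp add: projective_def)

text \<open>
  Arrows out of a projective object play the role of elements.  Since every object is covered by a
  projective one and epimorphisms are cokernels, injectivity, surjectivity and exactness on these
  elements already give a short exact sequence.  This is what makes diagram chases possible.
\<close>

lemma sesI:
  assumes f: "f \<in> Hom A a b" and g: "g \<in> Hom A b c" and gf: "g \<cdot> f = Zero A a c"
    and inj: "\<And>P x. projective A P \<Longrightarrow> x \<in> Hom A P a \<Longrightarrow> f \<cdot> x = Zero A P b \<Longrightarrow> x = Zero A P a"
    and surj: "\<And>P y. projective A P \<Longrightarrow> y \<in> Hom A P c \<Longrightarrow> \<exists>x\<in>Hom A P b. g \<cdot> x = y"
    and exact: "\<And>P y. projective A P \<Longrightarrow> y \<in> Hom A P b \<Longrightarrow> g \<cdot> y = Zero A P c \<Longrightarrow> \<exists>x\<in>Hom A P a. f \<cdot> x = y"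
  shows "ses f g a b c"
proof -
  note [simp] = f[unfolded hom_iff] g[unfolded hom_iff]
  have [simp]: "a \<in> Ob A" "b \<in> Ob A" "c \<in> Ob A" using f g Hom_Ob by blast+
  have epic: "epic A g"
  proof (rule epicI[OF g])
    fix t x assume x: "x \<in> Hom A c t" "x \<cdot> g = Zero A b t"
    note [simp] = x(1)[unfolded hom_iff]
    have [simp]: "t \<in> Ob A" using Hom_Ob[OF x(1)] by auto
    obtain k K P e where P: "projective A P" and e: "ses k e K P c" by (rule cover[of c]) auto
    note [simp] = ses_simps[OF e]
    have "e \<in> Hom A P c" by (simp add: hom_iff)
    then obtain y where y: "y \<in> Hom A P b" "g \<cdot> y = e" using surj[OF P] by blast
    note [simp] = y(1)[unfolded hom_iff]
    have "x \<cdot> e = (x \<cdot> g) \<cdot> y" using y(2) by simp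
    hence "x \<cdot> e = Zero A c t \<cdot> e" unfolding x(2) by simp
    thus "x = Zero A c t" by (rule epicD[OF ses_epic[OF e]]) (simp_all add: hom_iff)
  qed
  have monic: "monic A f"
  proof (rule monicI[OF f])
    fix t x assume x: "x \<in> Hom A t a" "f \<cdot> x = Zero A t b"
    note [simp] = x(1)[unfolded hom_iff]
    have [simp]: "t \<in> Ob A" using Hom_Ob[OF x(1)] by auto
    obtain k K P e where P: "projective A P" and e: "ses k e K P t" by (rule cover[of t]) auto
    note [simp] = ses_simps[OF e]
    have "f \<cdot> (x \<cdot> e) = (f \<cdot> x) \<cdot> e" by simp
    hence "x \<cdot> e = Zero A P a" unfolding x(2) by (intro inj[OF P]) (simp_all add: hom_iff)
    hence "x \<cdot> e = Zero A t a \<cdot> e" by simp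
    thus "x = Zero A t a" by (rule epicD[OF ses_epic[OF e]]) (simp_all add: hom_iff)
  qed
  have "is_kernel A g f"
  proof (rule is_kernelI[OF f g gf monic])
    fix t x assume x: "x \<in> Hom A t b" "g \<cdot> x = Zero A t c"
    note [simp] = x(1)[unfolded hom_iff]
    have [simp]: "t \<in> Ob A" using Hom_Ob[OF x(1)] by auto
    obtain k K P e where P: "projective A P" and e: "ses k e K P t" by (rule cover[of t]) auto
    note [simp] = ses_simps[OF e]
    have "g \<cdot> (x \<cdot> e) = (g \<cdot> x) \<cdot> e" by simp
    hence "g \<cdot> (x \<cdot> e) = Zero A P c" unfolding x(2) by simp
    hence "\<exists>y\<in>Hom A P a. f \<cdot> y = x \<cdot> e" by (intro exact[OF P]) (simp_all add: hom_iff)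
    then obtain y where y: "y \<in> Hom A P a" "f \<cdot> y = x \<cdot> e" by blast
    note [simp] = y(1)[unfolded hom_iff]
    have "f \<cdot> (y \<cdot> k) = (f \<cdot> y) \<cdot> k" by simp
    hence "f \<cdot> (y \<cdot> k) = f \<cdot> Zero A K a" unfolding y(2) by simp
    hence "y \<cdot> k = Zero A K a" by (rule monicD[OF monic]) (simp_all add: hom_iff)
    then obtain h where h: "h \<in> Hom A t a" "h \<cdot> e = y" using ses_desc[OF e _ y(1)] by blast
    note [simp] = h(1)[unfolded hom_iff]
    have "(f \<cdot> h) \<cdot> e = x \<cdot> e" using h(2) y(2) by simp
    hence "f \<cdot> h = x" by (rule epicD[OF ses_epic[OF e]]) (simp_all add: hom_iff)
    thus "\<exists>h\<in>Hom A t a. f \<cdot> h = x" using h(1) by blast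
  qed
  with cokernel_of_kernel[OF epic this] f g show ?thesis by (simp add: ses_def)
qed

section \<open>Constructions with short exact sequences\<close>

lemma ses_of_biproduct:
  assumes B: "is_biproduct A a b s i j p q"
  shows "ses i q a s b"
proof (rule sesI)
  note [simp] = biproduct_simps[OF B]
  show "i \<in> Hom A a s" "q \<in> Hom A s b" "q \<cdot> i = Zero A a b" by (simp_all add: hom_iff)
  fix P
  {
    fix x assume x: "x \<in> Hom A P a" "i \<cdot> x = Zero A P s"
    note [simp] = HomD[OF x(1)]
    have "p \<cdot> (i \<cdot> x) = Zero A P a" unfolding x(2) by simp
    thus "x = Zero A P a" by simp
  next
    fix y assume y: "y \<in> Hom A P b"
    note [simp] = HomD[OF y(1)]
    show "\<exists>x\<in>Hom A P s. q \<cdot> x = y" by (rule bexI[of _ "j \<cdot> y"]) (simp_all add: hom_iff)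
  next
    fix y assume y: "y \<in> Hom A P s" "q \<cdot> y = Zero A P b"
    note [simp] = HomD[OF y(1)]
    have "i \<cdot> (p \<cdot> y) = y" by (rule biproduct_eqI[OF B]) (simp_all add: hom_iff y(2))
    thus "\<exists>x\<in>Hom A P a. i \<cdot> x = y" by (intro bexI[of _ "p \<cdot> y"]) (simp_all add: hom_iff)
  }
qed

lemma projective_split:
  assumes S: "ses f g a X q" and q: "projective A q"
  shows "\<exists>s r. is_biproduct A a q X f s r g"
proof -
  have "q \<in> Ob A" using q by (rule projective_Ob)
  hence "Id A q \<in> Hom A q q" by (rule Id_in_Hom)
  then obtain s where "s \<in> Hom A q X" "g \<cdot> s = Id A q" by (rule ses_proj[OF S q])
  from split_of_section[OF S this] show ?thesis by blast
qed

text \<open>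
  If \<open>b\<close> is an extension of \<open>c\<close> by \<open>a\<close>, then the kernel of \<open>p \<rightarrow> b \<rightarrow> c\<close> is the preimage of \<open>a\<close>, so it
  is an extension of \<open>a\<close> by the kernel of \<open>p \<rightarrow> b\<close>.
\<close>

lemma ses_preimage:
  assumes S: "ses f g a b c" and T: "ses d e D p b"
  obtains \<kappa> k \<delta> \<theta> where "ses \<kappa> (g \<cdot> e) k p c" "ses \<delta> \<theta> D k a" "f \<cdot> \<theta> = e \<cdot> \<kappa>" "\<kappa> \<cdot> \<delta> = d"
proof -
  note [simp] = ses_simps[OF S] ses_simps[OF T]
  have "epic A (g \<cdot> e)"
    by (rule epic_comp[OF ses_epic[OF T] _ ses_epic[OF S]]) (simp_all add: hom_iff)
  moreover have "g \<cdot> e \<in> Hom A p c" by (simp add: hom_iff)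
  ultimately obtain \<kappa> k where K: "ses \<kappa> (g \<cdot> e) k p c" by (rule ses_of_epic)
  note [simp] = ses_simps(1-9)[OF K]
  have gek: "g \<cdot> (e \<cdot> \<kappa>) = Zero A k c" using ses_simps(10)[OF K] by simp
  obtain \<theta> where \<theta>: "\<theta> \<in> Hom A k a" "f \<cdot> \<theta> = e \<cdot> \<kappa>"
    by (rule ses_lift[OF S gek]) (simp_all add: hom_iff)
  have "(g \<cdot> e) \<cdot> d = Zero A D c" by simp
  then obtain \<delta> where \<delta>: "\<delta> \<in> Hom A D k" "\<kappa> \<cdot> \<delta> = d"
    by (rule ses_lift[OF K]) (simp_all add: hom_iff)
  note [simp] = HomD[OF \<theta>(1)] HomD[OF \<delta>(1)] \<delta>(2) comp_eq_comp[OF \<delta>(2)] \<theta>(2) comp_eq_comp[OF \<theta>(2)]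
  have "ses \<delta> \<theta> D k a"
  proof (rule sesI[OF \<delta>(1) \<theta>(1)])
    have "f \<cdot> (\<theta> \<cdot> \<delta>) = f \<cdot> Zero A D a" by simp
    thus "\<theta> \<cdot> \<delta> = Zero A D a" by (rule ses_mono[OF S]) (simp_all add: hom_iff)
    fix P assume P: "projective A P"
    {
      fix x assume x: "x \<in> Hom A P D" "\<delta> \<cdot> x = Zero A P k"
      note [simp] = HomD[OF x(1)]
      have "d \<cdot> x = \<kappa> \<cdot> (\<delta> \<cdot> x)" by simp
      hence "d \<cdot> x = Zero A P p" unfolding x(2) by simp
      thus "x = Zero A P D" by (rule ses_zero[OF T _ x(1)])
    next
      fix x assume x: "x \<in> Hom A P a"
      note [simp] = HomD[OF x(1)]
      have "f \<cdot> x \<in> Hom A P b" by (simp add: hom_iff)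
      then obtain y where y: "y \<in> Hom A P p" "e \<cdot> y = f \<cdot> x" by (rule ses_proj[OF T P])
      note [simp] = HomD[OF y(1)]
      have "g \<cdot> e \<cdot> y = Zero A P c" using y(2) by simp
      then obtain z where z: "z \<in> Hom A P k" "\<kappa> \<cdot> z = y" by (rule ses_lift[OF K _ y(1)])
      note [simp] = HomD[OF z(1)]
      have "f \<cdot> (\<theta> \<cdot> z) = f \<cdot> x" using z(2) y(2) by simp
      hence "\<theta> \<cdot> z = x" by (rule ses_mono[OF S]) (simp_all add: hom_iff)
      thus "\<exists>z\<in>Hom A P k. \<theta> \<cdot> z = x" using z(1) by blast
    next
      fix y assume y: "y \<in> Hom A P k" "\<theta> \<cdot> y = Zero A P a"
      note [simp] = HomD[OF y(1)]
      have "e \<cdot> (\<kappa> \<cdot> y) = f \<cdot> (\<theta> \<cdot> y)" by simp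
      hence "e \<cdot> (\<kappa> \<cdot> y) = Zero A P b" unfolding y(2) by simp
      then obtain z where z: "z \<in> Hom A P D" "d \<cdot> z = \<kappa> \<cdot> y"
        by (rule ses_lift[OF T]) (simp_all add: hom_iff)
      note [simp] = HomD[OF z(1)]
      have "\<kappa> \<cdot> (\<delta> \<cdot> z) = \<kappa> \<cdot> y" using z(2) by simp
      hence "\<delta> \<cdot> z = y" by (rule ses_mono[OF K]) (simp_all add: hom_iff)
      thus "\<exists>x\<in>Hom A P D. \<delta> \<cdot> x = y" using z(1) by blast
    }
  qed
  with K \<theta>(2) \<delta>(2) that show ?thesis by blast
qed

lemma ext_preimage:
  assumes "ext a b c" "ext d p b"
  obtains k where "ext k p c" "ext d k a"
proof -
  obtain f g u v where S: "ses f g a b c" and T: "ses u v d p b" using assms unfolding ext_def by blast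
  from ses_preimage[OF S T] that show ?thesis unfolding ext_def by metis
qed

text \<open>
  The third isomorphism theorem for \<open>a \<subseteq> b \<subseteq> d\<close>: here \<open>x\<close> is \<open>d / a\<close>, which contains \<open>c = b / a\<close> with
  quotient \<open>e = d / b\<close>.
\<close>

lemma ext_quotient:
  assumes "ext a b c" "ext b d e"
  obtains x where "ext a d x" "ext c x e"
proof -
  obtain f g u v where S: "ses f g a b c" and T: "ses u v b d e" using assms unfolding ext_def by blast
  note [simp] = ses_simps[OF S] ses_simps[OF T]
  have "monic A (u \<cdot> f)"
    by (rule monic_comp[OF ses_monic[OF S] _ ses_monic[OF T]]) (simp_all add: hom_iff)
  moreover have "u \<cdot> f \<in> Hom A a d" by (simp add: hom_iff)
  ultimately obtain \<pi> x where Q: "ses (u \<cdot> f) \<pi> a d x" by (rule ses_of_monic)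
  note [simp] = ses_simps(1-9)[OF Q]
  have puf: "\<pi> \<cdot> (u \<cdot> f) = Zero A a x" using ses_simps(10)[OF Q] by simp
  have "(\<pi> \<cdot> u) \<cdot> f = Zero A a x" using puf by simp
  then obtain \<gamma> where \<gamma>: "\<gamma> \<in> Hom A c x" "\<gamma> \<cdot> g = \<pi> \<cdot> u"
    by (rule ses_desc[OF S]) (simp_all add: hom_iff)
  have "v \<cdot> (u \<cdot> f) = Zero A a e" by simp
  then obtain \<epsilon> where \<epsilon>: "\<epsilon> \<in> Hom A x e" "\<epsilon> \<cdot> \<pi> = v"
    by (rule ses_desc[OF Q]) (simp_all add: hom_iff)
  note [simp] = HomD[OF \<gamma>(1)] HomD[OF \<epsilon>(1)] \<gamma>(2) comp_eq_comp[OF \<gamma>(2)] \<epsilon>(2) comp_eq_comp[OF \<epsilon>(2)]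
  have "ses \<gamma> \<epsilon> c x e"
  proof (rule sesI[OF \<gamma>(1) \<epsilon>(1)])
    have "(\<epsilon> \<cdot> \<gamma>) \<cdot> g = Zero A c e \<cdot> g" by simp
    thus "\<epsilon> \<cdot> \<gamma> = Zero A c e" by (rule epicD[OF ses_epic[OF S]]) (simp_all add: hom_iff)
    fix P assume P: "projective A P"
    {
      fix y assume y: "y \<in> Hom A P c" "\<gamma> \<cdot> y = Zero A P x"
      note [simp] = HomD[OF y(1)]
      obtain y' where y': "y' \<in> Hom A P b" "g \<cdot> y' = y" by (rule ses_proj[OF S P y(1)])
      note [simp] = HomD[OF y'(1)]
      have "\<pi> \<cdot> (u \<cdot> y') = \<gamma> \<cdot> (g \<cdot> y')" by simp
      hence "\<pi> \<cdot> (u \<cdot> y') = Zero A P x" unfolding y'(2) y(2) .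
      then obtain z where z: "z \<in> Hom A P a" "u \<cdot> f \<cdot> z = u \<cdot> y'"
        by (rule ses_lift[OF Q]) (simp_all add: hom_iff)
      note [simp] = HomD[OF z(1)]
      have "u \<cdot> (f \<cdot> z) = u \<cdot> y'" using z(2) by simp
      hence "f \<cdot> z = y'" by (rule ses_mono[OF T]) (simp_all add: hom_iff)
      hence "y = g \<cdot> (f \<cdot> z)" using y'(2) by simp
      thus "y = Zero A P c" by simp
    next
      fix y assume y: "y \<in> Hom A P e"
      obtain y' where y': "y' \<in> Hom A P d" "v \<cdot> y' = y" by (rule ses_proj[OF T P y(1)])
      note [simp] = HomD[OF y'(1)]
      have "\<epsilon> \<cdot> (\<pi> \<cdot> y') = y" using y'(2) by simp
      thus "\<exists>x'\<in>Hom A P x. \<epsilon> \<cdot> x' = y" by (intro bexI[of _ "\<pi> \<cdot> y'"]) (simp_all add: hom_iff)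
    next
      fix w assume w: "w \<in> Hom A P x" "\<epsilon> \<cdot> w = Zero A P e"
      obtain w' where w': "w' \<in> Hom A P d" "\<pi> \<cdot> w' = w" by (rule ses_proj[OF Q P w(1)])
      note [simp] = HomD[OF w'(1)] HomD[OF w(1)]
      have "v \<cdot> w' = \<epsilon> \<cdot> (\<pi> \<cdot> w')" by simp
      hence "v \<cdot> w' = Zero A P e" unfolding w'(2) w(2) .
      then obtain y where y: "y \<in> Hom A P b" "u \<cdot> y = w'" by (rule ses_lift[OF T _ w'(1)])
      note [simp] = HomD[OF y(1)]
      have "\<gamma> \<cdot> (g \<cdot> y) = \<pi> \<cdot> (u \<cdot> y)" by simp
      hence "\<gamma> \<cdot> (g \<cdot> y) = w" unfolding y(2) w'(2) .
      thus "\<exists>y\<in>Hom A P c. \<gamma> \<cdot> y = w" by (intro bexI[of _ "g \<cdot> y"]) (simp_all add: hom_iff)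
    }
  qed
  with Q that show ?thesis unfolding ext_def by blast
qed

text \<open>
  The pullback is the kernel of \<open>g p - h r\<close> on the biproduct of \<open>b\<close> and \<open>q\<close>.
\<close>

lemma pullback:
  assumes S: "ses f g a b c" and h: "h \<in> Hom A q c"
  obtains \<alpha> \<beta> \<gamma> X where "ses \<alpha> \<beta> a X q" "\<gamma> \<in> Hom A X b" "g \<cdot> \<gamma> = h \<cdot> \<beta>" "\<gamma> \<cdot> \<alpha> = f"
    "\<And>t y z. y \<in> Hom A t b \<Longrightarrow> z \<in> Hom A t q \<Longrightarrow> g \<cdot> y = h \<cdot> z \<Longrightarrow> \<exists>x\<in>Hom A t X. \<gamma> \<cdot> x = y \<and> \<beta> \<cdot> x = z"
    "\<And>t x y. x \<in> Hom A t X \<Longrightarrow> y \<in> Hom A t X \<Longrightarrow> \<gamma> \<cdot> x = \<gamma> \<cdot> y \<Longrightarrow> \<beta> \<cdot> x = \<beta> \<cdot> y \<Longrightarrow> x = y"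
proof -
  note [simp] = ses_simps[OF S] HomD[OF h]
  obtain s i j p r where B: "is_biproduct A b q s i j p r" using ex_biproduct[of b q] by auto
  note [simp] = biproduct_simps[OF B]
  define \<phi> where "\<phi> = Plus A (g \<cdot> p) (neg (h \<cdot> r))"
  have \<phi> [simp]: "\<phi> \<in> Arr A" "Dom A \<phi> = s" "Cod A \<phi> = c" by (simp_all add: \<phi>_def)
  obtain k where k: "is_kernel A \<phi> k" using ex_kernel[of \<phi>] by auto
  define X where "X = Dom A k"
  have [simp]: "k \<in> Arr A" "Dom A k = X" "Cod A k = s" "X \<in> Ob A"
    using is_kernel_simps[OF k] by (simp_all add: X_def)
  note k' = is_kernelD[OF k]
  have univ: "\<exists>x\<in>Hom A t X. (p \<cdot> k) \<cdot> x = y \<and> (r \<cdot> k) \<cdot> x = z"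
    if y: "y \<in> Hom A t b" and z: "z \<in> Hom A t q" and e: "g \<cdot> y = h \<cdot> z" for t y z
  proof -
    note [simp] = HomD[OF y] HomD[OF z]
    have "\<exists>x\<in>Hom A t (Dom A k). k \<cdot> x = Plus A (i \<cdot> y) (j \<cdot> z)"
      by (intro k'(5)) (simp_all add: hom_iff \<phi>_def e)
    then obtain x where x: "x \<in> Hom A t X" "k \<cdot> x = Plus A (i \<cdot> y) (j \<cdot> z)" by auto
    note [simp] = HomD[OF x(1)]
    show ?thesis by (rule bexI[OF _ x(1)]) (simp add: x(2))
  qed
  have joint: "x = y" if x: "x \<in> Hom A t X" and y: "y \<in> Hom A t X"
    and e: "(p \<cdot> k) \<cdot> x = (p \<cdot> k) \<cdot> y" "(r \<cdot> k) \<cdot> x = (r \<cdot> k) \<cdot> y" for t x y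
  proof -
    note [simp] = HomD[OF x] HomD[OF y]
    have "p \<cdot> (k \<cdot> x) = p \<cdot> (k \<cdot> y)" "r \<cdot> (k \<cdot> x) = r \<cdot> (k \<cdot> y)" using e by simp_all
    hence "k \<cdot> x = k \<cdot> y" by (rule biproduct_eqI[OF B, rotated 2]) (simp_all add: hom_iff)
    thus ?thesis by (rule monicD[OF k'(4)]) (simp_all add: hom_iff)
  qed
  define \<gamma> \<beta> where "\<gamma> = p \<cdot> k" and "\<beta> = r \<cdot> k"
  note univ = univ[folded \<gamma>_def \<beta>_def] and joint = joint[folded \<gamma>_def \<beta>_def]
  have [simp]: "\<gamma> \<in> Arr A" "Dom A \<gamma> = X" "Cod A \<gamma> = b" "\<beta> \<in> Arr A" "Dom A \<beta> = X" "Cod A \<beta> = q"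
    by (simp_all add: \<gamma>_def \<beta>_def)
  have "\<phi> \<cdot> k = Plus A (g \<cdot> \<gamma>) (neg (h \<cdot> \<beta>))" by (simp add: \<phi>_def \<gamma>_def \<beta>_def)
  hence "Plus A (g \<cdot> \<gamma>) (neg (h \<cdot> \<beta>)) = Zero A X c" using k'(3) by simp
  hence comm: "g \<cdot> \<gamma> = h \<cdot> \<beta>" by (rule diff_eq_zeroD) (simp_all add: hom_iff)
  note [simp] = comm comp_eq_comp[OF comm]
  have "\<exists>\<alpha>\<in>Hom A a X. \<gamma> \<cdot> \<alpha> = f \<and> \<beta> \<cdot> \<alpha> = Zero A a q"
    by (intro univ) (simp_all add: hom_iff)
  then obtain \<alpha> where \<alpha>: "\<alpha> \<in> Hom A a X" "\<gamma> \<cdot> \<alpha> = f" "\<beta> \<cdot> \<alpha> = Zero A a q" by blast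
  note [simp] = HomD[OF \<alpha>(1)] \<alpha>(2,3) comp_eq_comp[OF \<alpha>(2)] comp_eq_comp[OF \<alpha>(3)]
  have "ses \<alpha> \<beta> a X q"
  proof (rule sesI[OF \<alpha>(1) _ \<alpha>(3)])
    show "\<beta> \<in> Hom A X q" by (simp add: hom_iff)
    fix P assume P: "projective A P"
    {
      fix x assume x: "x \<in> Hom A P a" "\<alpha> \<cdot> x = Zero A P X"
      note [simp] = HomD[OF x(1)]
      have "f \<cdot> x = \<gamma> \<cdot> (\<alpha> \<cdot> x)" by simp
      hence "f \<cdot> x = Zero A P b" unfolding x(2) by simp
      thus "x = Zero A P a" by (rule ses_zero[OF S _ x(1)])
    next
      fix z assume z: "z \<in> Hom A P q"
      note [simp] = HomD[OF z]
      have "h \<cdot> z \<in> Hom A P c" by (simp add: hom_iff)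
      then obtain y where "y \<in> Hom A P b" "g \<cdot> y = h \<cdot> z" by (rule ses_proj[OF S P])
      thus "\<exists>x\<in>Hom A P X. \<beta> \<cdot> x = z" using univ z by blast
    next
      fix y assume y: "y \<in> Hom A P X" "\<beta> \<cdot> y = Zero A P q"
      note [simp] = HomD[OF y(1)]
      have "g \<cdot> (\<gamma> \<cdot> y) = h \<cdot> (\<beta> \<cdot> y)" by simp
      hence "g \<cdot> (\<gamma> \<cdot> y) = Zero A P c" unfolding y(2) by simp
      then obtain x where x: "x \<in> Hom A P a" "f \<cdot> x = \<gamma> \<cdot> y"
        by (rule ses_lift[OF S]) (simp_all add: hom_iff)
      note [simp] = HomD[OF x(1)]
      have "\<alpha> \<cdot> x = y" by (rule joint) (simp_all add: hom_iff x(2) y(2))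
      thus "\<exists>x\<in>Hom A P a. \<alpha> \<cdot> x = y" using x(1) by blast
    }
  qed
  moreover have "\<gamma> \<in> Hom A X b" by (simp add: hom_iff)
  ultimately show ?thesis by (rule that) (fact comm \<alpha>(2) univ joint)+
qed

text \<open>
  In a pullback square of two epimorphisms both projections are epic, with unchanged kernels.
\<close>

lemma ext_pullback:
  assumes "ext a b c" "ext a' q c"
  obtains X where "ext a X q" "ext a' X b"
proof -
  obtain f g u h where S: "ses f g a b c" and T: "ses u h a' q c" using assms unfolding ext_def by blast
  note [simp] = ses_simps[OF S] ses_simps[OF T]
  have h: "h \<in> Hom A q c" by (simp add: hom_iff)
  obtain \<alpha> \<beta> \<gamma> X where P: "ses \<alpha> \<beta> a X q" "\<gamma> \<in> Hom A X b" "g \<cdot> \<gamma> = h \<cdot> \<beta>"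
    and univ: "\<And>t y z. y \<in> Hom A t b \<Longrightarrow> z \<in> Hom A t q \<Longrightarrow> g \<cdot> y = h \<cdot> z \<Longrightarrow> \<exists>x\<in>Hom A t X. \<gamma> \<cdot> x = y \<and> \<beta> \<cdot> x = z"
    and joint: "\<And>t x y. x \<in> Hom A t X \<Longrightarrow> y \<in> Hom A t X \<Longrightarrow> \<gamma> \<cdot> x = \<gamma> \<cdot> y \<Longrightarrow> \<beta> \<cdot> x = \<beta> \<cdot> y \<Longrightarrow> x = y"
    by (rule pullback[OF S h]) (rule that)
  note [simp] = ses_simps[OF P(1)] HomD[OF P(2)] P(3) comp_eq_comp[OF P(3)]
  have "\<exists>\<delta>\<in>Hom A a' X. \<gamma> \<cdot> \<delta> = Zero A a' b \<and> \<beta> \<cdot> \<delta> = u"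
    by (intro univ) (simp_all add: hom_iff)
  then obtain \<delta> where \<delta>: "\<delta> \<in> Hom A a' X" "\<gamma> \<cdot> \<delta> = Zero A a' b" "\<beta> \<cdot> \<delta> = u" by blast
  note [simp] = HomD[OF \<delta>(1)] \<delta>(2,3) comp_eq_comp[OF \<delta>(2)] comp_eq_comp[OF \<delta>(3)]
  have "ses \<delta> \<gamma> a' X b"
  proof (rule sesI[OF \<delta>(1) P(2) \<delta>(2)])
    fix P assume P: "projective A P"
    {
      fix x assume x: "x \<in> Hom A P a'" "\<delta> \<cdot> x = Zero A P X"
      note [simp] = HomD[OF x(1)]
      have "u \<cdot> x = \<beta> \<cdot> (\<delta> \<cdot> x)" by simp
      hence "u \<cdot> x = Zero A P q" unfolding x(2) by simp
      thus "x = Zero A P a'" by (rule ses_zero[OF T _ x(1)])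
    next
      fix y assume y: "y \<in> Hom A P b"
      note [simp] = HomD[OF y]
      have "g \<cdot> y \<in> Hom A P c" by (simp add: hom_iff)
      then obtain z where z: "z \<in> Hom A P q" "h \<cdot> z = g \<cdot> y" by (rule ses_proj[OF T P])
      show "\<exists>x\<in>Hom A P X. \<gamma> \<cdot> x = y" using univ[OF y z(1) z(2)[symmetric]] by blast
    next
      fix y assume y: "y \<in> Hom A P X" "\<gamma> \<cdot> y = Zero A P b"
      note [simp] = HomD[OF y(1)]
      have "h \<cdot> (\<beta> \<cdot> y) = g \<cdot> (\<gamma> \<cdot> y)" by simp
      hence "h \<cdot> (\<beta> \<cdot> y) = Zero A P c" unfolding y(2) by simp
      then obtain x where x: "x \<in> Hom A P a'" "u \<cdot> x = \<beta> \<cdot> y"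
        by (rule ses_lift[OF T]) (simp_all add: hom_iff)
      note [simp] = HomD[OF x(1)]
      have "\<delta> \<cdot> x = y" by (rule joint) (simp_all add: hom_iff x(2) y(2))
      thus "\<exists>x\<in>Hom A P a'. \<delta> \<cdot> x = y" using x(1) by blast
    }
  qed
  with P(1) that show ?thesis unfolding ext_def by blast
qed

text \<open>
  The pushout of two monomorphisms is the cokernel of \<open>a \<rightarrow> b \<oplus> d\<close>.  The sign that makes the square
  commute is omitted: it does not affect which sequences exist.
\<close>

lemma ext_pushout:
  assumes "ext a b c" "ext a d e"
  obtains X where "ext d X c" "ext b X e"
proof -
  obtain f g u v where S: "ses f g a b c" and T: "ses u v a d e" using assms unfolding ext_def by blast
  note [simp] = ses_simps[OF S] ses_simps[OF T]
  obtain s i j p q where B: "is_biproduct A b d s i j p q" using ex_biproduct[of b d] by auto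
  note [simp] = biproduct_simps[OF B]
  define w where "w = Plus A (i \<cdot> f) (j \<cdot> u)"
  have w [simp]: "w \<in> Arr A" "Dom A w = a" "Cod A w = s" by (simp_all add: w_def)
  have pw [simp]: "p \<cdot> w = f" "q \<cdot> w = u" by (simp_all add: w_def)
  note [simp] = comp_eq_comp[OF pw(1)] comp_eq_comp[OF pw(2)]
  have "monic A w"
  proof (rule monicI)
    show "w \<in> Hom A a s" by (simp add: hom_iff)
    fix t x assume x: "x \<in> Hom A t a" "w \<cdot> x = Zero A t s"
    note [simp] = HomD[OF x(1)]
    have "f \<cdot> x = p \<cdot> (w \<cdot> x)" by simp
    hence "f \<cdot> x = Zero A t b" unfolding x(2) by simp
    thus "x = Zero A t a" by (rule ses_zero[OF S _ x(1)])
  qed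
  moreover have "w \<in> Hom A a s" by (simp add: hom_iff)
  ultimately obtain \<pi> X where Q: "ses w \<pi> a s X" by (rule ses_of_monic)
  note [simp] = ses_simps[OF Q]
  have "(g \<cdot> p) \<cdot> w = Zero A a c" by simp
  then obtain \<beta> where \<beta>: "\<beta> \<in> Hom A X c" "\<beta> \<cdot> \<pi> = g \<cdot> p"
    by (rule ses_desc[OF Q]) (simp_all add: hom_iff)
  have "(v \<cdot> q) \<cdot> w = Zero A a e" by simp
  then obtain \<epsilon> where \<epsilon>: "\<epsilon> \<in> Hom A X e" "\<epsilon> \<cdot> \<pi> = v \<cdot> q"
    by (rule ses_desc[OF Q]) (simp_all add: hom_iff)
  note [simp] = HomD[OF \<beta>(1)] \<beta>(2) comp_eq_comp[OF \<beta>(2)] HomD[OF \<epsilon>(1)] \<epsilon>(2) comp_eq_comp[OF \<epsilon>(2)]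
  \<comment> \<open>Modulo the image of \<open>w\<close> a component in the image of \<open>f\<close> can be moved to the other summand.\<close>
  have move: "\<pi> \<cdot> (i \<cdot> (f \<cdot> x)) = \<pi> \<cdot> (j \<cdot> neg (u \<cdot> x))" "\<pi> \<cdot> (j \<cdot> (u \<cdot> x)) = \<pi> \<cdot> (i \<cdot> neg (f \<cdot> x))"
    if x: "x \<in> Hom A t a" for x t
  proof -
    note [simp] = HomD[OF x]
    have "\<pi> \<cdot> (w \<cdot> x) = Plus A (\<pi> \<cdot> (i \<cdot> (f \<cdot> x))) (\<pi> \<cdot> (j \<cdot> (u \<cdot> x)))"
      unfolding w_def by simp
    hence *: "Plus A (\<pi> \<cdot> (i \<cdot> (f \<cdot> x))) (\<pi> \<cdot> (j \<cdot> (u \<cdot> x))) = Zero A t X" by simp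
    hence "\<pi> \<cdot> (j \<cdot> (u \<cdot> x)) = neg (\<pi> \<cdot> (i \<cdot> (f \<cdot> x)))"
      by (rule neg_unique) (simp_all add: hom_iff)
    thus "\<pi> \<cdot> (j \<cdot> (u \<cdot> x)) = \<pi> \<cdot> (i \<cdot> neg (f \<cdot> x))" by simp
    have "Plus A (\<pi> \<cdot> (j \<cdot> (u \<cdot> x))) (\<pi> \<cdot> (i \<cdot> (f \<cdot> x))) = Zero A t X"
      using * by (subst Plus_commute[of _ t X]) (simp_all add: hom_iff)
    hence "\<pi> \<cdot> (i \<cdot> (f \<cdot> x)) = neg (\<pi> \<cdot> (j \<cdot> (u \<cdot> x)))"
      by (rule neg_unique) (simp_all add: hom_iff)
    thus "\<pi> \<cdot> (i \<cdot> (f \<cdot> x)) = \<pi> \<cdot> (j \<cdot> neg (u \<cdot> x))" by simp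
  qed
  have "ses (\<pi> \<cdot> j) \<beta> d X c"
  proof (rule sesI[OF _ \<beta>(1)])
    show "\<pi> \<cdot> j \<in> Hom A d X" "\<beta> \<cdot> (\<pi> \<cdot> j) = Zero A d c" by (simp_all add: hom_iff)
    fix P assume P: "projective A P"
    {
      fix y assume y: "y \<in> Hom A P d" "\<pi> \<cdot> j \<cdot> y = Zero A P X"
      note [simp] = HomD[OF y(1)]
      have "\<pi> \<cdot> (j \<cdot> y) = Zero A P X" using y(2) by simp
      then obtain z where z: "z \<in> Hom A P a" "w \<cdot> z = j \<cdot> y"
        by (rule ses_lift[OF Q]) (simp_all add: hom_iff)
      note [simp] = HomD[OF z(1)]
      have "f \<cdot> z = p \<cdot> (w \<cdot> z)" by simp
      hence "f \<cdot> z = Zero A P b" unfolding z(2) by simp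
      hence z0: "z = Zero A P a" by (rule ses_zero[OF S _ z(1)])
      have "y = q \<cdot> (j \<cdot> y)" by simp
      also have "\<dots> = Zero A P d" unfolding z(2)[symmetric] z0 by simp
      finally show "y = Zero A P d" .
    next
      fix y assume y: "y \<in> Hom A P c"
      obtain z where z: "z \<in> Hom A P b" "g \<cdot> z = y" by (rule ses_proj[OF S P y])
      note [simp] = HomD[OF z(1)]
      show "\<exists>x\<in>Hom A P X. \<beta> \<cdot> x = y"
        using z(2) by (intro bexI[of _ "\<pi> \<cdot> (i \<cdot> z)"]) (simp_all add: hom_iff)
    next
      fix x assume x: "x \<in> Hom A P X" "\<beta> \<cdot> x = Zero A P c"
      obtain y where y: "y \<in> Hom A P s" "\<pi> \<cdot> y = x" by (rule ses_proj[OF Q P x(1)])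
      note [simp] = HomD[OF x(1)] HomD[OF y(1)]
      have "g \<cdot> (p \<cdot> y) = \<beta> \<cdot> (\<pi> \<cdot> y)" by simp
      hence "g \<cdot> (p \<cdot> y) = Zero A P c" unfolding y(2) x(2) .
      then obtain z where z: "z \<in> Hom A P a" "f \<cdot> z = p \<cdot> y"
        by (rule ses_lift[OF S]) (simp_all add: hom_iff)
      note [simp] = HomD[OF z(1)]
      have "x = \<pi> \<cdot> Plus A (i \<cdot> (p \<cdot> y)) (j \<cdot> (q \<cdot> y))"
        using y(2) biproduct_decomp[OF B y(1)] by simp
      also have "\<dots> = Plus A (\<pi> \<cdot> (i \<cdot> (f \<cdot> z))) (\<pi> \<cdot> (j \<cdot> (q \<cdot> y)))" unfolding z(2) by simp
      also have "\<dots> = \<pi> \<cdot> j \<cdot> Plus A (neg (u \<cdot> z)) (q \<cdot> y)" unfolding move(1)[OF z(1)] by simp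
      finally show "\<exists>y\<in>Hom A P d. \<pi> \<cdot> j \<cdot> y = x"
        by (intro bexI[of _ "Plus A (neg (u \<cdot> z)) (q \<cdot> y)"]) (simp_all add: hom_iff)
    }
  qed
  moreover have "ses (\<pi> \<cdot> i) \<epsilon> b X e"
  proof (rule sesI[OF _ \<epsilon>(1)])
    show "\<pi> \<cdot> i \<in> Hom A b X" "\<epsilon> \<cdot> (\<pi> \<cdot> i) = Zero A b e" by (simp_all add: hom_iff)
    fix P assume P: "projective A P"
    {
      fix y assume y: "y \<in> Hom A P b" "\<pi> \<cdot> i \<cdot> y = Zero A P X"
      note [simp] = HomD[OF y(1)]
      have "\<pi> \<cdot> (i \<cdot> y) = Zero A P X" using y(2) by simp
      then obtain z where z: "z \<in> Hom A P a" "w \<cdot> z = i \<cdot> y"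
        by (rule ses_lift[OF Q]) (simp_all add: hom_iff)
      note [simp] = HomD[OF z(1)]
      have "u \<cdot> z = q \<cdot> (w \<cdot> z)" by simp
      hence "u \<cdot> z = Zero A P d" unfolding z(2) by simp
      hence z0: "z = Zero A P a" by (rule ses_zero[OF T _ z(1)])
      have "y = p \<cdot> (i \<cdot> y)" by simp
      also have "\<dots> = Zero A P b" unfolding z(2)[symmetric] z0 by simp
      finally show "y = Zero A P b" .
    next
      fix y assume y: "y \<in> Hom A P e"
      obtain z where z: "z \<in> Hom A P d" "v \<cdot> z = y" by (rule ses_proj[OF T P y])
      note [simp] = HomD[OF z(1)]
      show "\<exists>x\<in>Hom A P X. \<epsilon> \<cdot> x = y"
        using z(2) by (intro bexI[of _ "\<pi> \<cdot> (j \<cdot> z)"]) (simp_all add: hom_iff)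
    next
      fix x assume x: "x \<in> Hom A P X" "\<epsilon> \<cdot> x = Zero A P e"
      obtain y where y: "y \<in> Hom A P s" "\<pi> \<cdot> y = x" by (rule ses_proj[OF Q P x(1)])
      note [simp] = HomD[OF x(1)] HomD[OF y(1)]
      have "v \<cdot> (q \<cdot> y) = \<epsilon> \<cdot> (\<pi> \<cdot> y)" by simp
      hence "v \<cdot> (q \<cdot> y) = Zero A P e" unfolding y(2) x(2) .
      then obtain z where z: "z \<in> Hom A P a" "u \<cdot> z = q \<cdot> y"
        by (rule ses_lift[OF T]) (simp_all add: hom_iff)
      note [simp] = HomD[OF z(1)]
      have "x = \<pi> \<cdot> Plus A (i \<cdot> (p \<cdot> y)) (j \<cdot> (q \<cdot> y))"
        using y(2) biproduct_decomp[OF B y(1)] by simp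
      also have "\<dots> = Plus A (\<pi> \<cdot> (i \<cdot> (p \<cdot> y))) (\<pi> \<cdot> (j \<cdot> (u \<cdot> z)))" unfolding z(2) by simp
      also have "\<dots> = \<pi> \<cdot> i \<cdot> Plus A (p \<cdot> y) (neg (f \<cdot> z))" unfolding move(2)[OF z(1)] by simp
      finally show "\<exists>y\<in>Hom A P b. \<pi> \<cdot> i \<cdot> y = x"
        by (intro bexI[of _ "Plus A (p \<cdot> y) (neg (f \<cdot> z))"]) (simp_all add: hom_iff)
    }
  qed
  ultimately show ?thesis using that unfolding ext_def by blast
qed

text \<open>
  The two sequences are added componentwise; the biproducts are prescribed because the results are
  used for biproducts that arise from splittings.
\<close>

lemma ext_sum:
  assumes "ext a b c" "ext a' b' c'"
    and Ba: "is_biproduct A a a' sa ia ja pa qa"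
    and Bb: "is_biproduct A b b' sb ib jb pb qb"
    and Bc: "is_biproduct A c c' sc ic jc pc qc"
  shows "ext sa sb sc"
proof -
  obtain f g f' g' where S: "ses f g a b c" and T: "ses f' g' a' b' c'"
    using assms unfolding ext_def by blast
  note [simp] = ses_simps[OF S] ses_simps[OF T] biproduct_simps[OF Ba] biproduct_simps[OF Bb] biproduct_simps[OF Bc]
  define F G where "F = Plus A (ib \<cdot> (f \<cdot> pa)) (jb \<cdot> (f' \<cdot> qa))"
    and "G = Plus A (ic \<cdot> (g \<cdot> pb)) (jc \<cdot> (g' \<cdot> qb))"
  have [simp]: "F \<in> Arr A" "Dom A F = sa" "Cod A F = sb" "G \<in> Arr A" "Dom A G = sb" "Cod A G = sc"
    by (simp_all add: F_def G_def)
  have e: "pb \<cdot> F = f \<cdot> pa" "qb \<cdot> F = f' \<cdot> qa" "pc \<cdot> G = g \<cdot> pb" "qc \<cdot> G = g' \<cdot> qb"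
    by (simp_all add: F_def G_def)
  note [simp] = e comp_eq_comp[OF e(1)] comp_eq_comp[OF e(2)] comp_eq_comp[OF e(3)] comp_eq_comp[OF e(4)]
  have "ses F G sa sb sc"
  proof (rule sesI)
    show "F \<in> Hom A sa sb" "G \<in> Hom A sb sc" by (simp_all add: hom_iff)
    show "G \<cdot> F = Zero A sa sc" by (rule biproduct_eqI[OF Bc]) (simp_all add: hom_iff)
    fix P assume P: "projective A P"
    {
      fix x assume x: "x \<in> Hom A P sa" "F \<cdot> x = Zero A P sb"
      note [simp] = HomD[OF x(1)]
      have "f \<cdot> (pa \<cdot> x) = pb \<cdot> (F \<cdot> x)" "f' \<cdot> (qa \<cdot> x) = qb \<cdot> (F \<cdot> x)" by simp_all
      hence 1: "f \<cdot> (pa \<cdot> x) = Zero A P b" and 2: "f' \<cdot> (qa \<cdot> x) = Zero A P b'"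
        unfolding x(2) by simp_all
      have 3: "pa \<cdot> x = Zero A P a" by (rule ses_zero[OF S 1]) (simp add: hom_iff)
      have 4: "qa \<cdot> x = Zero A P a'" by (rule ses_zero[OF T 2]) (simp add: hom_iff)
      show "x = Zero A P sa" by (rule biproduct_eqI[OF Ba]) (simp_all add: hom_iff 3 4)
    next
      fix y assume y: "y \<in> Hom A P sc"
      note [simp] = HomD[OF y]
      have "pc \<cdot> y \<in> Hom A P c" by (simp add: hom_iff)
      then obtain u where u: "u \<in> Hom A P b" "g \<cdot> u = pc \<cdot> y" by (rule ses_proj[OF S P])
      have "qc \<cdot> y \<in> Hom A P c'" by (simp add: hom_iff)
      then obtain v where v: "v \<in> Hom A P b'" "g' \<cdot> v = qc \<cdot> y" by (rule ses_proj[OF T P])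
      note [simp] = HomD[OF u(1)] HomD[OF v(1)]
      have "G \<cdot> Plus A (ib \<cdot> u) (jb \<cdot> v) = y"
        by (rule biproduct_eqI[OF Bc]) (simp_all add: hom_iff u(2) v(2) del: comp_Plus,
            simp_all add: u(2) v(2))
      thus "\<exists>x\<in>Hom A P sb. G \<cdot> x = y"
        by (intro bexI[of _ "Plus A (ib \<cdot> u) (jb \<cdot> v)"]) (simp_all add: hom_iff)
    next
      fix y assume y: "y \<in> Hom A P sb" "G \<cdot> y = Zero A P sc"
      note [simp] = HomD[OF y(1)]
      have "g \<cdot> (pb \<cdot> y) = pc \<cdot> (G \<cdot> y)" "g' \<cdot> (qb \<cdot> y) = qc \<cdot> (G \<cdot> y)" by simp_all
      hence 1: "g \<cdot> (pb \<cdot> y) = Zero A P c" and 2: "g' \<cdot> (qb \<cdot> y) = Zero A P c'"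
        unfolding y(2) by simp_all
      obtain u where u: "u \<in> Hom A P a" "f \<cdot> u = pb \<cdot> y"
        by (rule ses_lift[OF S 1]) (simp_all add: hom_iff)
      obtain v where v: "v \<in> Hom A P a'" "f' \<cdot> v = qb \<cdot> y"
        by (rule ses_lift[OF T 2]) (simp_all add: hom_iff)
      note [simp] = HomD[OF u(1)] HomD[OF v(1)]
      have "F \<cdot> Plus A (ia \<cdot> u) (ja \<cdot> v) = y"
        by (rule biproduct_eqI[OF Bb]) (simp_all add: hom_iff u(2) v(2) del: comp_Plus,
            simp_all add: u(2) v(2))
      thus "\<exists>x\<in>Hom A P sa. F \<cdot> x = y"
        by (intro bexI[of _ "Plus A (ia \<cdot> u) (ja \<cdot> v)"]) (simp_all add: hom_iff)
    }
  qed
  thus ?thesis unfolding ext_def by blast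
qed

lemma ext_zero_left: "is_zero A z \<Longrightarrow> X \<in> Ob A \<Longrightarrow> ext z X X"
  and ext_zero_right: "is_zero A z \<Longrightarrow> X \<in> Ob A \<Longrightarrow> ext X X z"
  using ses_of_biproduct[OF biproduct_zero] ses_of_biproduct[OF biproduct_swap[OF biproduct_zero]]
  unfolding ext_def by blast+

lemma zero_of_ext_mid:
  assumes "ext a z c" "is_zero A z"
  shows "is_zero A a" "is_zero A c"
proof -
  obtain f g where S: "ses f g a z c" using assms unfolding ext_def by blast
  note [simp] = ses_simps[OF S]
  have f: "f = Zero A a z" by (rule is_zero_simps(2)[OF assms(2)]) (simp_all add: hom_iff)
  have g: "g = Zero A z c" by (rule is_zero_simps(3)[OF assms(2)]) (simp_all add: hom_iff)
  have "f \<cdot> Id A a = f \<cdot> Zero A a a" using f by simp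
  hence "Id A a = Zero A a a" by (rule ses_mono[OF S]) (simp_all add: hom_iff)
  thus "is_zero A a" by (intro is_zeroI) simp_all
  have "Id A c \<cdot> g = Zero A c c \<cdot> g" using g by simp
  hence "Id A c = Zero A c c" by (rule epicD[OF ses_epic[OF S]]) (simp_all add: hom_iff)
  thus "is_zero A c" by (intro is_zeroI) simp_all
qed

lemma zero_of_ext_ends:
  assumes "ext a b c" "is_zero A a" "is_zero A c"
  shows "is_zero A b"
proof -
  obtain f g where S: "ses f g a b c" using assms unfolding ext_def by blast
  note [simp] = ses_simps[OF S]
  have g: "g = Zero A b c" by (rule is_zero_simps(2)[OF assms(3)]) (simp_all add: hom_iff)
  have "g \<cdot> Id A b = Zero A b c" using g by simp
  then obtain y where y: "y \<in> Hom A b a" "f \<cdot> y = Id A b"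
    by (rule ses_lift[OF S]) (simp_all add: hom_iff)
  have "y = Zero A b a" by (rule is_zero_simps(2)[OF assms(2) _ y(1)]) simp
  thus ?thesis using y(2) by (intro is_zeroI) simp_all
qed

lemma ext_iso_right:
  assumes "ext a b c" "isomorphic A c d"
  shows "ext a b d"
proof -
  obtain f g where S: "ses f g a b c" using assms unfolding ext_def by blast
  note [simp] = ses_simps[OF S]
  obtain u v where u: "u \<in> Hom A c d" and v: "v \<in> Hom A d c" and e: "v \<cdot> u = Id A c" "u \<cdot> v = Id A d"
    using assms(2) unfolding isomorphic_def by blast
  note [simp] = HomD[OF u] HomD[OF v] e comp_eq_comp[OF e(1)] comp_eq_comp[OF e(2)]
  have "ses f (u \<cdot> g) a b d"
  proof (rule sesI)
    show "f \<in> Hom A a b" "u \<cdot> g \<in> Hom A b d" "u \<cdot> g \<cdot> f = Zero A a d" by (simp_all add: hom_iff)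
    fix P assume P: "projective A P"
    {
      fix x assume x: "x \<in> Hom A P a" "f \<cdot> x = Zero A P b"
      show "x = Zero A P a" by (rule ses_zero[OF S x(2,1)])
    next
      fix y assume y: "y \<in> Hom A P d"
      note [simp] = HomD[OF y]
      have "v \<cdot> y \<in> Hom A P c" by (simp add: hom_iff)
      then obtain x where x: "x \<in> Hom A P b" "g \<cdot> x = v \<cdot> y" by (rule ses_proj[OF S P])
      note [simp] = HomD[OF x(1)]
      show "\<exists>x\<in>Hom A P b. u \<cdot> g \<cdot> x = y" by (rule bexI[OF _ x(1)]) (simp add: x(2))
    next
      fix y assume y: "y \<in> Hom A P b" "u \<cdot> g \<cdot> y = Zero A P d"
      note [simp] = HomD[OF y(1)]
      have "g \<cdot> y = v \<cdot> (u \<cdot> g \<cdot> y)" by simp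
      hence "g \<cdot> y = Zero A P c" unfolding y(2) by simp
      thus "\<exists>x\<in>Hom A P a. f \<cdot> x = y" using ses_lift[OF S _ y(1)] by metis
    }
  qed
  thus ?thesis unfolding ext_def by blast
qed

lemma ext_iso_left:
  assumes "ext a b c" "isomorphic A d a"
  shows "ext d b c"
proof -
  obtain f g where S: "ses f g a b c" using assms unfolding ext_def by blast
  note [simp] = ses_simps[OF S]
  obtain u v where u: "u \<in> Hom A d a" and v: "v \<in> Hom A a d" and e: "v \<cdot> u = Id A d" "u \<cdot> v = Id A a"
    using assms(2) unfolding isomorphic_def by blast
  note [simp] = HomD[OF u] HomD[OF v] e comp_eq_comp[OF e(1)] comp_eq_comp[OF e(2)]
  have "ses (f \<cdot> u) g d b c"
  proof (rule sesI)
    show "f \<cdot> u \<in> Hom A d b" "g \<in> Hom A b c" "g \<cdot> (f \<cdot> u) = Zero A d c" by (simp_all add: hom_iff)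
    fix P assume P: "projective A P"
    {
      fix x assume x: "x \<in> Hom A P d" "f \<cdot> u \<cdot> x = Zero A P b"
      note [simp] = HomD[OF x(1)]
      have "f \<cdot> (u \<cdot> x) = Zero A P b" using x(2) by simp
      hence *: "u \<cdot> x = Zero A P a" by (rule ses_zero[OF S]) (simp add: hom_iff)
      have "x = v \<cdot> (u \<cdot> x)" by simp
      thus "x = Zero A P d" unfolding * by simp
    next
      fix y assume y: "y \<in> Hom A P c"
      show "\<exists>x\<in>Hom A P b. g \<cdot> x = y" using ses_proj[OF S P y] by metis
    next
      fix y assume y: "y \<in> Hom A P b" "g \<cdot> y = Zero A P c"
      obtain x where x: "x \<in> Hom A P a" "f \<cdot> x = y" by (rule ses_lift[OF S y(2,1)])
      note [simp] = HomD[OF x(1)]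
      show "\<exists>x\<in>Hom A P d. f \<cdot> u \<cdot> x = y"
        using x(2) by (intro bexI[of _ "v \<cdot> x"]) (simp_all add: hom_iff)
    }
  qed
  thus ?thesis unfolding ext_def by blast
qed

lemma isomorphic_sym: "isomorphic A a b \<Longrightarrow> isomorphic A b a"
  unfolding isomorphic_def by blast

lemma isomorphic_refl: "a \<in> Ob A \<Longrightarrow> isomorphic A a a"
  unfolding isomorphic_def
  by (intro conjI bexI[of _ "Id A a"]) (simp_all add: hom_iff)

lemma isomorphic_trans:
  assumes "isomorphic A a b" "isomorphic A b c"
  shows "isomorphic A a c"
proof -
  obtain u v u' v' where u: "u \<in> Hom A a b" and v: "v \<in> Hom A b a" and e: "v \<cdot> u = Id A a" "u \<cdot> v = Id A b"
    and u': "u' \<in> Hom A b c" and v': "v' \<in> Hom A c b" and e': "v' \<cdot> u' = Id A b" "u' \<cdot> v' = Id A c"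
    using assms unfolding isomorphic_def by blast
  note [simp] = HomD[OF u] HomD[OF v] e comp_eq_comp[OF e(1)] comp_eq_comp[OF e(2)]
    HomD[OF u'] HomD[OF v'] e' comp_eq_comp[OF e'(1)] comp_eq_comp[OF e'(2)]
  show ?thesis unfolding isomorphic_def
    by (intro conjI bexI[of _ "u' \<cdot> u"] bexI[of _ "v \<cdot> v'"]) (simp_all add: hom_iff)
qed

lemma isomorphic_of_ext_zero_left:
  assumes "ext z b c" "is_zero A z"
  shows "isomorphic A b c"
proof -
  obtain f g where S: "ses f g z b c" using assms unfolding ext_def by blast
  note [simp] = ses_simps[OF S]
  have f: "f = Zero A z b" by (rule is_zero_simps(3)[OF assms(2)]) (simp_all add: hom_iff)
  have "Id A b \<cdot> f = Zero A z b" using f by simp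
  then obtain r where r: "r \<in> Hom A c b" "r \<cdot> g = Id A b"
    by (rule ses_desc[OF S]) (simp_all add: hom_iff)
  note [simp] = HomD[OF r(1)]
  have "(g \<cdot> r) \<cdot> g = Id A c \<cdot> g" by (simp add: r(2))
  hence "g \<cdot> r = Id A c" by (rule epicD[OF ses_epic[OF S]]) (simp_all add: hom_iff)
  thus ?thesis unfolding isomorphic_def
    by (intro conjI bexI[of _ g] bexI[of _ r]) (simp_all add: hom_iff r(2))
qed

lemma isomorphic_of_ext_zero_right:
  assumes "ext a b z" "is_zero A z"
  shows "isomorphic A a b"
proof -
  obtain f g where S: "ses f g a b z" using assms unfolding ext_def by blast
  note [simp] = ses_simps[OF S]
  have g: "g = Zero A b z" by (rule is_zero_simps(2)[OF assms(2)]) (simp_all add: hom_iff)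
  have "g \<cdot> Id A b = Zero A b z" using g by simp
  then obtain r where r: "r \<in> Hom A b a" "f \<cdot> r = Id A b"
    by (rule ses_lift[OF S]) (simp_all add: hom_iff)
  note [simp] = HomD[OF r(1)] r(2) comp_eq_comp[OF r(2)]
  have "f \<cdot> (r \<cdot> f) = f \<cdot> Id A a" by simp
  hence "r \<cdot> f = Id A a" by (rule ses_mono[OF S]) (simp_all add: hom_iff)
  thus ?thesis unfolding isomorphic_def
    by (intro conjI bexI[of _ f] bexI[of _ r]) (simp_all add: hom_iff)
qed

lemma is_zero_isomorphic:
  assumes "isomorphic A a b" "is_zero A a"
  shows "is_zero A b"
  using zero_of_ext_mid(2)[OF ext_iso_right[OF ext_zero_left[OF assms(2)] assms(1)] assms(2)]
    is_zero_simps(1)[OF assms(2)] by simp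

lemma ext_Ob: "ext a b c \<Longrightarrow> a \<in> Ob A \<and> b \<in> Ob A \<and> c \<in> Ob A"
  unfolding ext_def using ses_simps(7-9) by blast

text \<open>
  Pulling back along \<open>q \<rightarrow> c\<close> gives an extension of the projective \<open>q\<close> by \<open>a\<close>, which splits; so \<open>p \<oplus> q\<close>
  covers \<open>a \<oplus> q\<close>, which covers \<open>b\<close>, and the composite has the required kernel.
\<close>

lemma horseshoe:
  assumes "ext a b c" "ext a' p a" "ext c' q c" "projective A p" "projective A q"
  obtains b' s where "projective A s" "ext b' s b" "ext a' b' c'"
proof -
  obtain X where X: "ext a X q" "ext c' X b" using ext_pullback[OF assms(1,3)] by blast
  obtain i j p' q' where B: "is_biproduct A a q X i j p' q'"
    using X(1) projective_split[OF _ assms(5)] unfolding ext_def by blast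
  obtain s k l m n where Bs: "is_biproduct A p q s k l m n"
    using ex_biproduct[of p q] assms projective_Ob by blast
  obtain z where z: "is_zero A z" using ex_zero by blast
  have "ext z q q" using ext_zero_left[OF z] assms(5) projective_Ob by blast
  hence "ext a' s X"
    by (rule ext_sum[OF assms(2) _ biproduct_zero[OF z] Bs B]) (use ext_Ob[OF assms(2)] in blast)
  from ext_preimage[OF X(2) this] obtain b' where "ext b' s b" "ext a' b' c'" by blast
  thus ?thesis using that biproduct_projective[OF Bs assms(4,5)] by blast
qed

section \<open>Gorenstein projective objects\<close>

text \<open>
  Vanishing of \<open>Ext\<^sup>1(c, Q)\<close> for all projective \<open>Q\<close>, in the form that needs no \<open>Ext\<close>: every arrow from the
  subobject of an extension by \<open>c\<close> to a projective object extends.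
\<close>

definition orth :: "'a \<Rightarrow> bool" where
  "orth c \<longleftrightarrow> c \<in> Ob A \<and>
     (\<forall>f g a b u Q. ses f g a b c \<and> projective A Q \<and> u \<in> Hom A a Q \<longrightarrow> (\<exists>v\<in>Hom A b Q. v \<cdot> f = u))"

lemma orthD:
  assumes "orth c" "ses f g a b c" "projective A Q" "u \<in> Hom A a Q"
  obtains v where "v \<in> Hom A b Q" "v \<cdot> f = u"
  using assms unfolding orth_def by metis

text \<open>
  An arrow on \<open>D \<subseteq> p\<close>, where \<open>p / D = b\<close>, is extended in two steps, through the preimage of \<open>a\<close> in \<open>p\<close>.
\<close>

lemma orth_ext:
  assumes "ext a b c" "orth a" "orth c"
  shows "orth b"
  unfolding orth_def
proof (intro conjI allI impI; (elim conjE)?)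
  obtain f g where S: "ses f g a b c" using assms(1) unfolding ext_def by blast
  note [simp] = ses_simps[OF S]
  show "b \<in> Ob A" by simp
  fix d e D p u Q assume T: "ses d e D p b" and Q: "projective A Q" and u: "u \<in> Hom A D Q"
  note [simp] = ses_simps[OF T] HomD[OF u]
  obtain \<kappa> k \<delta> \<theta> where K: "ses \<kappa> (g \<cdot> e) k p c" and R: "ses \<delta> \<theta> D k a"
    and "f \<cdot> \<theta> = e \<cdot> \<kappa>" and \<delta>: "\<kappa> \<cdot> \<delta> = d"
    by (rule ses_preimage[OF S T])
  note [simp] = ses_simps(1-9)[OF K] ses_simps[OF R]
  obtain v where v: "v \<in> Hom A k Q" "v \<cdot> \<delta> = u" by (rule orthD[OF assms(2) R Q u])
  obtain w where w: "w \<in> Hom A p Q" "w \<cdot> \<kappa> = v" by (rule orthD[OF assms(3) K Q v(1)])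
  note [simp] = HomD[OF v(1)] HomD[OF w(1)]
  have "w \<cdot> (\<kappa> \<cdot> \<delta>) = (w \<cdot> \<kappa>) \<cdot> \<delta>" by simp
  hence "w \<cdot> d = u" unfolding w(2) v(2) \<delta> .
  thus "\<exists>v\<in>Hom A p Q. v \<cdot> d = u" using w(1) by blast
qed

text \<open>
  Given an extension of the retract \<open>K\<close> of \<open>X\<close>, extend the arrow over the pullback to \<open>X\<close> and
  restrict along the section of the pullback which comes from \<open>K \<rightarrow> X\<close>.
\<close>

lemma orth_retract:
  assumes X: "orth X" and i: "i \<in> Hom A K X" and p: "p \<in> Hom A X K" and pi: "p \<cdot> i = Id A K"
  shows "orth K"
  unfolding orth_def
proof (intro conjI allI impI; (elim conjE)?)
  note [simp] = HomD[OF i] HomD[OF p] pi comp_eq_comp[OF pi]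
  show "K \<in> Ob A" by simp
  fix f g a b u Q assume S: "ses f g a b K" and Q: "projective A Q" and u: "u \<in> Hom A a Q"
  note [simp] = ses_simps[OF S] HomD[OF u]
  obtain \<alpha> \<beta> \<gamma> X' where P: "ses \<alpha> \<beta> a X' X" "\<gamma> \<in> Hom A X' b" "g \<cdot> \<gamma> = p \<cdot> \<beta>" "\<gamma> \<cdot> \<alpha> = f"
    and univ: "\<And>t y z. y \<in> Hom A t b \<Longrightarrow> z \<in> Hom A t X \<Longrightarrow> g \<cdot> y = p \<cdot> z \<Longrightarrow> \<exists>x\<in>Hom A t X'. \<gamma> \<cdot> x = y \<and> \<beta> \<cdot> x = z"
    and joint: "\<And>t x y. x \<in> Hom A t X' \<Longrightarrow> y \<in> Hom A t X' \<Longrightarrow> \<gamma> \<cdot> x = \<gamma> \<cdot> y \<Longrightarrow> \<beta> \<cdot> x = \<beta> \<cdot> y \<Longrightarrow> x = y"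
    by (rule pullback[OF S p]) (rule that)
  note [simp] = ses_simps[OF P(1)] HomD[OF P(2)] P(4) comp_eq_comp[OF P(4)]
  obtain v where v: "v \<in> Hom A X' Q" "v \<cdot> \<alpha> = u" by (rule orthD[OF X P(1) Q u])
  have "\<exists>\<sigma>\<in>Hom A b X'. \<gamma> \<cdot> \<sigma> = Id A b \<and> \<beta> \<cdot> \<sigma> = i \<cdot> g"
    by (intro univ) (simp_all add: hom_iff)
  then obtain \<sigma> where \<sigma>: "\<sigma> \<in> Hom A b X'" "\<gamma> \<cdot> \<sigma> = Id A b" "\<beta> \<cdot> \<sigma> = i \<cdot> g" by blast
  note [simp] = HomD[OF v(1)] HomD[OF \<sigma>(1)] \<sigma>(2,3) comp_eq_comp[OF \<sigma>(2)] comp_eq_comp[OF \<sigma>(3)]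
  have "\<sigma> \<cdot> f = \<alpha>" by (rule joint) (simp_all add: hom_iff)
  hence "v \<cdot> \<sigma> \<cdot> f = u" using v(2) by simp
  thus "\<exists>w\<in>Hom A b Q. w \<cdot> f = u" by (intro bexI[of _ "v \<cdot> \<sigma>"]) (simp_all add: hom_iff)
qed

lemma orth_projective:
  assumes "projective A c"
  shows "orth c"
  unfolding orth_def
proof (intro conjI allI impI; (elim conjE)?)
  show "c \<in> Ob A" using assms by (rule projective_Ob)
  fix f g a b u Q assume S: "ses f g a b c" and Q: "projective A Q" and u: "u \<in> Hom A a Q"
  obtain s r where B: "is_biproduct A a c b f s r g" using projective_split[OF S assms] by blast
  note [simp] = biproduct_simps[OF B] HomD[OF u]
  show "\<exists>w\<in>Hom A b Q. w \<cdot> f = u" by (intro bexI[of _ "u \<cdot> r"]) (simp_all add: hom_iff)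
qed

lemma orth_split:
  assumes "orth c" "ses f g Q X c" "projective A Q"
  shows "\<exists>s r. is_biproduct A Q c X f s r g"
proof -
  have "Id A Q \<in> Hom A Q Q" using projective_Ob[OF assms(3)] by (rule Id_in_Hom)
  then obtain r where "r \<in> Hom A X Q" "r \<cdot> f = Id A Q" by (rule orthD[OF assms])
  from split_of_retraction[OF assms(2) this] show ?thesis by blast
qed

text \<open>
  A single presentation of \<open>c\<close> by a projective object decides \<open>orth c\<close>: in any extension \<open>b\<close> of \<open>c\<close> by
  \<open>a\<close>, the projective \<open>P\<close> maps to \<open>b\<close>, and \<open>b\<close> becomes the quotient of \<open>a \<oplus> P\<close> by \<open>K\<close>.
\<close>

lemma orth_of_presentation:
  assumes K: "ses k e K P c" and P: "projective A P"
    and ex: "\<And>Q u. projective A Q \<Longrightarrow> u \<in> Hom A K Q \<Longrightarrow> \<exists>v\<in>Hom A P Q. v \<cdot> k = u"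
  shows "orth c"
  unfolding orth_def
proof (intro conjI allI impI; (elim conjE)?)
  note [simp] = ses_simps[OF K]
  show "c \<in> Ob A" by simp
  fix f g a b u Q assume S: "ses f g a b c" and Q: "projective A Q" and u: "u \<in> Hom A a Q"
  note [simp] = ses_simps[OF S] HomD[OF u]
  have "e \<in> Hom A P c" by (simp add: hom_iff)
  then obtain l where l: "l \<in> Hom A P b" "g \<cdot> l = e" by (rule ses_proj[OF S P])
  note [simp] = HomD[OF l(1)] l(2) comp_eq_comp[OF l(2)]
  have "g \<cdot> (l \<cdot> k) = Zero A K c" by simp
  then obtain \<theta> where \<theta>: "\<theta> \<in> Hom A K a" "f \<cdot> \<theta> = l \<cdot> k"
    by (rule ses_lift[OF S]) (simp_all add: hom_iff)
  note [simp] = HomD[OF \<theta>(1)] \<theta>(2) comp_eq_comp[OF \<theta>(2)]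
  have "u \<cdot> \<theta> \<in> Hom A K Q" by (simp add: hom_iff)
  then obtain w where w: "w \<in> Hom A P Q" "w \<cdot> k = u \<cdot> \<theta>" using ex[OF Q] by blast
  note [simp] = HomD[OF w(1)] w(2)
  obtain s i j p q where B: "is_biproduct A a P s i j p q" using ex_biproduct[of a P] by auto
  note [simp] = biproduct_simps[OF B]
  define \<phi> \<kappa> \<psi> where "\<phi> = Plus A (f \<cdot> p) (l \<cdot> q)" and "\<kappa> = Plus A (i \<cdot> neg \<theta>) (j \<cdot> k)"
    and "\<psi> = Plus A (u \<cdot> p) (w \<cdot> q)"
  have [simp]: "\<phi> \<in> Arr A" "Dom A \<phi> = s" "Cod A \<phi> = b" "\<kappa> \<in> Arr A" "Dom A \<kappa> = K" "Cod A \<kappa> = s"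
    "\<psi> \<in> Arr A" "Dom A \<psi> = s" "Cod A \<psi> = Q"
    by (simp_all add: \<phi>_def \<kappa>_def \<psi>_def)
  have e: "p \<cdot> \<kappa> = neg \<theta>" "q \<cdot> \<kappa> = k" "\<phi> \<cdot> i = f" "\<psi> \<cdot> i = u"
    by (simp_all add: \<phi>_def \<kappa>_def \<psi>_def)
  note [simp] = e comp_eq_comp[OF e(1)] comp_eq_comp[OF e(2)] comp_eq_comp[OF e(3)] comp_eq_comp[OF e(4)]
  have "ses \<kappa> \<phi> K s b"
  proof (rule sesI)
    show "\<kappa> \<in> Hom A K s" "\<phi> \<in> Hom A s b" by (simp_all add: hom_iff)
    show "\<phi> \<cdot> \<kappa> = Zero A K b" unfolding \<phi>_def by simp
    fix R assume R: "projective A R"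
    {
      fix x assume x: "x \<in> Hom A R K" "\<kappa> \<cdot> x = Zero A R s"
      note [simp] = HomD[OF x(1)]
      have "k \<cdot> x = q \<cdot> (\<kappa> \<cdot> x)" by simp
      hence "k \<cdot> x = Zero A R P" unfolding x(2) by simp
      thus "x = Zero A R K" by (rule ses_zero[OF K _ x(1)])
    next
      fix y assume y: "y \<in> Hom A R b"
      note [simp] = HomD[OF y]
      have "g \<cdot> y \<in> Hom A R c" by (simp add: hom_iff)
      then obtain z where z: "z \<in> Hom A R P" "e \<cdot> z = g \<cdot> y" by (rule ses_proj[OF K R])
      note [simp] = HomD[OF z(1)]
      have "g \<cdot> Plus A y (neg (l \<cdot> z)) = Zero A R c" using z(2) by simp
      then obtain x where x: "x \<in> Hom A R a" "f \<cdot> x = Plus A y (neg (l \<cdot> z))"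
        by (rule ses_lift[OF S]) (simp_all add: hom_iff)
      note [simp] = HomD[OF x(1)]
      have "\<phi> \<cdot> Plus A (i \<cdot> x) (j \<cdot> z) = Plus A (f \<cdot> x) (l \<cdot> z)" unfolding \<phi>_def by simp
      also have "\<dots> = y" unfolding x(2) by (subst Plus_assoc[of _ R b]) (simp_all add: hom_iff)
      finally show "\<exists>x\<in>Hom A R s. \<phi> \<cdot> x = y"
        by (intro bexI[of _ "Plus A (i \<cdot> x) (j \<cdot> z)"]) (simp_all add: hom_iff)
    next
      fix y assume y: "y \<in> Hom A R s" "\<phi> \<cdot> y = Zero A R b"
      note [simp] = HomD[OF y(1)]
      have 1: "Plus A (f \<cdot> (p \<cdot> y)) (l \<cdot> (q \<cdot> y)) = Zero A R b" using y(2) unfolding \<phi>_def by simp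
      have "g \<cdot> Plus A (f \<cdot> (p \<cdot> y)) (l \<cdot> (q \<cdot> y)) = e \<cdot> (q \<cdot> y)" by simp
      hence "e \<cdot> (q \<cdot> y) = Zero A R c" unfolding 1 by simp
      then obtain x where x: "x \<in> Hom A R K" "k \<cdot> x = q \<cdot> y"
        by (rule ses_lift[OF K]) (simp_all add: hom_iff)
      note [simp] = HomD[OF x(1)]
      have "Plus A (l \<cdot> (q \<cdot> y)) (f \<cdot> (p \<cdot> y)) = Zero A R b"
        using 1 by (subst Plus_commute[of _ R b]) (simp_all add: hom_iff)
      hence "f \<cdot> (p \<cdot> y) = neg (l \<cdot> (q \<cdot> y))" by (rule neg_unique) (simp_all add: hom_iff)
      also have "\<dots> = f \<cdot> neg (\<theta> \<cdot> x)" unfolding x(2)[symmetric] by simp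
      finally have "p \<cdot> y = neg (\<theta> \<cdot> x)" by (rule ses_mono[OF S]) (simp_all add: hom_iff)
      hence "p \<cdot> (\<kappa> \<cdot> x) = p \<cdot> y" by simp
      hence "\<kappa> \<cdot> x = y" by (rule biproduct_eqI[OF B, rotated 2]) (simp_all add: hom_iff x(2))
      thus "\<exists>x\<in>Hom A R K. \<kappa> \<cdot> x = y" using x(1) by blast
    }
  qed
  note T = this
  have "\<psi> \<cdot> \<kappa> = Zero A K Q" unfolding \<psi>_def by simp
  then obtain v where v: "v \<in> Hom A b Q" "v \<cdot> \<phi> = \<psi>"
    by (rule ses_desc[OF T]) (simp_all add: hom_iff)
  note [simp] = HomD[OF v(1)]
  have "v \<cdot> (\<phi> \<cdot> i) = (v \<cdot> \<phi>) \<cdot> i" by (simp del: e)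
  hence "v \<cdot> f = u" unfolding v(2) by simp
  thus "\<exists>v\<in>Hom A b Q. v \<cdot> f = u" using v(1) by blast
qed

text \<open>
  Dual to the horseshoe.  The pushout along \<open>a \<rightarrow> p\<close> is an extension of \<open>c\<close> by \<open>p\<close>, and \<open>orth c\<close> makes
  it split.
\<close>

lemma cohorseshoe:
  assumes "ext a b c" "ext a p a'" "ext c q c'" "projective A p" "projective A q" "orth c"
  obtains b' s where "projective A s" "ext b s b'" "ext a' b' c'"
proof -
  obtain X where X: "ext p X c" "ext b X a'" using ext_pushout[OF assms(1,2)] by blast
  obtain i j p' q' where B: "is_biproduct A p c X i j p' q'"
    using X(1) orth_split[OF assms(6) _ assms(4)] unfolding ext_def by blast
  obtain s k l m n where Bs: "is_biproduct A p q s k l m n"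
    using ex_biproduct[of p q] assms projective_Ob by blast
  obtain z where z: "is_zero A z" using ex_zero by blast
  have p: "ext p p z" using ext_zero_right[OF z] assms(4) projective_Ob by blast
  have "c' \<in> Ob A" using ext_Ob[OF assms(3)] by blast
  from ext_sum[OF p assms(3) B Bs biproduct_swap[OF biproduct_zero[OF z this]]] have "ext X s c'" .
  from ext_quotient[OF X(2) this] obtain b' where "ext b s b'" "ext a' b' c'" by blast
  thus ?thesis using that biproduct_projective[OF Bs assms(4,5)] by blast
qed

text \<open>
  The coinductive description of Gorenstein projective objects: a complete resolution is unfolded one
  step at a time in both directions.  As all syzygies and cosyzygies are again in the class, the
  vanishing of \<open>Ext\<^sup>1\<close> alone suffices.
\<close>

coinductive gp :: "'a \<Rightarrow> bool" where
  gpI: "\<lbrakk>orth G; projective A P; ext G P G'; gp G'; projective A P'; ext G'' P' G; gp G''\<rbrakk> \<Longrightarrow> gp G"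

lemma gp_projective: "projective A P \<Longrightarrow> gp P"
proof (coinduction arbitrary: P)
  case gp
  obtain z where z: "is_zero A z" using ex_zero by blast
  have P: "P \<in> Ob A" using gp by (rule projective_Ob)
  show ?case
    using orth_projective[OF gp] gp ext_zero_right[OF z P] ext_zero_left[OF z P] zero_projective[OF z] by blast
qed

lemma gp_orth: "gp G \<Longrightarrow> orth G"
  by (auto elim: gp.cases)

text \<open>
  Closure under extensions, by coinduction: the horseshoe and its dual yield syzygies and cosyzygies
  that are extensions of those of the outer terms.
\<close>

lemma gp_ext: "\<lbrakk>gp a; gp c; ext a b c\<rbrakk> \<Longrightarrow> gp b"
proof (coinduction arbitrary: a b c)
  case gp
  obtain p a' pp a'' where a: "orth a" "projective A p" "ext a p a'" "gp a'" "projective A pp" "ext a'' pp a" "gp a''"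
    using gp(1) by (auto elim: gp.cases)
  obtain q c' qq c'' where c: "orth c" "projective A q" "ext c q c'" "gp c'" "projective A qq" "ext c'' qq c" "gp c''"
    using gp(2) by (auto elim: gp.cases)
  obtain b' s where 1: "projective A s" "ext b s b'" "ext a' b' c'"
    by (rule cohorseshoe[OF gp(3) a(3) c(3) a(2) c(2) c(1)])
  obtain b'' ss where 2: "projective A ss" "ext b'' ss b" "ext a'' b'' c''"
    by (rule horseshoe[OF gp(3) a(6) c(6) a(5) c(5)])
  show ?case using orth_ext[OF gp(3) a(1) c(1)] 1 2 a c by blast
qed

lemma gp_Ob: "gp G \<Longrightarrow> G \<in> Ob A"
  using gp_orth by (simp add: orth_def)

lemma ext_of_iso:
  assumes "isomorphic A a b" "is_zero A z"
  shows "ext a b z"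
  using ext_iso_left[OF ext_zero_right[OF assms(2)] assms(1)] assms(1) by (simp add: isomorphic_def)

lemma gp_zero: "is_zero A z \<Longrightarrow> gp z"
  by (intro gp_projective zero_projective)

text \<open>
  An object isomorphic to \<open>a\<close> is an extension of a zero object by \<open>a\<close>.
\<close>

lemma gp_iso:
  assumes "gp a" "isomorphic A a b"
  shows "gp b"
proof -
  obtain z where z: "is_zero A z" using ex_zero by blast
  from gp_ext[OF assms(1) gp_zero[OF z] ext_of_iso[OF assms(2) z]] show ?thesis .
qed

lemma ext_projective_swap:
  assumes "ext K X P" "projective A P"
  obtains i j p q where "is_biproduct A K P X i j p q" "ext P X K"
  using projective_split[OF _ assms(2)] ses_of_biproduct[OF biproduct_swap] assms(1)
  unfolding ext_def by metis

text \<open>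
  As \<open>X\<close> is \<open>K \<oplus> P\<close>, both \<open>X \<rightarrow> K\<close> and \<open>K \<rightarrow> X\<close> are available.  A syzygy of \<open>K\<close> is then an extension of
  \<open>P\<close> by a syzygy of \<open>X\<close>, and a cosyzygy an extension of a cosyzygy of \<open>X\<close> by \<open>P\<close>.
\<close>

lemma gp_split:
  assumes "gp X" "ext K X P" "projective A P"
  shows "gp K"
proof -
  obtain p X' pp X'' where X: "projective A p" "ext X p X'" "gp X'" "projective A pp" "ext X'' pp X" "gp X''"
    using assms(1) by (auto elim: gp.cases)
  obtain i j pr q where B: "is_biproduct A K P X i j pr q" and PXK: "ext P X K"
    by (rule ext_projective_swap[OF assms(2,3)])
  have 1: "orth K"
    by (rule orth_retract[OF gp_orth[OF assms(1)], of i _ pr])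
      (use B in \<open>auto simp: is_biproduct_def\<close>)
  obtain k where 2: "ext k pp K" "ext X'' k P" by (rule ext_preimage[OF PXK X(5)])
  obtain n where 3: "ext K p n" "ext P n X'" by (rule ext_quotient[OF assms(2) X(2)])
  show ?thesis
    by (rule gpI[OF 1 X(1) 3(1) _ X(4) 2(1)])
      (use gp_ext[OF _ _ 3(2)] gp_ext[OF _ _ 2(2)] gp_projective[OF assms(3)] X in blast)+
qed

section \<open>Gorenstein projective dimension\<close>

text \<open>
  \<open>gdim n M\<close> expresses that the Gorenstein projective dimension of \<open>M\<close> is at most \<open>n\<close>.
\<close>

primrec gdim :: "nat \<Rightarrow> 'a \<Rightarrow> bool" where
  "gdim 0 M \<longleftrightarrow> gp M"
| "gdim (Suc n) M \<longleftrightarrow> (\<exists>K G. gp G \<and> ext K G M \<and> gdim n K)"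

lemma gdim_Suc: "gdim n M \<Longrightarrow> gdim (Suc n) M"
proof (induction n arbitrary: M)
  case 0
  obtain z where z: "is_zero A z" using ex_zero by blast
  from 0 show ?case using gp_zero[OF z] ext_zero_left[OF z gp_Ob] by auto
next
  case (Suc n)
  then obtain K G where "gp G" "ext K G M" "gdim n K" by auto
  with Suc.IH[of K] show ?case by (metis gdim.simps(2))
qed

lemma gdim_mono: "m \<le> n \<Longrightarrow> gdim m M \<Longrightarrow> gdim n M"
  by (induction n rule: dec_induct) (blast intro: gdim_Suc)+

lemma gdim_gp: "gp M \<Longrightarrow> gdim n M"
  by (rule gdim_mono[of 0]) simp_all

text \<open>
  The first step of a resolution can be taken projective: replace \<open>G\<close> by a projective object covering it; the
  new kernel is an extension of \<open>K\<close> by a syzygy of \<open>G\<close>.  Closure under extensions in dimension \<open>n\<close> is a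
  hypothesis, because its proof in dimension \<open>n + 1\<close> uses this lemma.
\<close>

lemma gdim_cover_aux:
  assumes "\<And>a b c. ext a b c \<Longrightarrow> gdim n a \<Longrightarrow> gdim n c \<Longrightarrow> gdim n b" "gdim (Suc n) M"
  obtains K P where "projective A P" "ext K P M" "gdim n K"
proof -
  obtain K G where K: "gp G" "ext K G M" "gdim n K" using assms(2) by auto
  obtain G' P where P: "projective A P" "ext G' P G" "gp G'" using K(1) by (auto elim: gp.cases)
  obtain k where k: "ext k P M" "ext G' k K" by (rule ext_preimage[OF K(2) P(2)])
  show ?thesis by (rule that[OF P(1) k(1) assms(1)[OF k(2) gdim_gp[OF P(3)] K(3)]])
qed

lemma gdim_ext: "ext a b c \<Longrightarrow> gdim n a \<Longrightarrow> gdim n c \<Longrightarrow> gdim n b"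
proof (induction n arbitrary: a b c)
  case 0
  thus ?case using gp_ext[of a c b] by simp
next
  case (Suc n)
  obtain a' p where a: "projective A p" "ext a' p a" "gdim n a'"
    by (rule gdim_cover_aux[OF Suc.IH Suc.prems(2)])
  obtain c' q where c: "projective A q" "ext c' q c" "gdim n c'"
    by (rule gdim_cover_aux[OF Suc.IH Suc.prems(3)])
  obtain b' s where b: "projective A s" "ext b' s b" "ext a' b' c'"
    by (rule horseshoe[OF Suc.prems(1) a(2) c(2) a(1) c(1)])
  show ?case using Suc.IH[OF b(3) a(3) c(3)] b gp_projective by auto
qed

lemma gdim_cover:
  assumes "gdim (Suc n) M"
  obtains K P where "projective A P" "ext K P M" "gdim n K"
  by (rule gdim_cover_aux[OF gdim_ext assms])

lemma gdim_zero: "is_zero A z \<Longrightarrow> gdim n z"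
  by (intro gdim_gp gp_zero)

lemma gdim_iso:
  assumes "gdim n a" "isomorphic A a b"
  shows "gdim n b"
proof -
  obtain z where z: "is_zero A z" using ex_zero by blast
  from gdim_ext[OF ext_of_iso[OF assms(2) z] assms(1) gdim_zero[OF z]] show ?thesis .
qed

text \<open>
  \<open>K\<close> is also the quotient of \<open>X\<close> by \<open>P\<close>.  Its syzygy with respect to a cover of \<open>X\<close> is an extension of
  \<open>P\<close> by a syzygy of \<open>X\<close>.
\<close>

lemma gdim_split:
  assumes "gdim n X" "ext K X P" "projective A P"
  shows "gdim n K"
proof (cases n)
  case 0
  thus ?thesis using gp_split assms by simp
next
  case (Suc m)
  obtain i j pr q where PXK: "ext P X K" by (rule ext_projective_swap[OF assms(2,3)])
  obtain X' R where R: "projective A R" "ext X' R X" "gdim m X'"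
    using gdim_cover[OF assms(1)[unfolded Suc]] by blast
  obtain k where k: "ext k R K" "ext X' k P" by (rule ext_preimage[OF PXK R(2)])
  have "gdim m k" by (rule gdim_ext[OF k(2) R(3) gdim_gp[OF gp_projective[OF assms(3)]]])
  thus ?thesis using k(1) gp_projective[OF R(1)] Suc by auto
qed

text \<open>
  After pulling back an epimorphism from a projective object to \<open>c\<close>, the object \<open>a\<close> is a complement of a projective object in
  an extension of \<open>b\<close>.  In dimension zero this is closure under kernels of epimorphisms.
\<close>

lemma gdim_kernel:
  assumes "ext a b c" "gdim n b" "gdim (Suc n) c"
  shows "gdim n a"
proof -
  obtain c' P where P: "projective A P" "ext c' P c" "gdim n c'" by (rule gdim_cover[OF assms(3)])
  obtain X where X: "ext a X P" "ext c' X b" by (rule ext_pullback[OF assms(1) P(2)])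
  show ?thesis by (rule gdim_split[OF gdim_ext[OF X(2) P(3) assms(2)] X(1) P(1)])
qed

text \<open>
  The kernel of \<open>P \<rightarrow> b \<rightarrow> c\<close> for a projective \<open>P\<close> covering \<open>b\<close> is an extension of \<open>a\<close> by a syzygy of \<open>b\<close>.
\<close>

lemma gdim_cokernel:
  assumes "ext a b c" "gdim n a" "gdim (Suc n) b"
  shows "gdim (Suc n) c"
proof -
  obtain b' P where P: "projective A P" "ext b' P b" "gdim n b'" by (rule gdim_cover[OF assms(3)])
  obtain k where k: "ext k P c" "ext b' k a" by (rule ext_preimage[OF assms(1) P(2)])
  from gdim_ext[OF k(2) P(3) assms(2)] gp_projective[OF P(1)] k(1) show ?thesis by auto
qed

text \<open>
  Knowing \<open>gdim (n + 1) M\<close>, the dimension of \<open>M\<close> is at most that of a biproduct \<open>M \<oplus> N\<close>.  Syzygies reduce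
  this to \<open>n = 0\<close>.  There \<open>M\<close> is the quotient of one Gorenstein projective object by another; pushing out along an
  embedding of the kernel into a projective \<open>Q\<close> gives a Gorenstein projective extension of \<open>M\<close> by \<open>Q\<close>,
  which splits because \<open>orth\<close> passes to summands.
\<close>

lemma gdim_summand:
  assumes "is_biproduct A M N S i j p q" "gdim n S" "gdim (Suc n) M"
  shows "gdim n M"
  using assms
proof (induction n arbitrary: M N S i j p q)
  case 0
  note B = 0(1)
  have S: "gp S" using 0 by simp
  have "orth M"
    by (rule orth_retract[OF gp_orth[OF S], of i _ p]) (use B in \<open>auto simp: is_biproduct_def\<close>)
  obtain K G where K: "gp G" "ext K G M" "gp K" using 0(3) by auto
  obtain K' Q where Q: "projective A Q" "ext K Q K'" "gp K'" using K(3) by (auto elim: gp.cases)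
  obtain X where X: "ext Q X M" "ext G X K'" by (rule ext_pushout[OF K(2) Q(2)])
  have "gp X" by (rule gp_ext[OF K(1) Q(3) X(2)])
  moreover have "ext M X Q"
    using X(1) orth_split[OF \<open>orth M\<close> _ Q(1)] ses_of_biproduct[OF biproduct_swap] unfolding ext_def by blast
  ultimately show ?case using gp_split[OF _ _ Q(1)] by simp
next
  case (Suc n)
  obtain K P where K: "projective A P" "ext K P M" "gdim (Suc n) K" by (rule gdim_cover[OF Suc.prems(3)])
  have "N \<in> Ob A" using biproduct_simps(14)[OF Suc.prems(1)] .
  then obtain u N' R v where R: "projective A R" "ses u v N' R N" by (rule cover)
  hence N': "ext N' R N" unfolding ext_def by blast
  obtain S' i' j' p' q' where B': "is_biproduct A K N' S' i' j' p' q'"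
    using ex_biproduct[of K N'] ext_Ob[OF K(2)] ext_Ob[OF N'] by blast
  obtain T i2 j2 p2 q2 where T: "is_biproduct A P R T i2 j2 p2 q2"
    using ex_biproduct[of P R] ext_Ob[OF K(2)] ext_Ob[OF N'] by blast
  have e: "ext S' T S" by (rule ext_sum[OF K(2) N' B' T Suc.prems(1)])
  have "gdim n T" using biproduct_projective[OF T K(1) R(1)] by (intro gdim_gp gp_projective)
  from Suc.IH[OF B' gdim_kernel[OF e this Suc.prems(2)] K(3)] have "gdim n K" .
  thus ?case using K gp_projective by auto
qed

section \<open>Copowers\<close>

lemma copower_0:
  assumes "is_copower A M 0 D"
  shows "is_zero A D"
proof -
  have D: "D \<in> Ob A" and u: "\<And>x. x \<in> Ob A \<Longrightarrow> \<exists>!h. h \<in> Hom A D x"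
    using assms unfolding is_copower_def by auto
  have "Id A D = Zero A D D" using u[OF D] D by (auto simp: hom_iff)
  with D show ?thesis by (rule is_zeroI)
qed

text \<open>
  The first coprojection has the retraction that is the identity on the first copy and zero on the
  others; its cokernel is the copower of the remaining copies.
\<close>

lemma copower_Suc:
  assumes "is_copower A M (Suc n) D"
  obtains D' i j p q where "is_biproduct A M D' D i j p q" "is_copower A M n D'"
proof -
  have [simp]: "D \<in> Ob A" "M \<in> Ob A" using assms by (auto simp: is_copower_def)
  obtain i where i': "\<forall>k<Suc n. i k \<in> Hom A M D"
    and u': "\<forall>x\<in>Ob A. \<forall>f. (\<forall>k<Suc n. f k \<in> Hom A M x) \<longrightarrow>
       (\<exists>!h. h \<in> Hom A D x \<and> (\<forall>k<Suc n. h \<cdot> i k = f k))"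
    using assms unfolding is_copower_def by (elim conjE exE) (rule that)
  have i: "i k \<in> Hom A M D" if "k < Suc n" for k using i' that by blast
  have u: "\<exists>!h. h \<in> Hom A D x \<and> (\<forall>k<Suc n. h \<cdot> i k = f k)"
    if "x \<in> Ob A" "\<And>k. k < Suc n \<Longrightarrow> f k \<in> Hom A M x" for x f
    using u' that by simp
  have i0: "i 0 \<in> Hom A M D" by (rule i) simp
  have ik: "i (Suc k) \<in> Hom A M D" if "k < n" for k by (rule i) (simp add: that)
  note [simp] = HomD[OF i0]
  have "\<exists>!h. h \<in> Hom A D M \<and> (\<forall>k<Suc n. h \<cdot> i k = (case k of 0 \<Rightarrow> Id A M | Suc _ \<Rightarrow> Zero A M M))"
    by (rule u) (auto simp: hom_iff split: nat.splits)
  then obtain r where r': "r \<in> Hom A D M"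
      "\<forall>k<Suc n. r \<cdot> i k = (case k of 0 \<Rightarrow> Id A M | Suc _ \<Rightarrow> Zero A M M)" by blast
  have "r \<cdot> i 0 = Id A M" using r'(2)[rule_format, of 0] by simp
  note r = r'(1) this
  note [simp] = HomD[OF r(1)]
  have "monic A (i 0)"
  proof (rule monicI[OF i0])
    fix t x assume x: "x \<in> Hom A t M" "i 0 \<cdot> x = Zero A t D"
    note [simp] = HomD[OF x(1)]
    have "(r \<cdot> i 0) \<cdot> x = r \<cdot> (i 0 \<cdot> x)" by simp
    thus "x = Zero A t M" unfolding x(2) r(2) by simp
  qed
  then obtain c D' where S: "ses (i 0) c M D D'" using ses_of_monic i0 by blast
  note [simp] = ses_simps[OF S]
  have "is_copower A M n D'"
    unfolding is_copower_def
  proof (intro conjI exI[of _ "\<lambda>k. c \<cdot> i (Suc k)"] allI impI ballI)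
    show "c \<cdot> i (Suc k) \<in> Hom A M D'" if "k < n" for k using HomD[OF ik[OF that]] by (simp add: hom_iff)
    fix x f assume x: "x \<in> Ob A" and f: "\<forall>k<n. f k \<in> Hom A M x"
    have "\<exists>!h. h \<in> Hom A D x \<and> (\<forall>k<Suc n. h \<cdot> i k = (case k of 0 \<Rightarrow> Zero A M x | Suc j \<Rightarrow> f j))" (is "\<exists>!h. ?P h")
      by (rule u) (use x f in \<open>auto simp: hom_iff split: nat.splits\<close>)
    then obtain h where h: "?P h" and hu: "\<And>h'. ?P h' \<Longrightarrow> h' = h" by (elim ex1E) (rule that, blast+)
    have h1: "h \<in> Hom A D x" "h \<cdot> i 0 = Zero A M x" and hk: "\<And>k. k < n \<Longrightarrow> h \<cdot> i (Suc k) = f k"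
      using h[THEN conjunct1] h[THEN conjunct2, rule_format, of 0] h[THEN conjunct2, rule_format, of "Suc k" for k]
      by simp_all
    obtain g where g: "g \<in> Hom A D' x" "g \<cdot> c = h" by (rule ses_desc[OF S h1(2,1)])
    note [simp] = HomD[OF h1(1)] HomD[OF g(1)]
    show "\<exists>!h. h \<in> Hom A D' x \<and> (\<forall>k<n. h \<cdot> (c \<cdot> i (Suc k)) = f k)"
    proof (intro ex1I[of _ g] conjI allI impI g(1))
      fix k assume k: "k < n"
      note [simp] = HomD[OF ik[OF k]]
      have "g \<cdot> (c \<cdot> i (Suc k)) = (g \<cdot> c) \<cdot> i (Suc k)" by simp
      thus "g \<cdot> (c \<cdot> i (Suc k)) = f k" unfolding g(2) hk[OF k] .
    next
      fix g' assume g': "g' \<in> Hom A D' x \<and> (\<forall>k<n. g' \<cdot> (c \<cdot> i (Suc k)) = f k)"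
      hence g'1: "g' \<in> Hom A D' x" by simp
      note [simp] = HomD[OF g'1]
      have "?P (g' \<cdot> c)"
      proof (intro conjI allI impI)
        show "g' \<cdot> c \<in> Hom A D x" by (simp add: hom_iff)
        fix k assume k: "k < Suc n"
        note [simp] = HomD[OF i[OF k]]
        show "g' \<cdot> c \<cdot> i k = (case k of 0 \<Rightarrow> Zero A M x | Suc j \<Rightarrow> f j)"
        proof (cases k)
          case 0 thus ?thesis by simp
        next
          case (Suc j)
          hence "g' \<cdot> (c \<cdot> i k) = f j" using g' k by auto
          moreover have "g' \<cdot> c \<cdot> i k = g' \<cdot> (c \<cdot> i k)" by simp
          ultimately show ?thesis using Suc by (simp del: comp_assoc)
        qed
      qed
      hence "g' \<cdot> c = h" by (rule hu)
      hence "g' \<cdot> c = g \<cdot> c" using g(2) by simp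
      thus "g' = g" by (rule epicD[OF ses_epic[OF S]]) (simp_all add: hom_iff)
    qed
  qed simp_all
  with split_of_retraction[OF S r] that show ?thesis by blast
qed

lemma copower_zero: "is_zero A z \<Longrightarrow> M \<in> Ob A \<Longrightarrow> is_copower A M 0 z"
  unfolding is_copower_def by (auto simp: is_zero_def)

lemma copower_one:
  assumes "M \<in> Ob A" shows "is_copower A M 1 M"
  unfolding is_copower_def
proof (intro conjI exI[of _ "\<lambda>_. Id A M"] allI impI ballI)
  fix x f assume "\<forall>k<1::nat. f k \<in> Hom A M x"
  hence f: "f 0 \<in> Hom A M x" by simp
  note [simp] = HomD[OF f]
  show "\<exists>!h. h \<in> Hom A M x \<and> (\<forall>k<1. h \<cdot> Id A M = f k)"
    by (rule ex1I[of _ "f 0"]) (use f in \<open>auto simp: hom_iff\<close>)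
qed (use assms in \<open>auto simp: hom_iff\<close>)

lemma gdim_copower: "is_copower A M a D \<Longrightarrow> gdim n M \<Longrightarrow> gdim n D"
proof (induction a arbitrary: D)
  case 0
  thus ?case using copower_0 gdim_zero by blast
next
  case (Suc a)
  obtain D' i j p q where "is_biproduct A M D' D i j p q" "is_copower A M a D'"
    by (rule copower_Suc[OF Suc.prems(1)])
  thus ?case using gdim_ext[of M D D' n] ses_of_biproduct Suc unfolding ext_def by blast
qed

lemma gdim_of_copower:
  assumes "is_copower A M a D" "a \<noteq> 0" "gdim n D" "gdim (Suc n) M"
  shows "gdim n M"
  using assms copower_Suc gdim_summand by (metis not0_implies_Suc)

lemma zero_of_copower:
  assumes "is_copower A M a D" "a \<noteq> 0" "is_zero A D"
  shows "is_zero A M"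
proof -
  obtain b where "a = Suc b" using assms(2) not0_implies_Suc by blast
  then obtain D' i j p q where "is_biproduct A M D' D i j p q"
    using copower_Suc assms(1) by metis
  thus ?thesis using zero_of_ext_mid(1)[of M D D'] assms(3) ses_of_biproduct unfolding ext_def by blast
qed

section \<open>Syzygies of a periodic approximation\<close>

text \<open>
  \<open>syz n M N\<close> expresses that \<open>N\<close> is an \<open>n\<close>-th syzygy of \<open>M\<close> for some projective resolution of \<open>M\<close>.
\<close>

primrec syz :: "nat \<Rightarrow> 'a \<Rightarrow> 'a \<Rightarrow> bool" where
  "syz 0 M N \<longleftrightarrow> M = N"
| "syz (Suc n) M N \<longleftrightarrow> (\<exists>K P. projective A P \<and> ext K P M \<and> syz n K N)"

lemma syz_append: "syz m M K \<Longrightarrow> syz n K N \<Longrightarrow> syz (m + n) M N"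
  by (induction m arbitrary: M) auto

lemma syz_split: "syz (m + n) M N \<Longrightarrow> \<exists>K. syz m M K \<and> syz n K N"
  by (induction m arbitrary: M) (auto, blast)

lemma syz_iso_left:
  assumes "syz (Suc n) M N" "isomorphic A M M'"
  shows "syz (Suc n) M' N"
  using assms ext_iso_right by (metis syz.simps(2))

lemma syz_iso_right: "syz (Suc n) M N \<Longrightarrow> isomorphic A N' N \<Longrightarrow> syz (Suc n) M N'"
proof (induction n arbitrary: M)
  case 0 thus ?case using ext_iso_left by auto
next
  case (Suc n)
  obtain K P where "projective A P" "ext K P M" "syz (Suc n) K N" using Suc.prems(1) by auto
  with Suc.IH Suc.prems(2) show ?case by (metis syz.simps(2))
qed

lemma syz_unroll:
  "syz n M N \<Longrightarrow> \<exists>K P. K 0 = M \<and> K n = N \<and> (\<forall>j<n. projective A (P j) \<and> ext (K (Suc j)) (P j) (K j))"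
proof (induction n arbitrary: M)
  case 0
  thus ?case by (intro exI[of _ "\<lambda>_. M"]) simp
next
  case (Suc n)
  obtain K0 P0 where 0: "projective A P0" "ext K0 P0 M" "syz n K0 N" using Suc.prems by auto
  obtain K P where K: "K 0 = K0" "K n = N" "\<forall>j<n. projective A (P j) \<and> ext (K (Suc j)) (P j) (K j)"
    using Suc.IH[OF 0(3)] by blast
  have "projective A (case j of 0 \<Rightarrow> P0 | Suc i \<Rightarrow> P i) \<and>
      ext (case Suc j of 0 \<Rightarrow> M | Suc i \<Rightarrow> K i) (case j of 0 \<Rightarrow> P0 | Suc i \<Rightarrow> P i) (case j of 0 \<Rightarrow> M | Suc i \<Rightarrow> K i)"
    if "j < Suc n" for j
    using that 0 K by (cases j) auto
  thus ?case using K(2)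
    by (intro exI[of _ "case_nat M K"] exI[of _ "case_nat P0 P"]) auto
qed

text \<open>
  Projective dimension less than \<open>n\<close>; the shift by one lets \<open>n = 0\<close> mean that \<open>L\<close> is zero.
\<close>

definition pdim :: "nat \<Rightarrow> 'a \<Rightarrow> bool" where
  "pdim n L \<longleftrightarrow> (\<exists>z. is_zero A z \<and> syz n L z)"

lemma pdim_Suc: "pdim (Suc n) L \<longleftrightarrow> (\<exists>K P. projective A P \<and> ext K P L \<and> pdim n K)"
  unfolding pdim_def by auto

text \<open>
  The approximation of Auslander and Buchweitz: by induction \<open>K\<close> is \<open>G1 / L\<close> with \<open>L\<close> of small projective
  dimension.  Embedding \<open>G1\<close> in a projective \<open>Q\<close> embeds \<open>K\<close> in \<open>Q / L\<close> with Gorenstein projective cokernel,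
  and pushing out along this embedding replaces \<open>K\<close> by \<open>Q / L\<close>.
\<close>

lemma gp_approximation:
  "gdim n M \<Longrightarrow> \<exists>L G. gp G \<and> ext L G M \<and> pdim n L"
proof (induction n arbitrary: M)
  case 0
  obtain z where z: "is_zero A z" using ex_zero by blast
  from 0 show ?case using ext_zero_left[OF z gp_Ob] z by (auto simp: pdim_def)
next
  case (Suc n)
  obtain K G where K: "gp G" "ext K G M" "gdim n K" using Suc.prems by auto
  obtain L G1 where L: "gp G1" "ext L G1 K" "pdim n L" using Suc.IH[OF K(3)] by blast
  obtain G2 Q where Q: "projective A Q" "ext G1 Q G2" "gp G2" using L(1) by (auto elim: gp.cases)
  obtain N where N: "ext L Q N" "ext K N G2" by (rule ext_quotient[OF L(2) Q(2)])
  obtain X where X: "ext N X M" "ext G X G2" by (rule ext_pushout[OF K(2) N(2)])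
  have "gp X" by (rule gp_ext[OF K(1) Q(3) X(2)])
  moreover have "pdim (Suc n) N" using pdim_Suc Q(1) N(1) L(3) by blast
  ultimately show ?case using X(1) by blast
qed

text \<open>
  In an extension \<open>k\<close> of \<open>L\<close> by \<open>G\<close> the contribution of \<open>L\<close> disappears after \<open>n\<close> horseshoe steps.  The
  statement is about an \<open>M\<close> of which \<open>k\<close> is a syzygy, so that the isomorphism left at the end can be
  absorbed in the last short exact sequence.
\<close>

lemma syz_of_extension:
  "\<lbrakk>ext k P M; projective A P; ext G k L; pdim n L; syz n G G'\<rbrakk> \<Longrightarrow> syz (Suc n) M G'"
proof (induction n arbitrary: k P M G L)
  case 0
  hence "is_zero A L" by (auto simp: pdim_def)
  hence "isomorphic A G k" using isomorphic_of_ext_zero_right 0 by blast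
  hence "ext G P M" using ext_iso_left 0 by blast
  thus ?case using 0 by auto
next
  case (Suc n)
  obtain G1 Q where G1: "projective A Q" "ext G1 Q G" "syz n G1 G'" using Suc.prems(5) by auto
  obtain L1 R where L1: "projective A R" "ext L1 R L" "pdim n L1" using Suc.prems(4) pdim_Suc by blast
  obtain k' s where k': "projective A s" "ext k' s k" "ext G1 k' L1"
    by (rule horseshoe[OF Suc.prems(3) G1(2) L1(2) G1(1) L1(1)])
  have "syz (Suc n) k G'" by (rule Suc.IH[OF k'(2,1,3) L1(3) G1(3)])
  thus ?case using Suc.prems(1,2) by (metis syz.simps(2))
qed

text \<open>
  If \<open>G \<rightarrow> M\<close> has kernel of projective dimension less than \<open>n\<close>, then \<open>G\<close> and \<open>M\<close> have a common
  \<open>(n + 1)\<close>-st syzygy.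
\<close>

lemma syz_of_cokernel:
  assumes "ext L G M" "pdim n L" "syz (Suc n) G G'"
  shows "syz (Suc n) M G'"
proof -
  obtain G1 P where G1: "projective A P" "ext G1 P G" "syz n G1 G'" using assms(3) by auto
  obtain k where k: "ext k P M" "ext G1 k L" by (rule ext_preimage[OF assms(1) G1(2)])
  show ?thesis by (rule syz_of_extension[OF k(1) G1(1) k(2) assms(2) G1(3)])
qed

lemma syz_mult: "syz r G G \<Longrightarrow> syz (k * r) G G"
  by (induction k) (auto intro: syz_append)

text \<open>
  A multiple of the period of \<open>G\<close> exceeds \<open>n + 1\<close>; beyond the \<open>(n + 1)\<close>-st syzygy the resolutions of \<open>G\<close>
  and \<open>M\<close> agree, so \<open>G\<close> itself occurs as a syzygy of \<open>M\<close>.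
\<close>

lemma periodic_approximation:
  assumes "gdim n M" and per: "\<And>G. gp G \<Longrightarrow> \<exists>r\<ge>1. syz r G G"
  obtains s L G where "s \<ge> 1" "syz (Suc s) M G" "ext L G M" "pdim n L"
proof -
  obtain L G where G: "gp G" "ext L G M" "pdim n L" using gp_approximation[OF assms(1)] by blast
  obtain r where r: "r \<ge> 1" "syz r G G" using per[OF G(1)] by blast
  \<comment> \<open>The factor \<open>n + 2\<close> instead of \<open>n + 1\<close> ensures \<open>s \<ge> 1\<close>: the two homology objects lie in different degrees.\<close>
  define m where "m = (n + 2) * r - Suc n"
  have "n + 2 \<le> (n + 2) * r" using mult_le_mono2[OF r(1), of "n + 2"] by simp
  hence m: "(n + 2) * r = Suc n + m" "m \<ge> 1" unfolding m_def by linarith+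
  have "syz (Suc n + m) G G" using syz_mult[OF r(2), of "n + 2"] m(1) by metis
  then obtain G' where G': "syz (Suc n) G G'" "syz m G' G" using syz_split by blast
  have "syz (Suc n + m) M G" by (rule syz_append[OF syz_of_cokernel[OF G(2,3) G'(1)] G'(2)])
  thus ?thesis using that[of "n + m"] m(2) G by auto
qed

section \<open>Complexes built from and split into short exact sequences\<close>

text \<open>
  Both arrows are kernels of cokernels of the same \<open>f\<close>, so each factors through the other.
\<close>

lemma image_unique:
  assumes "is_image A f m" "is_image A f m'"
  shows "isomorphic A (Dom A m) (Dom A m')"
proof -
  obtain c c' where c: "is_cokernel A f c" "is_kernel A c m" and c': "is_cokernel A f c'" "is_kernel A c' m'"
    using assms unfolding is_image_def by blast
  have fac: "\<exists>x\<in>Hom A (Dom A m) (Dom A m'). m' \<cdot> x = m"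
    if c: "is_cokernel A f c" "is_kernel A c m" and c': "is_cokernel A f c'" "is_kernel A c' m'" for c c' m m'
  proof -
    note [simp] = is_cokernel_simps[OF c(1)] is_kernel_simps[OF c(2)] is_cokernel_simps[OF c'(1)] is_kernel_simps[OF c'(2)]
    have "\<exists>h\<in>Hom A (Cod A c) (Cod A c'). h \<cdot> c = c'"
      using is_cokernelD(3)[OF c'(1)] by (intro is_cokernelD(5)[OF c(1)]) (simp_all add: hom_iff)
    then obtain h where h: "h \<in> Hom A (Cod A c) (Cod A c')" "h \<cdot> c = c'" by blast
    note [simp] = HomD[OF h(1)]
    have "(h \<cdot> c) \<cdot> m = h \<cdot> (c \<cdot> m)" by simp
    hence "c' \<cdot> m = Zero A (Dom A m) (Cod A c')" unfolding h(2) is_kernelD(3)[OF c(2)] by simp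
    thus ?thesis by (intro is_kernelD(5)[OF c'(2)]) (simp_all add: hom_iff)
  qed
  obtain x where x: "x \<in> Hom A (Dom A m) (Dom A m')" "m' \<cdot> x = m" using fac[OF c c'] by blast
  obtain y where y: "y \<in> Hom A (Dom A m') (Dom A m)" "m \<cdot> y = m'" using fac[OF c' c] by blast
  note [simp] = is_kernel_simps(1)[OF c(2)] is_kernel_simps(1)[OF c'(2)] HomD[OF x(1)] HomD[OF y(1)]
  have [simp]: "Cod A m = Dom A c" "Cod A m' = Dom A c"
    using is_kernel_simps(3)[OF c(2)] is_kernel_simps(3)[OF c'(2)]
      is_cokernel_simps(3)[OF c(1)] is_cokernel_simps(3)[OF c'(1)] by simp_all
  have "m \<cdot> (y \<cdot> x) = m \<cdot> Id A (Dom A m)"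
    using comp_eq_comp[OF y(2), of x] x(2) by simp
  hence 1: "y \<cdot> x = Id A (Dom A m)" by (rule monicD[OF is_kernelD(4)[OF c(2)]]) (simp_all add: hom_iff)
  have "m' \<cdot> (x \<cdot> y) = m' \<cdot> Id A (Dom A m')"
    using comp_eq_comp[OF x(2), of y] y(2) by simp
  hence 2: "x \<cdot> y = Id A (Dom A m')" by (rule monicD[OF is_kernelD(4)[OF c'(2)]]) (simp_all add: hom_iff)
  show ?thesis unfolding isomorphic_def
    by (intro conjI bexI[of _ x] bexI[of _ y] 1 2 x y) simp_all
qed

lemma ex_homology:
  assumes "chain_complex A X"
  shows "\<exists>H. is_homology A X i H"
proof -
  have d: "diff X i \<in> Hom A (obj X i) (obj X (i - 1))" "diff X (i + 1) \<in> Hom A (obj X (i + 1)) (obj X i)"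
    and dd: "diff X i \<cdot> diff X (i + 1) = Zero A (obj X (i + 1)) (obj X (i - 1))"
    using assms unfolding chain_complex_def by (metis add_diff_cancel_right')+
  note [simp] = HomD[OF d(1)] HomD[OF d(2)]
  obtain k where k: "is_kernel A (diff X i) k" using ex_kernel[of "diff X i"] by auto
  have "\<exists>u\<in>Hom A (obj X (i + 1)) (Dom A k). k \<cdot> u = diff X (i + 1)"
    by (rule is_kernelD(5)[OF k]) (simp_all add: hom_iff dd)
  then obtain u where u: "u \<in> Hom A (obj X (i + 1)) (Dom A k)" "k \<cdot> u = diff X (i + 1)" by blast
  obtain c where "is_cokernel A u c" using ex_cokernel[of u] HomD[OF u(1)] by auto
  thus ?thesis unfolding is_homology_def using k u by blast
qed

text \<open>
  Two choices of kernel are isomorphic compatibly with the arrows into them, hence so are the cokernels.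
  This identifies the object chosen by \<open>homology\<close> with any explicitly constructed one.
\<close>

lemma homology_unique:
  assumes "is_homology A X i H" "is_homology A X i H'"
  shows "isomorphic A H H'"
proof -
  have fac: "\<exists>h\<in>Hom A (Cod A c) (Cod A c'). h \<cdot> c = c' \<cdot> \<phi>"
    if k: "is_kernel A (diff X i) k" and u: "u \<in> Hom A (obj X (i + 1)) (Dom A k)" "k \<cdot> u = diff X (i + 1)"
      and c: "is_cokernel A u c"
      and k': "is_kernel A (diff X i) k'" and u': "u' \<in> Hom A (obj X (i + 1)) (Dom A k')" "k' \<cdot> u' = diff X (i + 1)"
      and c': "is_cokernel A u' c'"
      and \<phi>: "\<phi> \<in> Hom A (Dom A k) (Dom A k')" "k' \<cdot> \<phi> = k"
    for k u c k' u' c' \<phi>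
  proof -
    note [simp] = is_kernel_simps[OF k] is_kernel_simps(1,3)[OF k'] is_cokernel_simps[OF c] is_cokernel_simps[OF c']
      HomD[OF u(1)] HomD[OF u'(1)] HomD[OF \<phi>(1)]
    have "k' \<cdot> (\<phi> \<cdot> u) = k' \<cdot> u'" using comp_eq_comp[OF \<phi>(2), of u] u(2) u'(2) by simp
    hence "\<phi> \<cdot> u = u'" by (rule monicD[OF is_kernelD(4)[OF k']]) (simp_all add: hom_iff)
    hence "c' \<cdot> \<phi> \<cdot> u = Zero A (obj X (i + 1)) (Cod A c')" using is_cokernelD(3)[OF c'] by simp
    thus ?thesis by (intro is_cokernelD(5)[OF c]) (simp_all add: hom_iff)
  qed
  obtain k u c where k: "is_kernel A (diff X i) k" and u: "u \<in> Hom A (obj X (i + 1)) (Dom A k)" "k \<cdot> u = diff X (i + 1)"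
      and c: "is_cokernel A u c" "Cod A c = H"
    using assms(1) unfolding is_homology_def by blast
  obtain k' u' c' where k': "is_kernel A (diff X i) k'" and u': "u' \<in> Hom A (obj X (i + 1)) (Dom A k')" "k' \<cdot> u' = diff X (i + 1)"
      and c': "is_cokernel A u' c'" "Cod A c' = H'"
    using assms(2) unfolding is_homology_def by blast
  note [simp] = is_kernel_simps[OF k] is_kernel_simps(1,3)[OF k'] is_cokernel_simps[OF c(1)] is_cokernel_simps[OF c'(1)]
      HomD[OF u(1)] HomD[OF u'(1)]
  have "\<exists>\<phi>\<in>Hom A (Dom A k) (Dom A k'). k' \<cdot> \<phi> = k"
    using is_kernelD(3)[OF k] by (intro is_kernelD(5)[OF k']) (simp_all add: hom_iff)
  then obtain \<phi> where \<phi>: "\<phi> \<in> Hom A (Dom A k) (Dom A k')" "k' \<cdot> \<phi> = k" by blast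
  have "\<exists>\<phi>\<in>Hom A (Dom A k') (Dom A k). k \<cdot> \<phi> = k'"
    using is_kernelD(3)[OF k'] by (intro is_kernelD(5)[OF k]) (simp_all add: hom_iff)
  then obtain \<psi> where \<psi>: "\<psi> \<in> Hom A (Dom A k') (Dom A k)" "k \<cdot> \<psi> = k'" by blast
  note [simp] = HomD[OF \<phi>(1)] HomD[OF \<psi>(1)]
  have "k \<cdot> (\<psi> \<cdot> \<phi>) = k \<cdot> Id A (Dom A k)" using comp_eq_comp[OF \<psi>(2), of \<phi>] \<phi>(2) by simp
  hence 1: "\<psi> \<cdot> \<phi> = Id A (Dom A k)" by (rule monicD[OF is_kernelD(4)[OF k]]) (simp_all add: hom_iff)
  have "k' \<cdot> (\<phi> \<cdot> \<psi>) = k' \<cdot> Id A (Dom A k')" using comp_eq_comp[OF \<phi>(2), of \<psi>] \<psi>(2) by simp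
  hence 2: "\<phi> \<cdot> \<psi> = Id A (Dom A k')" by (rule monicD[OF is_kernelD(4)[OF k']]) (simp_all add: hom_iff)
  obtain f where f: "f \<in> Hom A (Cod A c) (Cod A c')" "f \<cdot> c = c' \<cdot> \<phi>"
    using fac[OF k u c(1) k' u' c'(1) \<phi>] by blast
  obtain g where g: "g \<in> Hom A (Cod A c') (Cod A c)" "g \<cdot> c' = c \<cdot> \<psi>"
    using fac[OF k' u' c'(1) k u c(1) \<psi>] by blast
  note [simp] = HomD[OF f(1)] HomD[OF g(1)]
  have "g \<cdot> f \<cdot> c = Id A (Cod A c) \<cdot> c"
    using comp_eq_comp[OF g(2), of \<phi>] by (simp add: f(2) 1)
  hence 3: "g \<cdot> f = Id A (Cod A c)" by (rule epicD[OF is_cokernelD(4)[OF c(1)]]) (simp_all add: hom_iff)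
  have "f \<cdot> g \<cdot> c' = Id A (Cod A c') \<cdot> c'"
    using comp_eq_comp[OF f(2), of \<psi>] by (simp add: g(2) 2)
  hence 4: "f \<cdot> g = Id A (Cod A c')" by (rule epicD[OF is_cokernelD(4)[OF c'(1)]]) (simp_all add: hom_iff)
  have "isomorphic A (Cod A c) (Cod A c')" unfolding isomorphic_def
    by (intro conjI bexI[of _ f] bexI[of _ g] 3 4 f g) simp_all
  thus ?thesis using c(2) c'(2) by simp
qed

lemma is_homology_homology: "chain_complex A X \<Longrightarrow> is_homology A X i (homology A X i)"
  unfolding homology_def using ex_homology by (rule someI_ex)

text \<open>
  The boundaries are the image of the arrow into the cycles, that is, the kernel of its cokernel, the
  homology.  By image factorization the differential is an epimorphism onto the boundaries followed by
  a monomorphism, so the epimorphism has the same kernel.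
\<close>

lemma cycles_and_boundaries:
  assumes X: "chain_complex A X"
  obtains Z B where "\<And>i. ext (Z i) (obj X i) (B (i - 1))" "\<And>i. ext (B i) (Z i) (homology A X i)"
proof -
  have "\<exists>Z B b c e k. ses b c B Z (homology A X i) \<and> is_kernel A (diff X i) k \<and> Dom A k = Z \<and>
     e \<in> Hom A (obj X (i + 1)) B \<and> epic A e \<and> (k \<cdot> b) \<cdot> e = diff X (i + 1)" for i
  proof -
    obtain k u c where k: "is_kernel A (diff X i) k" and u: "u \<in> Hom A (obj X (i + 1)) (Dom A k)" "k \<cdot> u = diff X (i + 1)"
      and c: "is_cokernel A u c" "Cod A c = homology A X i"
      using is_homology_homology[OF X, of i] unfolding is_homology_def by blast
    note [simp] = is_kernel_simps[OF k] is_cokernel_simps[OF c(1)] HomD[OF u(1)]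
    obtain b where b: "is_kernel A c b" using ex_kernel[of c] by auto
    note [simp] = is_kernel_simps[OF b]
    obtain e where e: "e \<in> Hom A (obj X (i + 1)) (Dom A b)" "b \<cdot> e = u" "epic A e"
      by (rule image_factorization[OF u(1) c(1) b])
    note [simp] = HomD[OF e(1)]
    have "ses b c (Dom A b) (Dom A k) (homology A X i)"
      using b cokernel_of_kernel[OF is_cokernelD(4)[OF c(1)] b] c(2) by (simp add: ses_def hom_iff)
    moreover have "(k \<cdot> b) \<cdot> e = diff X (i + 1)" using e(2) u(2) by simp
    ultimately show ?thesis using k e by blast
  qed
  then obtain Z B b c e k where S: "\<And>i. ses (b i) (c i) (B i) (Z i) (homology A X i)"
    and k: "\<And>i. is_kernel A (diff X i) (k i)" "\<And>i. Dom A (k i) = Z i"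
    and e: "\<And>i. e i \<in> Hom A (obj X (i + 1)) (B i)" "\<And>i. epic A (e i)"
    and kbe: "\<And>i. (k i \<cdot> b i) \<cdot> e i = diff X (i + 1)"
    by metis
  have "ext (Z i) (obj X i) (B (i - 1))" for i
  proof -
    have d: "diff X (i - 1) \<in> Hom A (obj X (i - 1)) (obj X (i - 1 - 1))" "obj X i \<in> Ob A"
      "diff X i \<in> Hom A (obj X i) (obj X (i - 1))"
      using X unfolding chain_complex_def by blast+
    have [simp]: "Cod A (k (i - 1)) = obj X (i - 1)" "k (i - 1) \<in> Arr A" "Dom A (k (i - 1)) = Z (i - 1)"
      "Cod A (k i) = obj X i" "k i \<in> Arr A" "Dom A (k i) = Z i"
      using is_kernel_simps[OF k(1)[of "i - 1"]] is_kernel_simps[OF k(1)[of i]] HomD[OF d(1)] HomD[OF d(3)] k(2) by simp_all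
    note [simp] = ses_simps(1-9)[OF S[of "i - 1"]]
    have e': "e (i - 1) \<in> Hom A (obj X i) (B (i - 1))" using e(1)[of "i - 1"] by simp
    have "monic A (k (i - 1) \<cdot> b (i - 1))"
      by (rule monic_comp[OF ses_monic[OF S] _ is_kernelD(4)[OF k(1)], where b = "Z (i - 1)"]) (simp_all add: hom_iff)
    moreover have "k (i - 1) \<cdot> b (i - 1) \<in> Hom A (B (i - 1)) (obj X (i - 1))" by (simp add: hom_iff)
    moreover have "is_kernel A ((k (i - 1) \<cdot> b (i - 1)) \<cdot> e (i - 1)) (k i)"
      using k(1)[of i] kbe[of "i - 1"] by simp
    ultimately have K: "is_kernel A (e (i - 1)) (k i)" using is_kernel_of_monic_comp e' by blast
    have "ses (k i) (e (i - 1)) (Z i) (obj X i) (B (i - 1))"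
      using K cokernel_of_kernel[OF e(2) K] e' by (simp add: ses_def hom_iff)
    thus ?thesis unfolding ext_def by blast
  qed
  with S that show ?thesis unfolding ext_def by blast
qed

text \<open>
  Cycles, boundaries and homology that fit together at the level of objects can be spliced: the
  differential is the composite \<open>T\<^sub>i \<rightarrow> B\<^sub>i\<^sub>-\<^sub>1 \<rightarrow> Z\<^sub>i\<^sub>-\<^sub>1 \<rightarrow> T\<^sub>i\<^sub>-\<^sub>1\<close>.
\<close>

lemma complex_of_cycles:
  assumes Z: "\<And>i. ext (Z i) (T i) (B (i - 1))" and B: "\<And>i. ext (B i) (Z i) (H i)"
  obtains X where "obj X = T" "chain_complex A X" "\<And>i. isomorphic A (homology A X i) (H i)"
proof -
  obtain \<zeta> \<pi> where S: "\<And>i. ses (\<zeta> i) (\<pi> i) (Z i) (T i) (B (i - 1))" using Z unfolding ext_def by metis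
  obtain \<beta> \<eta> where R: "\<And>i. ses (\<beta> i) (\<eta> i) (B i) (Z i) (H i)" using B unfolding ext_def by metis
  note [simp] = ses_simps(1-9)[OF S] ses_simps(1-9)[OF R]
  define X where "X = \<lparr>obj = T, diff = (\<lambda>i. (\<zeta> (i - 1) \<cdot> \<beta> (i - 1)) \<cdot> \<pi> i)\<rparr>"
  have X [simp]: "obj X = T" "diff X i = (\<zeta> (i - 1) \<cdot> \<beta> (i - 1)) \<cdot> \<pi> i" for i
    by (simp_all add: X_def)
  have S': "ses (\<zeta> (i + 1)) (\<pi> (i + 1)) (Z (i + 1)) (T (i + 1)) (B i)" for i
    using S[of "i + 1"] by simp
  have [simp]: "\<pi> (i + 1) \<in> Arr A" "Dom A (\<pi> (i + 1)) = T (i + 1)" "Cod A (\<pi> (i + 1)) = B i" for i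
    using ses_simps[OF S'] by simp_all
  have XC: "chain_complex A X"
    unfolding chain_complex_def
  proof (intro allI conjI)
    fix i
    show "obj X i \<in> Ob A" "diff X i \<in> Hom A (obj X i) (obj X (i - 1))" by (simp_all add: hom_iff)
    show "diff X i \<cdot> diff X (i + 1) = Zero A (obj X (i + 1)) (obj X (i - 1))"
      using ses_simps(11)[OF S[of i], of "\<beta> i \<cdot> \<pi> (i + 1)"] by simp
  qed
  have H: "is_homology A X i (H i)" for i
    unfolding is_homology_def
  proof (intro exI conjI)
    have "monic A (\<zeta> (i - 1) \<cdot> \<beta> (i - 1))"
      by (rule monic_comp[OF ses_monic[OF R] _ ses_monic[OF S], where b = "Z (i - 1)"]) (simp_all add: hom_iff)
    thus "is_kernel A (diff X i) (\<zeta> i)" unfolding X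
      by (rule is_kernel_monic_comp[where b = "B (i - 1)" and c = "T (i - 1)" and a = "T i"])
        (use S[of i] in \<open>simp_all add: hom_iff ses_def\<close>)
    show "\<beta> i \<cdot> \<pi> (i + 1) \<in> Hom A (obj X (i + 1)) (Dom A (\<zeta> i))" by (simp add: hom_iff)
    show "\<zeta> i \<cdot> (\<beta> i \<cdot> \<pi> (i + 1)) = diff X (i + 1)" by simp
    show "is_cokernel A (\<beta> i \<cdot> \<pi> (i + 1)) (\<eta> i)"
      by (rule is_cokernel_comp_epic[OF ses_epic[OF S'], where a = "T (i + 1)" and b = "B i" and c = "Z i"])
        (use R[of i] in \<open>simp_all add: hom_iff ses_def\<close>)
    show "Cod A (\<eta> i) = H i" by simp
  qed
  show ?thesis by (rule that[OF X(1) XC homology_unique[OF is_homology_homology[OF XC] H]])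
qed

text \<open>
  For exact complexes the arrows are kept, because total acyclicity speaks about the differentials.
\<close>

lemma exact_complex_of_cycles:
  assumes Z: "\<And>i. ext (Z i) (T i) (Z (i - 1))"
  obtains X m e where "obj X = T" "exact_complex A X" "\<And>i. ses (m i) (e i) (Z i) (T i) (Z (i - 1))"
    "\<And>i. diff X i = m (i - 1) \<cdot> e i" "\<And>i. is_image A (diff X (i + 1)) (m i)"
proof -
  obtain m e where S: "\<And>i. ses (m i) (e i) (Z i) (T i) (Z (i - 1))" using Z unfolding ext_def by metis
  note [simp] = ses_simps(1-9)[OF S]
  define X where "X = \<lparr>obj = T, diff = (\<lambda>i. m (i - 1) \<cdot> e i)\<rparr>"
  have X [simp]: "obj X = T" "diff X i = m (i - 1) \<cdot> e i" for i by (simp_all add: X_def)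
  have S': "ses (m (i + 1)) (e (i + 1)) (Z (i + 1)) (T (i + 1)) (Z i)" for i
    using S[of "i + 1"] by simp
  have [simp]: "e (i + 1) \<in> Arr A" "Dom A (e (i + 1)) = T (i + 1)" "Cod A (e (i + 1)) = Z i" for i
    using ses_simps[OF S'] by simp_all
  have img: "is_image A (diff X (i + 1)) (m i)" for i
    unfolding is_image_def
  proof (intro exI conjI)
    have "is_cokernel A (m i \<cdot> e (i + 1)) (e i)"
      by (rule is_cokernel_comp_epic[OF ses_epic[OF S'], where a = "T (i + 1)" and b = "Z i" and c = "T i"])
        (use S[of i] in \<open>simp_all add: hom_iff ses_def\<close>)
    thus "is_cokernel A (diff X (i + 1)) (e i)" by simp
    show "is_kernel A (e i) (m i)" using S[of i] by (simp add: ses_def)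
  qed
  have ker: "is_kernel A (diff X i) (m i)" for i
    unfolding X
    by (rule is_kernel_monic_comp[OF ses_monic[OF S], where b = "Z (i - 1)" and c = "T (i - 1)" and a = "T i"])
      (use S[of i] in \<open>simp_all add: hom_iff ses_def\<close>)
  have "exact_complex A X"
    unfolding exact_complex_def chain_complex_def exact_pair_def
  proof (intro allI conjI)
    fix i
    show "obj X i \<in> Ob A" "diff X i \<in> Hom A (obj X i) (obj X (i - 1))" by (simp_all add: hom_iff)
    show "diff X i \<cdot> diff X (i + 1) = Zero A (obj X (i + 1)) (obj X (i - 1))"
      using ses_simps(11)[OF S[of i], of "e (i + 1)"] by simp
    show "Cod A (diff X (i + 1)) = Dom A (diff X i)" by simp
    show "\<exists>m. is_image A (diff X (i + 1)) m \<and> is_kernel A (diff X i) m" using img ker by blast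
  qed
  thus ?thesis using that[OF X(1) _ S X(2) img] by simp
qed

lemma exact_complex_cycles:
  assumes X: "exact_complex A X"
  obtains Z m e where "\<And>i. ses (m i) (e i) (Z i) (obj X i) (Z (i - 1))"
    "\<And>i. diff X i = m (i - 1) \<cdot> e i" "\<And>i. is_image A (diff X (i + 1)) (m i)"
proof -
  have d: "diff X i \<in> Hom A (obj X i) (obj X (i - 1))" for i
    using X unfolding exact_complex_def chain_complex_def by blast
  have "\<exists>m e. is_image A (diff X (i + 1)) m \<and> is_kernel A (diff X i) m \<and>
     e \<in> Hom A (obj X (i + 1)) (Dom A m) \<and> m \<cdot> e = diff X (i + 1) \<and> epic A e" for i
  proof -
    obtain m where m: "is_image A (diff X (i + 1)) m" "is_kernel A (diff X i) m"
      using X unfolding exact_complex_def exact_pair_def by blast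
    obtain c where c: "is_cokernel A (diff X (i + 1)) c" "is_kernel A c m" using m unfolding is_image_def by blast
    show ?thesis using image_factorization[OF d c] m by metis
  qed
  then obtain m e where m: "\<And>i. is_image A (diff X (i + 1)) (m i)" "\<And>i. is_kernel A (diff X i) (m i)"
    and e: "\<And>i. e i \<in> Hom A (obj X (i + 1)) (Dom A (m i))" "\<And>i. m i \<cdot> e i = diff X (i + 1)" "\<And>i. epic A (e i)"
    by metis
  have "ses (m i) (e (i - 1)) (Dom A (m i)) (obj X i) (Dom A (m (i - 1)))" for i
  proof -
    have [simp]: "m i \<in> Arr A" "Cod A (m i) = obj X i" "m (i - 1) \<in> Arr A" "Cod A (m (i - 1)) = obj X (i - 1)"
      using is_kernel_simps[OF m(2)[of i]] is_kernel_simps[OF m(2)[of "i - 1"]] HomD[OF d[of i]] HomD[OF d[of "i - 1"]] by simp_all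
    have e': "e (i - 1) \<in> Hom A (obj X i) (Dom A (m (i - 1)))" "m (i - 1) \<cdot> e (i - 1) = diff X i"
      using e(1)[of "i - 1"] e(2)[of "i - 1"] by simp_all
    have "m (i - 1) \<in> Hom A (Dom A (m (i - 1))) (obj X (i - 1))" by (simp add: hom_iff)
    hence K: "is_kernel A (e (i - 1)) (m i)"
      using is_kernel_of_monic_comp[OF is_kernelD(4)[OF m(2)] _ e'(1)] m(2)[of i] e'(2) by metis
    show ?thesis using K cokernel_of_kernel[OF e(3) K] e'(1) by (simp add: ses_def hom_iff)
  qed
  moreover have "diff X i = m (i - 1) \<cdot> e (i - 1)" for i using e(2)[of "i - 1"] by simp
  ultimately show ?thesis using that[of m "\<lambda>i. e (i - 1)" "\<lambda>i. Dom A (m i)"] m(1) by blast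
qed

section \<open>Total acyclicity, resolutions and periodicity\<close>

text \<open>
  The complete resolution has the object \<open>G\<close> as its cycles in degree \<open>-1\<close>, iterated syzygies above and
  iterated cosyzygies below.  An arrow \<open>f\<close> into a projective object that vanishes on boundaries comes
  from the cycles one degree lower, and extends because the next cycles object is \<open>orth\<close>.
\<close>

lemma gorenstein_projective_of_gp:
  assumes G: "gp G"
  shows "gorenstein_projective A G"
proof -
  have "\<exists>G' P. gp H \<longrightarrow> gp G' \<and> projective A P \<and> ext H P G'" for H by (blast elim: gp.cases)
  then obtain co where co: "\<And>H. gp H \<Longrightarrow> gp (co H) \<and> (\<exists>P. projective A P \<and> ext H P (co H))" by metis
  have "\<exists>G' P. gp H \<longrightarrow> gp G' \<and> projective A P \<and> ext G' P H" for H by (blast elim: gp.cases)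
  then obtain sy where sy: "\<And>H. gp H \<Longrightarrow> gp (sy H) \<and> (\<exists>P. projective A P \<and> ext (sy H) P H)" by metis
  \<comment> \<open>Iterated syzygies upwards and iterated cosyzygies downwards from degree \<open>-1\<close>.\<close>
  define Z where "Z i = (if i \<ge> -1 then (sy ^^ nat (i + 1)) G else (co ^^ nat (-1 - i)) G)" for i :: int
  have gsy: "gp ((sy ^^ n) G)" and gco: "gp ((co ^^ n) G)" for n
    using G by (induction n) (simp_all add: co sy)
  have gZ: "gp (Z i)" for i by (simp add: Z_def gsy gco)
  have "\<exists>P. projective A P \<and> ext (Z i) P (Z (i - 1))" for i
  proof (cases "i \<ge> 0")
    case True
    hence "nat (i + 1) = Suc (nat (i - 1 + 1))" by simp
    hence "Z i = sy (Z (i - 1))" using True by (simp add: Z_def)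
    thus ?thesis using sy[OF gZ[of "i - 1"]] by simp
  next
    case False
    hence "nat (-1 - (i - 1)) = Suc (nat (-1 - i))" by simp
    hence "Z (i - 1) = co (Z i)" using False by (auto simp: Z_def)
    thus ?thesis using co[OF gZ[of i]] by simp
  qed
  then obtain T where T: "\<And>i. projective A (T i)" "\<And>i. ext (Z i) (T i) (Z (i - 1))" by metis
  obtain X m e where X: "obj X = T" "exact_complex A X" and S: "\<And>i. ses (m i) (e i) (Z i) (T i) (Z (i - 1))"
    and d: "\<And>i. diff X i = m (i - 1) \<cdot> e i" and img: "\<And>i. is_image A (diff X (i + 1)) (m i)"
    by (rule exact_complex_of_cycles[where Z = Z and T = T, OF T(2)]) (rule that)
  have "totally_acyclic A X"
    unfolding totally_acyclic_def
  proof (intro conjI allI impI X(2))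
    show "projective A (obj X i)" for i using T(1) X(1) by simp
    fix Q i assume Q: "projective A Q"
    note [simp] = ses_simps[OF S[of i]] ses_simps[OF S[of "i - 1"]] X(1) d
    have S1: "ses (m (i + 1)) (e (i + 1)) (Z (i + 1)) (T (i + 1)) (Z i)" using S[of "i + 1"] by simp
    note [simp] = ses_simps[OF S1]
    show "{f \<in> Hom A (obj X i) Q. f \<cdot> diff X (i + 1) = Zero A (obj X (i + 1)) Q}
        = (\<lambda>g. g \<cdot> diff X i) ` Hom A (obj X (i - 1)) Q" (is "?L = ?R")
    proof (intro equalityI subsetI)
      fix f assume "f \<in> ?L"
      hence f: "f \<in> Hom A (T i) Q" "f \<cdot> (m i \<cdot> e (i + 1)) = Zero A (T (i + 1)) Q" by simp_all
      note [simp] = HomD[OF f(1)]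
      have "(f \<cdot> m i) \<cdot> e (i + 1) = Zero A (Z i) Q \<cdot> e (i + 1)" using f(2) by simp
      hence "f \<cdot> m i = Zero A (Z i) Q" by (rule epicD[OF ses_epic[OF S1]]) (simp_all add: hom_iff)
      then obtain u where u: "u \<in> Hom A (Z (i - 1)) Q" "u \<cdot> e i = f" by (rule ses_desc[OF S _ f(1)])
      obtain v where v: "v \<in> Hom A (T (i - 1)) Q" "v \<cdot> m (i - 1) = u"
        by (rule orthD[OF gp_orth[OF gZ] S Q u(1)])
      note [simp] = HomD[OF v(1)]
      have "v \<cdot> diff X i = (v \<cdot> m (i - 1)) \<cdot> e i" by simp
      hence "f = v \<cdot> diff X i" unfolding v(2) u(2) by simp
      thus "f \<in> ?R" using v(1) by auto
    next
      fix f assume "f \<in> ?R"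
      then obtain g where g: "g \<in> Hom A (T (i - 1)) Q" "f = g \<cdot> (m (i - 1) \<cdot> e i)" by auto
      note [simp] = HomD[OF g(1)]
      show "f \<in> ?L" using g(2) by (simp add: hom_iff)
    qed
  qed
  moreover have "is_image A (diff X 0) (m (-1))" using img[of "-1"] by simp
  moreover have "Dom A (m (-1)) = G" using ses_simps(2)[OF S[of "-1"]] by (simp add: Z_def)
  ultimately show ?thesis
    unfolding gorenstein_projective_def using isomorphic_refl[OF gp_Ob[OF G]] by metis
qed

text \<open>
  By coinduction on all cycles objects of the complete resolution at once; exactness of \<open>Hom(-, Q)\<close> is
  the extension property for their given presentations.
\<close>

lemma gp_of_gorenstein_projective:
  assumes "gorenstein_projective A G"
  shows "gp G"
proof -
  obtain X m' where X: "totally_acyclic A X" and m': "is_image A (diff X 0) m'" "isomorphic A G (Dom A m')"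
    using assms unfolding gorenstein_projective_def by blast
  have ex: "exact_complex A X" and P: "\<And>i. projective A (obj X i)"
    and tot: "\<And>Q i. projective A Q \<Longrightarrow>
        {f \<in> Hom A (obj X i) Q. f \<cdot> diff X (i + 1) = Zero A (obj X (i + 1)) Q}
        = (\<lambda>g. g \<cdot> diff X i) ` Hom A (obj X (i - 1)) Q"
    using X unfolding totally_acyclic_def by blast+
  obtain Z m e where S: "\<And>i. ses (m i) (e i) (Z i) (obj X i) (Z (i - 1))"
    and d: "\<And>i. diff X i = m (i - 1) \<cdot> e i" and img: "\<And>i. is_image A (diff X (i + 1)) (m i)"
    by (rule exact_complex_cycles[OF ex]) (rule that)
  have orth: "orth (Z (i - 1))" for i
  proof (rule orth_of_presentation[OF S P])
    fix Q u assume Q: "projective A Q" and u: "u \<in> Hom A (Z i) Q"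
    have S1: "ses (m (i + 1)) (e (i + 1)) (Z (i + 1)) (obj X (i + 1)) (Z i)" using S[of "i + 1"] by simp
    have S2: "ses (m (i + 2)) (e (i + 2)) (Z (i + 2)) (obj X (i + 2)) (Z (i + 1))" using S[of "i + 2"] by (simp add: add.commute)
    have d1: "diff X (i + 1) = m i \<cdot> e (i + 1)" and d2: "diff X (i + 1 + 1) = m (i + 1) \<cdot> e (i + 2)"
      using d[of "i + 1"] d[of "i + 2"] by (simp_all add: algebra_simps)
    have ii: "i + 1 + 1 = i + 2" by simp
    note [simp] = HomD[OF u] ses_simps[OF S1] ses_simps[OF S2] ses_simps[OF S[of i]]
    have "u \<cdot> e (i + 1) \<in> {f \<in> Hom A (obj X (i + 1)) Q. f \<cdot> diff X (i + 1 + 1) = Zero A (obj X (i + 1 + 1)) Q}"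
      unfolding d2 unfolding ii by (simp add: hom_iff)
    then obtain g where g: "g \<in> Hom A (obj X i) Q" "u \<cdot> e (i + 1) = g \<cdot> (m i \<cdot> e (i + 1))"
      unfolding tot[OF Q] d1 by auto
    note [simp] = HomD[OF g(1)]
    have "(g \<cdot> m i) \<cdot> e (i + 1) = u \<cdot> e (i + 1)" using g(2) by simp
    hence "g \<cdot> m i = u" by (rule epicD[OF ses_epic[OF S1]]) (simp_all add: hom_iff)
    thus "\<exists>v\<in>Hom A (obj X i) Q. v \<cdot> m i = u" using g(1) by blast
  qed
  have orth': "orth (Z i)" for i using orth[of "i + 1"] by simp
  have S': "ext (Z (i + 1)) (obj X (i + 1)) (Z i)" "ext (Z i) (obj X i) (Z (i - 1))" for i
    using S[of "i + 1"] S[of i] unfolding ext_def by auto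
  have gZ: "gp (Z i)" for i
  proof (coinduction arbitrary: i)
    case gp
    show ?case using orth' S' P by metis
  qed
  have "is_image A (diff X 0) (m (-1))" using img[of "-1"] by simp
  hence "isomorphic A (Dom A (m (-1))) (Dom A m')" using m'(1) by (rule image_unique)
  hence "isomorphic A (Z (-1)) G"
    using isomorphic_trans isomorphic_sym[OF m'(2)] ses_simps(2)[OF S[of "-1"]] by metis
  thus ?thesis using gp_iso[OF gZ] by blast
qed

lemma gorenstein_projective_iff: "gorenstein_projective A G \<longleftrightarrow> gp G"
  using gorenstein_projective_of_gp gp_of_gorenstein_projective by blast

lemma gdim_unroll:
  "gdim n M \<Longrightarrow> \<exists>K G. K 0 = M \<and> gp (K n) \<and> (\<forall>j<n. gp (G j) \<and> ext (K (Suc j)) (G j) (K j))"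
proof (induction n arbitrary: M)
  case 0
  thus ?case by (intro exI[of _ "\<lambda>_. M"]) simp
next
  case (Suc n)
  obtain K0 G0 where 0: "gp G0" "ext K0 G0 M" "gdim n K0" using Suc.prems by auto
  obtain K G where K: "K 0 = K0" "gp (K n)" "\<forall>j<n. gp (G j) \<and> ext (K (Suc j)) (G j) (K j)"
    using Suc.IH[OF 0(3)] by blast
  have "gp (case j of 0 \<Rightarrow> G0 | Suc i \<Rightarrow> G i) \<and>
      ext (case Suc j of 0 \<Rightarrow> M | Suc i \<Rightarrow> K i) (case j of 0 \<Rightarrow> G0 | Suc i \<Rightarrow> G i) (case j of 0 \<Rightarrow> M | Suc i \<Rightarrow> K i)"
    if "j < Suc n" for j
    using that 0 K by (cases j) auto
  thus ?case using K(2)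
    by (intro exI[of _ "case_nat M K"] exI[of _ "case_nat G0 G"]) auto
qed

text \<open>
  The cycles in degree \<open>i\<close> are the \<open>(i + 1)\<close>-st kernel of the resolution, so \<open>M\<close> is both the object and
  the cycles in degree \<open>-1\<close>.
\<close>

lemma gproj_resolution_of_gdim:
  assumes "gdim n M"
  shows "\<exists>X. gproj_resolution A M n X"
proof -
  obtain K G where K: "K 0 = M" "gp (K n)" and KG: "\<And>j. j < n \<Longrightarrow> gp (G j) \<and> ext (K (Suc j)) (G j) (K j)"
    using gdim_unroll[OF assms] by blast
  obtain z where z: "is_zero A z" using ex_zero by blast
  have M: "M \<in> Ob A"
  proof (cases n)
    case 0 thus ?thesis using gp_Ob[OF K(2)] K(1) by simp
  next
    case (Suc m) thus ?thesis using KG[of 0] ext_Ob K(1) by auto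
  qed
  define T where "T i = (if i < -1 then z else if i = -1 then M else if i < int n then G (nat i)
     else if i = int n then K n else z)" for i
  define Z where "Z i = (if i < -1 then z else if i < int n then K (nat (i + 1)) else z)" for i
  have zz: "ext z z z" using ext_zero_left[OF z] is_zero_simps(1)[OF z] by blast
  have "ext (Z i) (T i) (Z (i - 1))" for i
  proof -
    consider "i < -1" | "i = -1" | "0 \<le> i" "i < int n" | "i = int n" | "i > int n" by linarith
    thus ?thesis
    proof cases
      case 3
      hence "nat (i + 1) = Suc (nat i)" "nat i < n" by auto
      thus ?thesis using 3 KG[of "nat i"] by (auto simp: Z_def T_def)
    next
      case 4
      thus ?thesis using ext_zero_left[OF z gp_Ob[OF K(2)]] by (auto simp: Z_def T_def)
    qed (use zz ext_zero_right[OF z M] K(1) in \<open>auto simp: Z_def T_def\<close>)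
  qed
  then obtain X where X: "obj X = T" "exact_complex A X" using exact_complex_of_cycles by blast
  have "gp (T i)" if "0 \<le> i" "i \<le> int n" for i
    using that K KG by (auto simp: T_def)
  thus ?thesis
    unfolding gproj_resolution_def gorenstein_projective_iff
    using X z by (intro exI[of _ X]) (auto simp: T_def)
qed

text \<open>
  The cycles in degree \<open>n - 1 - j\<close> have dimension at most \<open>j\<close>, by induction from the top of the
  resolution, and those in degree \<open>-1\<close> are isomorphic to \<open>M\<close>.
\<close>

lemma gdim_of_gproj_resolution:
  assumes "gproj_resolution A M n X"
  shows "gdim n M"
proof -
  have ex: "exact_complex A X" and M: "obj X (-1) = M"
    and G: "\<And>i. 0 \<le> i \<Longrightarrow> i \<le> int n \<Longrightarrow> gp (obj X i)"
    and z: "\<And>i. i < -1 \<or> int n < i \<Longrightarrow> is_zero A (obj X i)"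
    using assms unfolding gproj_resolution_def gorenstein_projective_iff by auto
  obtain Z where S: "\<And>i. ext (Z i) (obj X i) (Z (i - 1))"
    using exact_complex_cycles[OF ex] unfolding ext_def by metis
  have "is_zero A (Z (int n))" using zero_of_ext_mid(2)[OF S[of "int n + 1"]] z by simp
  hence "isomorphic A (obj X (int n)) (Z (int n - 1))" using isomorphic_of_ext_zero_left[OF S] by blast
  hence "gp (Z (int n - 1))" by (rule gp_iso[rotated]) (simp add: G)
  have "j \<le> n \<Longrightarrow> gdim j (Z (int n - 1 - int j))" for j
  proof (induction j)
    case 0 thus ?case using \<open>gp (Z (int n - 1))\<close> by simp
  next
    case (Suc j)
    have e: "int n - 1 - int (Suc j) = (int n - 1 - int j) - 1" by simp
    have "gp (obj X (int n - 1 - int j))" by (rule G) (use Suc.prems in auto)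
    thus ?case using S[of "int n - 1 - int j"] Suc unfolding e by (auto simp del: of_nat_Suc)
  qed
  from this[of n] have "gdim n (Z (-1))" by simp
  moreover have "is_zero A (Z (-2))" using zero_of_ext_mid(1)[OF S[of "-2"]] z by simp
  hence "isomorphic A (Z (-1)) M" using isomorphic_of_ext_zero_right S[of "-1"] M by simp
  ultimately show ?thesis by (rule gdim_iso)
qed

lemma gpd_eq: "gpd A M = (INF n\<in>{n. gdim n M}. ereal (real n))"
  unfolding gpd_def using gproj_resolution_of_gdim gdim_of_gproj_resolution by (intro INF_cong) auto

lemma gpd_cases:
  assumes "gpd A M < \<infinity>"
  obtains n where "gdim n M" "gpd A M = ereal (real n)" "\<And>k. gdim k M \<Longrightarrow> n \<le> k"
proof -
  have "\<exists>n. gdim n M"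
  proof (rule ccontr)
    assume "\<not> ?thesis"
    hence "gpd A M = \<infinity>" unfolding gpd_eq by (simp add: top_ereal_def)
    with assms show False by simp
  qed
  hence n: "gdim (LEAST n. gdim n M) M" by (rule LeastI_ex)
  have le: "(LEAST n. gdim n M) \<le> k" if "gdim k M" for k using that by (rule Least_le)
  have "gpd A M = ereal (real (LEAST n. gdim n M))"
    unfolding gpd_eq by (intro antisym INF_lower INF_greatest) (use n le in auto)
  with n le that show ?thesis by blast
qed

lemma syz_of_periodic:
  assumes "periodic A G"
  shows "\<exists>r\<ge>1. syz r G G"
proof -
  obtain r :: int and X where r: "1 \<le> r" and ex: "exact_complex A X" and G: "obj X (-1) = G" "obj X r = G"
    and P: "\<And>i. 0 \<le> i \<Longrightarrow> i < r \<Longrightarrow> projective A (obj X i)"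
    and z: "\<And>i. i < -1 \<or> r < i \<Longrightarrow> is_zero A (obj X i)"
    using assms unfolding periodic_def by auto
  obtain Z where S: "\<And>i. ext (Z i) (obj X i) (Z (i - 1))"
    using exact_complex_cycles[OF ex] unfolding ext_def by metis
  have "is_zero A (Z (-2))" using zero_of_ext_mid(1)[OF S[of "-2"]] z by simp
  hence 1: "isomorphic A (Z (-1)) G" using isomorphic_of_ext_zero_right S[of "-1"] G(1) by simp
  have "is_zero A (Z r)" using zero_of_ext_mid(2)[OF S[of "r + 1"]] z by simp
  hence 2: "isomorphic A G (Z (r - 1))" using isomorphic_of_ext_zero_left S[of r] G(2) by simp
  have "-1 \<le> i \<Longrightarrow> i + int j < r \<Longrightarrow> syz j (Z i) (Z (i + int j))" for i j
  proof (induction j arbitrary: i)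
    case (Suc j)
    have "syz j (Z (i + 1)) (Z (i + 1 + int j))" by (rule Suc.IH) (use Suc.prems in auto)
    moreover have "i + 1 + int j = i + int (Suc j)" by simp
    moreover have "projective A (obj X (i + 1))" by (rule P) (use Suc.prems in auto)
    moreover have "ext (Z (i + 1)) (obj X (i + 1)) (Z i)" using S[of "i + 1"] by simp
    ultimately show ?case by (metis syz.simps(2))
  qed simp
  from this[of "-1" "nat r"] r have "syz (nat r) (Z (-1)) (Z (r - 1))" by simp
  moreover obtain k where k: "nat r = Suc k" using r by (metis Suc_diff_1 nat_0_less_mult_iff not_one_le_zero zero_less_nat_eq zero_less_one order.strict_trans2)
  ultimately have "syz (Suc k) G G" using syz_iso_left[OF _ 1] syz_iso_right[OF _ 2] by metis
  thus ?thesis by (intro exI[of _ "Suc k"]) auto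
qed

section \<open>The two inequalities\<close>

text \<open>
  A projective resolution of \<open>M\<close> is followed for \<open>s + 1\<close> steps, until its kernel is \<open>G\<close>; then it is
  continued by a projective resolution of \<open>L \<subseteq> G\<close> instead of \<open>G\<close>.  This creates the homology \<open>G / L = M\<close> in
  degree \<open>s\<close>, besides \<open>M\<close> in degree \<open>0\<close>, and the complex stops \<open>n\<close> degrees later.
\<close>

lemma qproj_resolution_exists:
  assumes M: "M \<in> Ob A" "\<not> is_zero A M"
    and s: "s \<ge> 1" and W: "syz (Suc s) M G" and LGM: "ext L G M" and pd: "pdim n L"
  shows "\<exists>X. finite_qproj_resolution A M X \<and> csup A X - hsup A X \<le> ereal (real n)"
proof -
  obtain K P where K: "K 0 = M" "K (Suc s) = G"
    and KP: "\<And>j. j < Suc s \<Longrightarrow> projective A (P j) \<and> ext (K (Suc j)) (P j) (K j)"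
    using syz_unroll[OF W] by blast
  obtain z where z: "is_zero A z" "syz n L z" using pd unfolding pdim_def by blast
  obtain J Q where J: "J 0 = L" "J n = z"
    and JQ: "\<And>j. j < n \<Longrightarrow> projective A (Q j) \<and> ext (J (Suc j)) (Q j) (J j)"
    using syz_unroll[OF z(2)] by blast
  have zO: "z \<in> Ob A" by (rule is_zero_simps(1)[OF z(1)])
  have zz: "ext z z z" by (rule ext_zero_left[OF z(1) zO])
  have left: "ext z Y Y" and right: "ext Y Y z" if "Y \<in> Ob A" for Y
    using ext_zero_left[OF z(1) that] ext_zero_right[OF z(1) that] by auto
  have JOb: "J j \<in> Ob A" if "j \<le> n" for j
  proof (cases "j = n")
    case False
    thus ?thesis using JQ[of j] ext_Ob that by auto
  qed (use J zO in simp)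
  \<comment> \<open>The zero object \<open>z\<close> is the end of the resolution of \<open>L\<close>; it fills all other degrees, so that \<open>B\<close> fits in degree \<open>s + n\<close>.\<close>
  define T where "T i = (if i < 0 then z else if i \<le> int s then P (nat i)
    else if i \<le> int (s + n) then Q (nat (i - int s - 1)) else z)" for i
  \<comment> \<open>In degree \<open>0\<close> everything is a cycle; in degree \<open>s\<close> the cycles are \<open>G\<close> and the boundaries \<open>L\<close>.\<close>
  define Z where "Z i = (if i < 0 then z else if i = 0 then P 0 else if i \<le> int s then K (nat (i + 1))
    else if i \<le> int (s + n) then J (nat (i - int s)) else z)" for i
  define B where "B i = (if i < 0 then z else if i < int s then K (nat (i + 1))
    else if i \<le> int (s + n) then J (nat (i - int s)) else z)" for i
  define H where "H i = (if i = 0 \<or> i = int s then M else z)" for i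
  have ZTB: "ext (Z i) (T i) (B (i - 1))" for i
  proof -
    consider "i < 0" | "i = 0" | "0 < i" "i \<le> int s" | "int s < i" "i \<le> int (s + n)"
      | "i = int (s + n) + 1" | "i > int (s + n) + 1" by linarith
    thus ?thesis
    proof cases
      case 2
      thus ?thesis using right[of "P 0"] KP[of 0] ext_Ob by (auto simp: Z_def T_def B_def)
    next
      case 3
      hence "nat (i + 1) = Suc (nat i)" "nat i < Suc s" by auto
      thus ?thesis using 3 KP[of "nat i"] by (auto simp: Z_def T_def B_def)
    next
      case 4
      hence "nat (i - int s) = Suc (nat (i - int s - 1))" "nat (i - int s - 1) < n" "\<not> i \<le> int s" "\<not> i - 1 < int s"
        "i \<noteq> 0" "\<not> i < 0" "\<not> i - 1 < 0" "i - 1 \<le> int (s + n)"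
        "nat (i - 1 - int s) = nat (i - int s - 1)"
        using s by auto
      thus ?thesis using 4 JQ[of "nat (i - int s - 1)"] by (simp add: Z_def T_def B_def)
    next
      case 5
      thus ?thesis using zz J by (simp add: Z_def T_def B_def)
    qed (use zz in \<open>auto simp: Z_def T_def B_def\<close>)
  qed
  have BZH: "ext (B i) (Z i) (H i)" for i
  proof -
    consider "i < 0" | "i = 0" | "0 < i" "i < int s" | "i = int s" | "int s < i" "i \<le> int (s + n)"
      | "i > int (s + n)" by linarith
    thus ?thesis
    proof cases
      case 2
      thus ?thesis using KP[of 0] K s by (auto simp: Z_def H_def B_def)
    next
      case 3
      hence "nat i < s" "nat (i + 1) = Suc (nat i)" by auto
      hence "K (nat (i + 1)) \<in> Ob A" using KP[of "nat i"] ext_Ob by auto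
      from right[OF this] show ?thesis using 3 by (auto simp: Z_def H_def B_def)
    next
      case 4
      hence "nat (i + 1) = Suc s" by auto
      thus ?thesis using 4 LGM J K s by (simp add: Z_def H_def B_def)
    next
      case 5
      hence "nat (i - int s) \<le> n" by auto
      from right[OF JOb[OF this]] show ?thesis using 5 s by (auto simp: Z_def H_def B_def)
    qed (use zz s in \<open>auto simp: Z_def H_def B_def\<close>)
  qed
  obtain X where X: "obj X = T" "chain_complex A X" and HX: "\<And>i. isomorphic A (homology A X i) (H i)"
    using complex_of_cycles[of Z T B H] ZTB BZH by metis
  have proj: "projective A (T i)" for i
    using zero_projective[OF z(1)] KP[of "nat i"] JQ[of "nat (i - int s - 1)"] by (auto simp: T_def)
  have Ts: "\<not> is_zero A (T (int s))"
  proof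
    assume "is_zero A (T (int s))"
    hence "is_zero A (Z (int s))" using zero_of_ext_mid(1)[OF ZTB] by blast
    hence "is_zero A (H (int s))" using zero_of_ext_mid(2)[OF BZH] by blast
    thus False using M by (simp add: H_def)
  qed
  have Tz: "is_zero A (T i)" if "i < 0 \<or> int (s + n) < i" for i using that z by (auto simp: T_def)
  hence range: "0 \<le> i \<and> i \<le> int (s + n)" if "\<not> is_zero A (T i)" for i using that by force
  have cinf: "0 \<le> cinf A X"
    unfolding cinf_def X(1) by (intro INF_greatest) (use range in auto)
  have cinfs: "cinf A X \<le> ereal (real_of_int (int s))"
    unfolding cinf_def X(1) by (rule INF_lower) (use Ts in simp)
  have csup: "csup A X \<le> ereal (real (s + n))"
    unfolding csup_def X(1)
  proof (rule SUP_least)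
    fix i assume "i \<in> {i. \<not> is_zero A (T i)}"
    hence "real_of_int i \<le> real_of_int (int (s + n))" using range unfolding of_int_le_iff by blast
    thus "ereal (real_of_int i) \<le> ereal (real (s + n))" by simp
  qed
  have hs: "\<not> is_zero A (homology A X (int s))"
    using is_zero_isomorphic[OF HX[of "int s"]] M by (auto simp: H_def)
  have hsup: "ereal (real s) \<le> hsup A X"
    unfolding hsup_def by (rule SUP_upper2[of "int s"]) (use hs in simp_all)
  have "qproj_resolution A M X"
    unfolding qproj_resolution_def
  proof (intro conjI allI exI[of _ "\<lambda>i. if i = 0 \<or> i = int s then 1 else 0"] impI)
    show "chain_complex A X" by (rule X(2))
    show "projective A (obj X i)" for i using proj X(1) by simp
    show "- \<infinity> < cinf A X" using cinf by (auto simp: less_le_trans)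
    show "\<exists>i. cinf A X \<le> ereal (real_of_int i) \<and> (if i = 0 \<or> i = int s then 1 else 0) \<noteq> (0::nat)"
      using cinfs by (intro exI[of _ "int s"]) simp
    show "\<exists>D. is_copower A M (if i = 0 \<or> i = int s then 1 else 0) D \<and> isomorphic A (homology A X i) D" for i
      using HX[of i] copower_one[OF M(1)] copower_zero[OF z(1) M(1)] by (intro exI[of _ "H i"]) (auto simp: H_def)
  qed
  moreover have "csup A X < \<infinity>" using csup by (rule le_less_trans) simp
  moreover have "csup A X - hsup A X \<le> ereal (real (s + n)) - ereal (real s)"
    by (rule ereal_minus_mono[OF csup hsup])
  ultimately show ?thesis unfolding finite_qproj_resolution_def by auto
qed

text \<open>
  Put \<open>t = s - h\<close>, where \<open>s\<close> and \<open>h\<close> are the top degrees of the complex and of its homology.  As long as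
  \<open>gdim (m + 1) M\<close> holds with \<open>m \<ge> t\<close>, the bound can be lowered to \<open>m\<close>.  Going up from the bottom of the
  complex, all cycles have dimension at most \<open>m\<close>, since they are iterated kernels; the boundaries in
  degree \<open>h\<close> are resolved by the exact top part of the complex, of length \<open>t - 1\<close>.  Their quotient, the
  homology in degree \<open>h\<close>, therefore has dimension at most \<open>m\<close>, and \<open>M\<close> is a summand of it.
\<close>

lemma gdim_of_qproj_resolution:
  assumes M: "\<not> is_zero A M" and X: "finite_qproj_resolution A M X" and n: "gdim n M"
  obtains t where "gdim t M" "csup A X - hsup A X = ereal (real t)"
proof -
  have XC: "chain_complex A X" and P: "\<And>i. projective A (obj X i)" and inf: "- \<infinity> < cinf A X"
    and sup: "csup A X < \<infinity>"
    using X unfolding finite_qproj_resolution_def qproj_resolution_def by auto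
  obtain a where "(\<exists>i. cinf A X \<le> ereal (real_of_int i) \<and> a i \<noteq> (0::nat)) \<and>
      (\<forall>i. cinf A X \<le> ereal (real_of_int i) \<longrightarrow>
           (\<exists>D. is_copower A M (a i) D \<and> isomorphic A (homology A X i) D))"
    using X[unfolded finite_qproj_resolution_def qproj_resolution_def,
      THEN conjunct1, THEN conjunct2, THEN conjunct2, THEN conjunct2] by (rule exE)
  note a = this[THEN conjunct1] and aD' = this[THEN conjunct2]
  have aD: "\<exists>D. is_copower A M (a i) D \<and> isomorphic A (homology A X i) D"
    if "cinf A X \<le> ereal (real_of_int i)" for i
    using aD' that by blast
  obtain Z B where ZXB: "\<And>i. ext (Z i) (obj X i) (B (i - 1))" and BZH: "\<And>i. ext (B i) (Z i) (homology A X i)"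
    by (rule cycles_and_boundaries[OF XC]) (rule that)
  have zH: "is_zero A (homology A X i)" if "is_zero A (obj X i)" for i
    using zero_of_ext_mid(2)[OF BZH[of i]] zero_of_ext_mid(1)[OF ZXB[of i] that] by blast
  have infl: "cinf A X \<le> ereal (real_of_int i)" if "\<not> is_zero A (obj X i)" for i
    unfolding cinf_def using that by (intro INF_lower) simp
  have supu: "ereal (real_of_int i) \<le> csup A X" if "\<not> is_zero A (obj X i)" for i
    unfolding csup_def using that by (intro SUP_upper) simp
  obtain lo where lo: "ereal lo < cinf A X" using inf ereal_dense2 by blast
  obtain hi where hi: "csup A X < ereal hi" using sup ereal_dense2 by blast
  have bounds: "\<lfloor>lo\<rfloor> \<le> i \<and> i \<le> \<lceil>hi\<rceil>" if "\<not> is_zero A (obj X i)" for i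
  proof -
    have "ereal lo < ereal (real_of_int i)" by (rule less_le_trans[OF lo infl[OF that]])
    moreover have "ereal (real_of_int i) < ereal hi" by (rule le_less_trans[OF supu[OF that] hi])
    ultimately have "lo < real_of_int i" "real_of_int i < hi" by simp_all
    thus ?thesis unfolding floor_le_iff le_ceiling_iff by linarith
  qed
  define N where "N = {i. \<not> is_zero A (obj X i)}"
  define S where "S = {i. \<not> is_zero A (homology A X i)}"
  have SN: "S \<subseteq> N" using zH by (auto simp: N_def S_def)
  have finN: "finite N" by (rule finite_subset[of _ "{\<lfloor>lo\<rfloor>..\<lceil>hi\<rceil>}"]) (use bounds in \<open>auto simp: N_def\<close>)
  hence finS: "finite S" using SN finite_subset by blast
  have "S \<noteq> {}"
  proof -
    obtain i where i: "cinf A X \<le> ereal (real_of_int i)" "a i \<noteq> 0" using a by blast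
    obtain D where D: "is_copower A M (a i) D" "isomorphic A (homology A X i) D" using aD[OF i(1)] by blast
    have "i \<in> S" using zero_of_copower[OF D(1) i(2)] is_zero_isomorphic[OF D(2)] M by (auto simp: S_def)
    thus ?thesis by blast
  qed
  define s h where "s = Max N" and "h = Max S"
  have "N \<noteq> {}" using \<open>S \<noteq> {}\<close> SN by blast
  hence s: "s \<in> N" "\<And>i. i \<in> N \<Longrightarrow> i \<le> s" using finN unfolding s_def by simp_all
  have h: "h \<in> S" "\<And>i. i \<in> S \<Longrightarrow> i \<le> h" using finS \<open>S \<noteq> {}\<close> unfolding h_def by simp_all
  have hs: "h \<le> s" using s h SN by blast
  have csup: "csup A X = ereal (real_of_int s)"
    unfolding csup_def N_def[symmetric] by (intro antisym SUP_least SUP_upper2[of s]) (use s in auto)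
  have hsup: "hsup A X = ereal (real_of_int h)"
    unfolding hsup_def S_def[symmetric] by (intro antisym SUP_least SUP_upper2[of h]) (use h in auto)
  define t where "t = nat (s - h)"
  have t: "int t = s - h" using hs by (simp add: t_def)
  have zX: "is_zero A (obj X i)" if "i > s" for i using s(2)[of i] that by (auto simp: N_def)
  have zHh: "is_zero A (homology A X i)" if "i > h" for i using h(2)[of i] that by (auto simp: S_def)
  have gX: "gdim m (obj X i)" for m i by (intro gdim_gp gp_projective P)
  have gH: "gdim m (homology A X i)" if "gdim m M" for m i
  proof (cases "is_zero A (obj X i)")
    case True
    thus ?thesis using zH gdim_zero by blast
  next
    case False
    obtain D where "is_copower A M (a i) D" "isomorphic A (homology A X i) D" using aD[OF infl[OF False]] by blast
    thus ?thesis using gdim_copower[OF _ that] gdim_iso isomorphic_sym by blast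
  qed
  have zBs: "is_zero A (B s)" using zero_of_ext_mid(2)[OF ZXB[of "s + 1"]] zX[of "s + 1"] by simp
  have gB: "h \<le> s - 1 - int k \<Longrightarrow> gdim k (B (s - 1 - int k))" for k
  proof (induction k)
    case 0
    have "is_zero A (Z s)" using zero_of_ext_ends[OF BZH zBs zHh] 0 by simp
    hence "isomorphic A (obj X s) (B (s - 1))" using isomorphic_of_ext_zero_left[OF ZXB] by blast
    from gdim_iso[OF gX[of 0] this] show ?case by simp
  next
    case (Suc k)
    let ?i = "s - 1 - int k"
    have e: "s - 1 - int (Suc k) = ?i - 1" by simp
    have "gdim k (Z ?i)"
      by (rule gdim_ext[OF BZH]) (use Suc in \<open>auto intro!: gdim_zero zHh\<close>)
    thus ?case using ZXB[of ?i] P gp_projective unfolding e gdim.simps by blast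
  qed
  have descend: "gdim m M" if m: "gdim (Suc m) M" "t \<le> m" for m
  proof -
    have gZ0: "gdim m (Z i)" if "i < \<lfloor>lo\<rfloor>" for i
      using bounds[of i] that zero_of_ext_mid(1)[OF ZXB[of i]] gdim_zero by force
    \<comment> \<open>The induction starts below the complex, where all cycles are zero.\<close>
    have "\<lfloor>lo\<rfloor> - 1 \<le> i \<Longrightarrow> gdim m (Z i)" for i
    proof (induction i rule: int_ge_induct)
      case base
      thus ?case by (intro gZ0) simp
    next
      case (step i)
      have "gdim m (B i)" by (rule gdim_kernel[OF BZH step.IH gH[OF m(1)]])
      hence B: "gdim (Suc m) (B i)" by (rule gdim_Suc)
      have "ext (Z (i + 1)) (obj X (i + 1)) (B i)" using ZXB[of "i + 1"] by simp
      from gdim_kernel[OF this gX B] show ?case .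
    qed
    with gZ0 have gZ: "gdim m (Z h)" by (cases "h < \<lfloor>lo\<rfloor>") auto
    have gHh: "gdim m (homology A X h)"
    proof (cases t)
      case 0
      hence "is_zero A (B h)" using t zBs by simp
      hence "isomorphic A (Z h) (homology A X h)" using isomorphic_of_ext_zero_left[OF BZH] by blast
      with gZ show ?thesis by (rule gdim_iso)
    next
      case (Suc t')
      then obtain m' where m': "m = Suc m'" "t' \<le> m'" using m(2) by (cases m) auto
      have "gdim t' (B (s - 1 - int t'))" by (rule gB) (use Suc t in simp)
      moreover have "s - 1 - int t' = h" using Suc t by simp
      ultimately have "gdim m' (B h)" using gdim_mono[OF m'(2)] by simp
      from gdim_cokernel[OF BZH this] gZ m'(1) show ?thesis by simp
    qed
    have "h \<in> N" using h(1) SN by blast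
    hence "cinf A X \<le> ereal (real_of_int h)" by (intro infl) (simp add: N_def)
    then obtain D where D: "is_copower A M (a h) D" "isomorphic A (homology A X h) D" using aD by blast
    have "a h \<noteq> 0"
    proof
      assume "a h = 0"
      hence "is_zero A D" using copower_0 D(1) by simp
      thus False using h(1) is_zero_isomorphic[OF isomorphic_sym[OF D(2)]] by (simp add: S_def)
    qed
    from gdim_of_copower[OF D(1) this gdim_iso[OF gHh D(2)] m(1)] show ?thesis .
  qed
  have "gdim t M"
  proof (cases "n \<le> t")
    case True
    thus ?thesis using gdim_mono n by blast
  next
    case False
    hence "t \<le> n" by simp
    from this n show ?thesis
      by (induction t rule: inc_induct) (use descend in \<open>auto\<close>)
  qed
  moreover have "csup A X - hsup A X = ereal (real t)"
    unfolding csup hsup using t by (simp add: of_int_diff[symmetric] del: of_int_diff)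
  ultimately show ?thesis by (rule that)
qed

end

theorem theorem1p1:
  fixes A :: "('o, 'm) cat" and M :: 'o
  assumes "abelian_category A"
    and "enough_projectives A"
    and "\<And>G. gorenstein_projective A G \<Longrightarrow> periodic A G"
    and "M \<in> Ob A"
    and "gpd A M < \<infinity>"
  shows "qpd A M = gpd A M"
proof -
  interpret abelian_enough_projectives A
    using assms(1,2) by (simp add: abelian_enough_projectives_def abelian_enough_projectives_axioms_def)
  obtain n where n: "gdim n M" "gpd A M = ereal (real n)" "\<And>k. gdim k M \<Longrightarrow> n \<le> k"
    by (rule gpd_cases[OF assms(5)]) (rule that)
  show ?thesis
  proof (cases "is_zero A M")
    case True
    hence "n \<le> 0" using n(3) gdim_zero by blast
    with n True show ?thesis by (simp add: qpd_def)
  next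
    case False
    have per: "\<exists>r\<ge>1. syz r G G" if "gp G" for G
      using syz_of_periodic[OF assms(3)[OF gorenstein_projective_of_gp[OF that]]] .
    obtain s L G where "s \<ge> 1" "syz (Suc s) M G" "ext L G M" "pdim n L"
      by (rule periodic_approximation[OF n(1) per])
    from qproj_resolution_exists[OF assms(4) False this]
    obtain X where X: "finite_qproj_resolution A M X" "csup A X - hsup A X \<le> ereal (real n)" by blast
    have "qpd A M = (INF X\<in>{X. finite_qproj_resolution A M X}. csup A X - hsup A X)"
      using False by (simp add: qpd_def)
    also have "\<dots> = ereal (real n)"
    proof (rule antisym)
      show "(INF X\<in>{X. finite_qproj_resolution A M X}. csup A X - hsup A X) \<le> ereal (real n)"
        using X by (intro INF_lower2[of X]) simp_all
      show "ereal (real n) \<le> (INF X\<in>{X. finite_qproj_resolution A M X}. csup A X - hsup A X)"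
      proof (rule INF_greatest)
        fix X assume "X \<in> {X. finite_qproj_resolution A M X}"
        then obtain t where "gdim t M" "csup A X - hsup A X = ereal (real t)"
          using gdim_of_qproj_resolution[OF False _ n(1)] by blast
        thus "ereal (real n) \<le> csup A X - hsup A X" using n(3) by simp
      qed
    qed
    finally show ?thesis using n(2) by simp
  qed
qed

end
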